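(* Let $\mu>2$, $\nu>1$, let $\lambda\in\sigma_{\mathcal L}=(-\infty,-\lambda_{\min}]\cup[\lambda_{\min},\infty)$ be given and let $\varepsilon>0$. There exists $\eta_0>0$ such that for all $0<\eta<\eta_0$ the operator $\mathcal F^{\pm,\varepsilon}_\lambda:C^1([R_{\min},R_{\max}])\to C^1([R_{\min},R_{\max}])$, $$\mathcal F^{\pm,\varepsilon}_\lambda[V](R)=V(R)-\eta\sum_{m\in\mathbb Z_*}\frac1m\int_R^{R_{\max}}\frac{4\pi}{r^2}\,\mathbf{Pl}^{\pm,\lambda,\varepsilon}_m[q,\widehat V_mS_m](r)\,dr ,$$ is bounded (with bound independent of $\lambda$) and invertible (with inverse bounded independently of $\lambda$).
   Context: Fixed data. $M>0$, $L_0>0$, $\kappa$ with $-2^{-2/3}\frac{M^2}{2L_0}<\kappa<0$ are fixed; constants may depend on them and on $\mu,\nu$, and are uniform in $\eta$. Steady states. Coordinates $(r,w,L)\in(0,\infty)\times\mathbb R\times[0,\infty)$. For $\eta\ge0$ the steady state is $f_\eta^{\mu,\nu}=\eta\varphi(E,L)$, $\varphi(E,L)=(E_0-E)_+^\mu(L-L_0)_+^\nu$, $E=\frac12w^2+\Psi_L(r)$, $\Psi_L(r)=\bar U(r)-\frac Mr+\frac L{2r^2}$, with $\bar U$ the radial solution of $\Delta\bar U=4\pi\bar\rho$ on $\mathbb R^3$ vanishing at infinity, $\bar\rho(r)=\frac\pi{r^2}\int\int f_\eta^{\mu,\nu}\,dw\,dL$, and $E_0-\bar U(0)=\kappa$,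 $E_0<0$ (existence is known). $\Omega$ is the compact support of $\varphi(E(r,w,L),L)$, $[R_{\min},R_{\max}]$ its projection to $r$, $[L_0,L_{\max}]$ its projection to $L$. $\varphi':=\partial_E\varphi$. Action-angle variables (for $\eta$ small). For each $L\in[L_0,L_{\max}]$, $\Psi_L$ has a unique nondegenerate minimum $r_L$; $E^L_{\min}:=\Psi_L(r_L)$. $\mathcal I:=\{(E,L):L_0\le L\le L_{\max},\ E^L_{\min}\le E\le E_0\}$; write $\mathbf I=(E,L)$. For $E>E^L_{\min}$, $r_-(\mathbf I)<r_+(\mathbf I)$ are the solutions of $\Psi_L(r_\pm)=E$; $T(\mathbf I)=2\int_{r_-}^{r_+}\frac{dr}{\sqrt{2E-2\Psi_L(r)}}$ (extended continuously to $E=E^L_{\min}$), $\omega=1/T$, $\lambda_{\min}=2\pi\min_{\mathcal I}\omega$. The angle $\theta\in\mathbb S^1=\mathbb R/\mathbb Z$ is $\theta(r,w,L)=\frac1{T(\mathbf I)}\int_{r_-(\mathbf I)}^r\frac{ds}{\sqrt{2E-2\Psi_L(s)}}$ for $w\ge0$ and $\theta(r,w,L)=1-\theta(r,-w,L)$ for $w<0$; $(r,w)(\theta,\mathbf I)$ denotes the inverse map. For $V=V(R)$, $\widehat V_m(\mathbf I)=\int_{\mathbb S^1}V(r(\theta,\mathbf I))e^{-2\pi im\theta}d\theta$. $\mathbb Z_*=\mathbb Z\setminus\{0\}$. Coordinates $(R,y,z)$. For $R\in[R_{\min},R_{\max}]$ and $\mathbf I\in\mathcal I$ with $E\ge\Psi_L(R)$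 put $y=\omega(\mathbf I)$, $z=E-\Psi_L(R)$; for $\eta$ small $(R,\mathbf I)\mapsto(R,y,z)$ is an invertible change of variables, with inverse $\mathbf I(R,y,z)$. $\mathcal J_R=\{(y,z):\mathbf I(R,y,z)\in\mathcal I,\ E(R,y,z)>\Psi_{L(R,y,z)}(R)\}$. $\theta(R,\mathbf I)\in[0,\frac12]$ is the angle with $r(\theta(R,\mathbf I),\mathbf I)=R$, and $S_m(\theta)=\sin(2\pi m\theta)$. $\mathcal P_R:=\frac1{2R^2}\partial_E+\partial_L$ and $q(R,\mathbf I):=\frac{|\varphi'(\mathbf I)|}{|\mathcal P_R\omega(\mathbf I)|}$. Plemelj operator. $\mathbf{Pl}^{\pm,\lambda,\varepsilon}_m[Q,\mathcal V](R)=\int_{\mathcal J_R}\frac{Q(R,y,z)\,\mathcal V(R,y,z)}{y+\frac{\lambda\pm i\varepsilon}{2\pi m}}\,d(y,z)$; here $\widehat V_mS_m$ stands for $(R,y,z)\mapsto\widehat V_m(\mathbf I(R,y,z))\,S_m(\theta(R,\mathbf I(R,y,z)))$ and $q$ is evaluated at $(R,\mathbf I(R,y,z))$. *)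

theory Defs
  imports "HOL-Analysis.Analysis"
begin

text \<open>Elements of \<open>C\<^sup>1([a,b])\<close> are complex valued (the operator \<open>F\<close> has complex coefficients) and
  are represented by their extension by \<open>0\<close> to the real line, so that two elements are equal as
  functions iff they agree on \<open>[a,b]\<close>.  Derivatives at \<open>a\<close> and \<open>b\<close> are one-sided.\<close>

definition C1 :: "real \<Rightarrow> real \<Rightarrow> (real \<Rightarrow> complex) set" where
  "C1 a b = {V. (\<forall>x. x \<notin> {a..b} \<longrightarrow> V x = 0) \<and>
     (\<exists>V'. continuous_on {a..b} V' \<and>
       (\<forall>x\<in>{a..b}. (V has_vector_derivative V' x) (at x within {a..b})))}"

definition C1_norm :: "real \<Rightarrow> real \<Rightarrow> (real \<Rightarrow> complex) \<Rightarrow> real" where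
  "C1_norm a b V = (SUP x\<in>{a..b}. norm (V x))
     + (SUP x\<in>{a..b}. norm (vector_derivative V (at x within {a..b})))"

definition C1_bounded_operator ::
  "real \<Rightarrow> real \<Rightarrow> real \<Rightarrow> ((real \<Rightarrow> complex) \<Rightarrow> (real \<Rightarrow> complex)) \<Rightarrow> bool" where
  "C1_bounded_operator a b C F \<longleftrightarrow>
     F \<in> C1 a b \<rightarrow> C1 a b \<and>
     (\<forall>V\<in>C1 a b. \<forall>W\<in>C1 a b. F (\<lambda>x. V x + W x) = (\<lambda>x. F V x + F W x)) \<and>
     (\<forall>V\<in>C1 a b. \<forall>c. F (\<lambda>x. c * V x) = (\<lambda>x. c * F V x)) \<and>
     (\<forall>V\<in>C1 a b. C1_norm a b (F V) \<le> C * C1_norm a b V)"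

text \<open>\<open>g\<close> is the gradient and \<open>H\<close> the Hessian matrix of \<open>u\<close>, so that \<open>trace (H x)\<close> is the Laplacian.\<close>

definition poisson_solution :: "(real^3 \<Rightarrow> real) \<Rightarrow> (real^3 \<Rightarrow> real) \<Rightarrow> bool" where
  "poisson_solution u rho \<longleftrightarrow> (\<exists>g H.
     (\<forall>x. (u has_derivative (\<lambda>h. g x \<bullet> h)) (at x)) \<and>
     (\<forall>x. (g has_derivative (\<lambda>h. H x *v h)) (at x)) \<and>
     continuous_on UNIV (H :: real^3 \<Rightarrow> real^3^3) \<and>
     (\<forall>x. trace (H x) = 4 * pi * rho x))"

text \<open>The locale only collects parameters: \<open>U\<close> is the radial potential as a function of the
  radius, and \<open>steady_state\<close> below says that \<open>U\<close> and \<open>E0\<close> belong to the remaining parameters.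
  Only values of \<open>U\<close> on \<open>[0,\<infinity>)\<close> are ever used.\<close>

locale point_mass_vlasov_poisson =
  fixes M L0 \<kappa> \<mu> \<nu> \<eta> :: real
    and U :: "real \<Rightarrow> real"
    and E0 :: real
begin

definition Psi :: "real \<Rightarrow> real \<Rightarrow> real" where
  "Psi L r = U r - M / r + L / (2 * r\<^sup>2)"

definition energy :: "real \<Rightarrow> real \<Rightarrow> real \<Rightarrow> real" where
  "energy r w L = w\<^sup>2 / 2 + Psi L r"

definition phi :: "real \<Rightarrow> real \<Rightarrow> real" where
  "phi E L = (max 0 (E0 - E)) powr \<mu> * (max 0 (L - L0)) powr \<nu>"

definition f_steady :: "real \<Rightarrow> real \<Rightarrow> real \<Rightarrow> real" where
  "f_steady r w L = \<eta> * phi (energy r w L) L"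

text \<open>At \<open>r = 0\<close> this is \<open>0\<close> by the convention \<open>x / 0 = 0\<close>, which is the correct value: the
  density vanishes near the origin because \<open>L0 > 0\<close>.\<close>

definition rho :: "real \<Rightarrow> real" where
  "rho r = pi / r\<^sup>2 *
     (LINT w|lebesgue. (LINT L:{0..}|lebesgue. f_steady r w L))"

definition steady_state :: bool where
  "steady_state \<longleftrightarrow>
     0 \<le> \<eta> \<and>
     poisson_solution (\<lambda>x. U (norm x)) (\<lambda>x. rho (norm x)) \<and>
     (U \<longlongrightarrow> 0) at_top \<and>
     E0 - U 0 = \<kappa> \<and> E0 < 0"

definition Omega :: "(real \<times> real \<times> real) set" where
  "Omega = closure {(r, w, L). 0 < r \<and> 0 \<le> L \<and> phi (energy r w L) L \<noteq> 0}"

definition R_min :: real where "R_min = Inf ((\<lambda>(r, w, L). r) ` Omega)"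
definition R_max :: real where "R_max = Sup ((\<lambda>(r, w, L). r) ` Omega)"
definition L_max :: real where "L_max = Sup ((\<lambda>(r, w, L). L) ` Omega)"

definition r_L :: "real \<Rightarrow> real" where
  "r_L L = (THE r. 0 < r \<and> (\<forall>s>0. Psi L r \<le> Psi L s))"

definition E_min :: "real \<Rightarrow> real" where
  "E_min L = Psi L (r_L L)"

definition action_set :: "(real \<times> real) set" where
  "action_set = {(E, L). L0 \<le> L \<and> L \<le> L_max \<and> E_min L \<le> E \<and> E \<le> E0}"

definition r_minus :: "real \<Rightarrow> real \<Rightarrow> real" where
  "r_minus E L = Inf {r. 0 < r \<and> Psi L r = E}"

definition r_plus :: "real \<Rightarrow> real \<Rightarrow> real" where
  "r_plus E L = Sup {r. 0 < r \<and> Psi L r = E}"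

definition period_integral :: "real \<Rightarrow> real \<Rightarrow> real" where
  "period_integral E L =
     2 * (LINT r:{r_minus E L..r_plus E L}|lebesgue. 1 / sqrt (2 * E - 2 * Psi L r))"

text \<open>The second branch is the continuous extension to \<open>E = E_min L\<close>.\<close>

definition period :: "real \<Rightarrow> real \<Rightarrow> real" where
  "period E L =
     (if E_min L < E then period_integral E L
      else Lim (at (E, L) within {(E', L') \<in> action_set. E_min L' < E'})
             (\<lambda>(E', L'). period_integral E' L'))"

definition omega :: "real \<Rightarrow> real \<Rightarrow> real" where
  "omega E L = 1 / period E L"

definition lambda_min :: real where
  "lambda_min = 2 * pi * (INF (E, L)\<in>action_set. omega E L)"

definition sigma :: "real set" where
  "sigma = {..- lambda_min} \<union> {lambda_min..}"

definition angle :: "real \<Rightarrow> real \<Rightarrow> real \<Rightarrow> real" where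
  "angle r w L = (let E = energy r w L;
       t = (1 / period E L) *
           (LINT s:{r_minus E L..r}|lebesgue. 1 / sqrt (2 * E - 2 * Psi L s))
     in if 0 \<le> w then t else 1 - t)"

text \<open>The inverse map from angle and action to phase space.  \<open>angle\<close> takes values in \<open>[0,1)\<close>, and
  \<open>frac\<close> makes the map one-periodic in the angle.  It is meaningful for \<open>E > E_min L\<close>, which is the
  only range in which it is used.\<close>

definition rw_of_angle :: "real \<Rightarrow> real \<Rightarrow> real \<Rightarrow> real \<times> real" where
  "rw_of_angle t E L =
     (THE (r, w). 0 < r \<and> energy r w L = E \<and> angle r w L = frac t)"

definition r_of_angle :: "real \<Rightarrow> real \<Rightarrow> real \<Rightarrow> real" where
  "r_of_angle t E L = fst (rw_of_angle t E L)"

definition fourier_coeff :: "(real \<Rightarrow> complex) \<Rightarrow> int \<Rightarrow> real \<Rightarrow> real \<Rightarrow> complex" where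
  "fourier_coeff V m E L =
     (LINT t:{0..1}|lebesgue.
        V (r_of_angle t E L) * exp (- (2 * of_real pi * \<i> * of_int m * of_real t)))"

definition angle_at :: "real \<Rightarrow> real \<Rightarrow> real \<Rightarrow> real" where
  "angle_at R E L = (THE t. t \<in> {0..1/2} \<and> r_of_angle t E L = R)"

definition S :: "int \<Rightarrow> real \<Rightarrow> real" where
  "S m t = sin (2 * pi * of_int m * t)"

definition yz_domain :: "real \<Rightarrow> (real \<times> real) set" where
  "yz_domain R = {(E, L) \<in> action_set. Psi L R \<le> E}"

definition yz :: "real \<Rightarrow> real \<times> real \<Rightarrow> real \<times> real" where
  "yz R = (\<lambda>(E, L). (omega E L, E - Psi L R))"

definition action_of :: "real \<Rightarrow> real \<times> real \<Rightarrow> real \<times> real" where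
  "action_of R = inv_into (yz_domain R) (yz R)"

definition J :: "real \<Rightarrow> (real \<times> real) set" where
  "J R = {p \<in> yz R ` yz_domain R. case action_of R p of (E, L) \<Rightarrow> Psi L R < E}"

definition phi' :: "real \<Rightarrow> real \<Rightarrow> real" where
  "phi' E L = deriv (\<lambda>e. phi e L) E"

definition P :: "real \<Rightarrow> (real \<Rightarrow> real \<Rightarrow> real) \<Rightarrow> real \<Rightarrow> real \<Rightarrow> real" where
  "P R h E L = 1 / (2 * R\<^sup>2) * deriv (\<lambda>e. h e L) E + deriv (\<lambda>l. h E l) L"

definition q :: "real \<Rightarrow> real \<Rightarrow> real \<Rightarrow> real" where
  "q R E L = \<bar>phi' E L\<bar> / \<bar>P R omega E L\<bar>"

text \<open>The choice of sign in \<open>\<lambda> \<plusminus> i\<epsilon>\<close> is encoded by \<open>s = \<plusminus>1\<close>.\<close>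

definition Pl_integrand :: "real \<Rightarrow> real \<Rightarrow> real \<Rightarrow> int \<Rightarrow>
    (real \<Rightarrow> real \<times> real \<Rightarrow> real) \<Rightarrow> (real \<Rightarrow> real \<times> real \<Rightarrow> complex) \<Rightarrow>
    real \<Rightarrow> real \<times> real \<Rightarrow> complex" where
  "Pl_integrand s lam \<epsilon> m Q W R = (\<lambda>(y, z). of_real (Q R (y, z)) * W R (y, z) /
     (of_real y + (of_real lam + of_real s * \<i> * of_real \<epsilon>) / (2 * of_real pi * of_int m)))"

definition Pl :: "real \<Rightarrow> real \<Rightarrow> real \<Rightarrow> int \<Rightarrow>
    (real \<Rightarrow> real \<times> real \<Rightarrow> real) \<Rightarrow> (real \<Rightarrow> real \<times> real \<Rightarrow> complex) \<Rightarrow> real \<Rightarrow> complex" where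
  "Pl s lam \<epsilon> m Q W R = (LINT p:J R|lebesgue. Pl_integrand s lam \<epsilon> m Q W R p)"

definition q_yz :: "real \<Rightarrow> real \<times> real \<Rightarrow> real" where
  "q_yz R p = (case action_of R p of (E, L) \<Rightarrow> q R E L)"

definition VS_yz :: "(real \<Rightarrow> complex) \<Rightarrow> int \<Rightarrow> real \<Rightarrow> real \<times> real \<Rightarrow> complex" where
  "VS_yz V m R p = (case action_of R p of (E, L) \<Rightarrow>
     fourier_coeff V m E L * of_real (S m (angle_at R E L)))"

definition F_radial :: "real \<Rightarrow> real \<Rightarrow> real \<Rightarrow> int \<Rightarrow> (real \<Rightarrow> complex) \<Rightarrow> real \<Rightarrow> complex" where
  "F_radial s lam \<epsilon> m V r = of_real (4 * pi / r\<^sup>2) * Pl s lam \<epsilon> m q_yz (VS_yz V m) r"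

definition F_term :: "real \<Rightarrow> real \<Rightarrow> real \<Rightarrow> int \<Rightarrow> (real \<Rightarrow> complex) \<Rightarrow> real \<Rightarrow> complex" where
  "F_term s lam \<epsilon> m V R =
     1 / of_int m * (LINT r:{R..R_max}|lebesgue. F_radial s lam \<epsilon> m V r)"

definition F :: "real \<Rightarrow> real \<Rightarrow> real \<Rightarrow> (real \<Rightarrow> complex) \<Rightarrow> real \<Rightarrow> complex" where
  "F s lam \<epsilon> V R =
     (if R \<in> {R_min..R_max}
      then V R - of_real \<eta> * (\<Sum>\<^sub>\<infinity>m\<in>{m. m \<noteq> 0}. F_term s lam \<epsilon> m V R)
      else 0)"

text \<open>Integrals and infinite sums are total functions in HOL; this says that all those in the
  definition of \<open>F\<close> exist.\<close>

definition F_well_defined :: "real \<Rightarrow> real \<Rightarrow> real \<Rightarrow> bool" where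
  "F_well_defined s lam \<epsilon> \<longleftrightarrow> (\<forall>V\<in>C1 R_min R_max. \<forall>R\<in>{R_min..R_max}.
     (\<forall>m. m \<noteq> 0 \<longrightarrow>
        set_integrable lebesgue (J R) (Pl_integrand s lam \<epsilon> m q_yz (VS_yz V m) R) \<and>
        set_integrable lebesgue {R..R_max} (F_radial s lam \<epsilon> m V)) \<and>
     (\<lambda>m. F_term s lam \<epsilon> m V R) summable_on {m. m \<noteq> 0})"

end

end

(*
  Since eps > 0 is fixed, every denominator y + (lam +- i eps) / (2 pi m) is at least eps / (2 pi |m|)
  in modulus, whatever lam is. Undoing the change of variables (E, L) -> (y, z), whose Jacobian
  |P R omega| is cancelled by the weight q, the operator becomes I - eta K with
    |(K V)'(R)| <= C / eps * int |phi'| (sum over m of |V^_m|) d(E, L) <= C' / eps * |V|_{C1},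
  the sum of the Fourier coefficients being controlled by Bessel's inequality for the derivative of V
  along an orbit. So eta0 can be taken proportional to eps, and a Neumann series in C1 inverts F.

  The work lies in the uniformity in eta. With Y(r) = r^2 (U r - U 0), which is O(eta) in C^3, the function
  2 r^2 (E - Psi L r) is strictly concave and equals (r - r1) (r2 - r) G with G expressed by second divided
  differences of Y. The parametrization r = (r1 + r2) / 2 - (r2 - r1) / 2 cos x turns the period into the
  regular integral 2 int r / sqrt G dx. In the direction of P R the energy grows while both turning points
  move outward with bounded speed, so G decreases and r increases, and the period strictly
  increases: this gives P R omega < 0 and the injectivity of (E, L) -> (y, z).
*)
theory Submission
  imports Defs
begin

subsection \<open>Calculus and change of variables in the plane\<close>

text \<open>Constants must not depend on eta, although U, E0 and the support do. The density is eta
  times a power of E0 - Psi L0 r with exponent above 4, and U >= U 0 confines its support to an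
  interval (A, B) fixed by the Kepler problem. This makes the perturbation O(eta) with three
  derivatives, the third being what the derivative of the period consumes. From there on only the
  locale \<open>near_kepler\<close> is used, with constants built from M, L0, kappa, mu, nu.

  The obstacle is the circular orbits: dPsi at a turning point is proportional to r_plus - r_minus,
  so the partial derivatives of the turning points blow up as the orbit shrinks. For an orbit
  crossing R the direction of P R, which keeps E - Psi L R fixed, produces a numerator proportional
  to the distance from the turning point to R, at most r_plus - r_minus, and the quotient stays
  bounded.

  The factor |m| lost in the denominator is absorbed by 1/m in front of the integral. What remains
  is absolute summability of the Fourier coefficients: integration by parts gains 1/m, and
  Cauchy-Schwarz pairs it with the square-summable sine coefficients of V'.\<close>

lemma DERIV_max_powr:
  fixes p x :: real
  assumes p: "1 < p"
  shows "((\<lambda>x. max 0 x powr p) has_real_derivative p * max 0 x powr (p - 1)) (at x)"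
proof -
  consider "x > 0" | "x < 0" | "x = 0" by linarith
  then show ?thesis
  proof cases
    case 1
    have "((\<lambda>x. x powr p) has_real_derivative p * x powr (p - 1)) (at x)"
      using 1 by (auto intro!: derivative_eq_intros)
    then show ?thesis
      by (rule DERIV_cong[OF has_field_derivative_transform_within_open[of _ _ _ "{0<..}"]]) (use 1 in auto)
  next
    case 2
    have "((\<lambda>x. max 0 x powr p) has_real_derivative 0) (at x)"
      by (rule has_field_derivative_transform_within_open[OF DERIV_const[of 0], of "{..<0}"])
        (use 2 p in auto)
    then show ?thesis using 2 p by simp
  next
    case 3
    \<comment> \<open>At the kink the difference quotient is at most |h| powr (p - 1), which tends
      to 0 because p > 1.\<close>
    have "((\<lambda>h. \<bar>h\<bar> powr (p - 1)) \<longlongrightarrow> 0) (at (0::real))"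
      using p by (auto intro!: tendsto_eq_intros)
    then have "((\<lambda>h. max 0 h powr p / h) \<longlongrightarrow> 0) (at (0::real))"
    proof (rule Lim_null_comparison[rotated], intro always_eventually allI)
      fix h :: real
      show "norm (max 0 h powr p / h) \<le> \<bar>h\<bar> powr (p - 1)"
      proof (cases "h > 0")
        case True
        then show ?thesis by (simp add: powr_diff)
      next
        case False
        then have "max 0 h = 0" by simp
        then show ?thesis by simp
      qed
    qed
    then show ?thesis
      using 3 p by (simp add: DERIV_def)
  qed
qed

lemma continuous_on_max_powr:
  fixes f :: "'a::topological_space \<Rightarrow> real"
  assumes "continuous_on S f" "0 < p"
  shows "continuous_on S (\<lambda>x. max 0 (f x) powr p)"
  using assms by (intro continuous_on_powr' continuous_intros) auto

lemma has_derivative_integral_param_pair: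
  fixes f f1 f2 :: "real \<times> real \<Rightarrow> real \<Rightarrow> real"
  assumes U: "open U" "x0 \<in> U"
    and der: "\<And>x t. x \<in> U \<Longrightarrow> t \<in> {a..b} \<Longrightarrow>
      ((\<lambda>x. f x t) has_derivative (\<lambda>h. f1 x t * fst h + f2 x t * snd h)) (at x)"
    and c: "\<And>x. x \<in> U \<Longrightarrow> continuous_on {a..b} (f x)"
    and c1: "continuous_on (U \<times> {a..b}) (\<lambda>(x, t). f1 x t)"
    and c2: "continuous_on (U \<times> {a..b}) (\<lambda>(x, t). f2 x t)"
  shows "((\<lambda>x. integral {a..b} (f x)) has_derivative
      (\<lambda>h. integral {a..b} (f1 x0) * fst h + integral {a..b} (f2 x0) * snd h)) (at x0)"
proof -
  obtain e where e: "e > 0" "ball x0 e \<subseteq> U"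
    using U openE by blast
  \<comment> \<open>\<open>leibniz_rule\<close> takes the derivative as a bounded linear functional
    on a convex set. With the coordinate functionals \<open>B1\<close>, \<open>B2\<close> its joint
    continuity reduces to that of \<open>f1\<close> and \<open>f2\<close>, and a ball inside
    \<open>U\<close> supplies convexity.\<close>
  define B1 B2 :: "(real \<times> real) \<Rightarrow>\<^sub>L real" where "B1 = Blinfun fst" and "B2 = Blinfun snd"
  have B: "blinfun_apply B1 = fst" "blinfun_apply B2 = snd"
    unfolding B1_def B2_def by (auto intro!: bounded_linear_Blinfun_apply bounded_linear_fst bounded_linear_snd)
  have cx: "continuous_on {a..b} (f1 x0)" "continuous_on {a..b} (f2 x0)"
    using continuous_on_compose2[OF c1, of "{a..b}" "\<lambda>t. (x0, t)"]
      continuous_on_compose2[OF c2, of "{a..b}" "\<lambda>t. (x0, t)"] U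
    by (force intro!: continuous_intros)+
  have "((\<lambda>x. integral (cbox a b) (f x)) has_derivative
      integral (cbox a b) (\<lambda>t. f1 x0 t *\<^sub>R B1 + f2 x0 t *\<^sub>R B2)) (at x0 within ball x0 e)"
  proof (rule leibniz_rule)
    fix x t assume "x \<in> ball x0 e" "t \<in> cbox a b"
    then have "((\<lambda>x. f x t) has_derivative (\<lambda>h. f1 x t * fst h + f2 x t * snd h)) (at x)"
      using e by (intro der) auto
    then show "((\<lambda>x. f x t) has_derivative blinfun_apply (f1 x t *\<^sub>R B1 + f2 x t *\<^sub>R B2)) (at x within ball x0 e)"
      by (simp add: plus_blinfun.rep_eq scaleR_blinfun.rep_eq B has_derivative_at_withinI)
  next
    fix x assume "x \<in> ball x0 e"
    then show "f x integrable_on cbox a b"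
      using c[of x] e by (auto intro!: integrable_continuous_real)
  next
    show "continuous_on (ball x0 e \<times> cbox a b) (\<lambda>(x, t). f1 x t *\<^sub>R B1 + f2 x t *\<^sub>R B2)"
      using continuous_on_subset[OF c1, of "ball x0 e \<times> {a..b}"] continuous_on_subset[OF c2, of "ball x0 e \<times> {a..b}"] e
      by (auto simp: split_beta intro!: continuous_intros)
  qed (use e in auto)
  moreover have "integral (cbox a b) (\<lambda>t. f1 x0 t *\<^sub>R B1 + f2 x0 t *\<^sub>R B2)
      = integral {a..b} (f1 x0) *\<^sub>R B1 + integral {a..b} (f2 x0) *\<^sub>R B2"
    using cx by (intro integral_unique has_integral_add has_integral_scaleR_left)
      (auto simp: has_integral_integral[symmetric] intro: integrable_continuous_real)
  ultimately show ?thesis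
    using e at_within_open[of x0 "ball x0 e"] by (simp add: blinfun.add_left blinfun.scaleR_left B plus_blinfun.rep_eq scaleR_blinfun.rep_eq)
qed

section \<open>Transport of integrals between pairs and Cartesian vectors\<close>

definition cart :: "real \<times> real \<Rightarrow> real^2" where "cart p = vector [fst p, snd p]"
definition uncart :: "real^2 \<Rightarrow> real \<times> real" where "uncart v = (v $ 1, v $ 2)"

lemma cart_uncart [simp]: "cart (uncart v) = v" "uncart (cart p) = p"
  by (auto simp: cart_def uncart_def vec_eq_iff forall_2)

lemma cart_nth [simp]: "cart p $ 1 = fst p" "cart p $ 2 = snd p"
  by (auto simp: cart_def)

lemma bounded_linear_uncart: "bounded_linear uncart"
  unfolding uncart_def by (intro bounded_linear_Pair bounded_linear_vec_nth)

lemma bounded_linear_cart: "bounded_linear cart"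
proof -
  have "linear cart"
    by (rule linearI) (auto simp: vec_eq_iff forall_2)
  then show ?thesis by (simp add: linear_conv_bounded_linear)
qed

lemma norm_cart [simp]: "norm (cart p) = norm p"
  by (cases p) (simp add: norm_vec_def L2_set_def UNIV_2 norm_Pair)

lemma norm_uncart [simp]: "norm (uncart v) = norm v"
  using norm_cart[of "uncart v"] by simp

lemma uncart_image_cbox: "uncart ` cbox u v = cbox (uncart u) (uncart v)"
proof -
  have "uncart w \<in> cbox (uncart u) (uncart v) \<longleftrightarrow> w \<in> cbox u v" for w
    by (auto simp: uncart_def cbox_Pair_eq mem_box_cart forall_2)
  then show ?thesis by (auto simp: image_iff) (metis cart_uncart)+
qed

lemma cart_image_cbox: "cart ` cbox u v = cbox (cart u) (cart v)"
proof -
  have "uncart ` cbox (cart u) (cart v) = cbox u v" by (simp add: uncart_image_cbox)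
  then show ?thesis by (metis (no_types, lifting) cart_uncart(1) image_cong image_ident image_image)
qed

lemma content_cart_image_cbox: "measure lborel (cart ` cbox u v) = measure lborel (cbox u v)"
proof -
  obtain a b c d where uv: "u = (a, b)" "v = (c, d)" by (cases u, cases v)
  have *: "measure lborel (cbox (a, b) (c, d)) = measure lborel (cbox a c) * measure lborel (cbox b d)" for a b c d :: real
    by (rule content_Pair)
  have ex: "(\<exists>i::2. P i) \<longleftrightarrow> P 1 \<or> P 2" for P
    by (metis (full_types) exhaust_2)
  show ?thesis
    unfolding cart_image_cbox uv *
    by (auto simp: * content_cbox_if_cart interval_eq_empty_cart UNIV_2 ex prod.insert)
qed

lemma content_uncart_image_cbox: "measure lborel (uncart ` cbox u v) = measure lborel (cbox u v)"
  using content_cart_image_cbox[of "uncart u" "uncart v"]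
  by (simp add: uncart_image_cbox[symmetric] image_comp o_def)

text \<open>On boxes this is \<open>has_integral_twiddle\<close> with factor 1, since
  \<open>cart\<close> maps boxes to boxes of equal content. The passage to arbitrary sets goes
  through the characterization by large balls, and these are preserved because \<open>cart\<close>
  is an isometry.\<close>

lemma has_integral_cart:
  fixes f :: "real \<times> real \<Rightarrow> 'b::banach"
  shows "(f has_integral i) S \<longleftrightarrow> ((\<lambda>x. f (uncart x)) has_integral i) (cart ` S)"
proof -
  have mem: "x \<in> cart ` S \<longleftrightarrow> uncart x \<in> S" for x by (metis cart_uncart(1,2) image_iff)
  have box2: "\<exists>a b c d. cbox (p :: real \<times> real) q = cbox (a, b) (c, d)" for p q
    by (metis surj_pair)
  have bx: "(F has_integral z) (cbox a b) \<longleftrightarrow> ((\<lambda>x. F (uncart x)) has_integral z) (cbox (cart a) (cart b))"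
    for F :: "real \<times> real \<Rightarrow> 'b" and z a b
  proof
    assume "(F has_integral z) (cbox a b)"
    then have "((\<lambda>x. F (uncart x)) has_integral (1 / 1) *\<^sub>R z) (cart ` cbox a b)"
      by (intro has_integral_twiddle)
        (auto simp: cart_image_cbox box2 uncart_image_cbox content_uncart_image_cbox[unfolded uncart_image_cbox]
           bounded_linear.isCont[OF bounded_linear_uncart])
    then show "((\<lambda>x. F (uncart x)) has_integral z) (cbox (cart a) (cart b))"
      by (simp add: cart_image_cbox)
  next
    assume "((\<lambda>x. F (uncart x)) has_integral z) (cbox (cart a) (cart b))"
    then have "((\<lambda>x. F (uncart (cart x))) has_integral (1 / 1) *\<^sub>R z) (uncart ` cbox (cart a) (cart b))"
      by (intro has_integral_twiddle)
        (auto simp: cart_image_cbox box2 uncart_image_cbox content_cart_image_cbox[unfolded cart_image_cbox]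
           bounded_linear.isCont[OF bounded_linear_cart])
    then show "(F has_integral z) (cbox a b)"
      by (simp add: uncart_image_cbox)
  qed
  have ball: "ball 0 B \<subseteq> cbox (cart a) (cart b) \<longleftrightarrow> ball 0 B \<subseteq> cbox a b" for B a b
  proof -
    have "cart p \<in> cbox (cart a) (cart b) \<longleftrightarrow> p \<in> cbox a b" for p
      by (cases p, cases a, cases b) (auto simp: cbox_Pair_eq mem_box_cart forall_2)
    then show ?thesis
      unfolding subset_eq Ball_def mem_ball_0 by (metis cart_uncart norm_cart norm_uncart)
  qed
  have all: "(\<forall>a b. ball 0 B \<subseteq> cbox a b \<longrightarrow> (\<exists>z. (g has_integral z) (cbox a b) \<and> N z)) \<longleftrightarrow>
      (\<forall>a b. ball 0 B \<subseteq> cbox (cart a) (cart b) \<longrightarrow> (\<exists>z. (g has_integral z) (cbox (cart a) (cart b)) \<and> N z))"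
    for B N and g :: "real^2 \<Rightarrow> 'b"
    by (metis cart_uncart(1))
  show ?thesis
    unfolding has_integral' [of f] has_integral'[of "\<lambda>x. f (uncart x)"] all
    by (simp add: ball bx mem)
qed

lemma absolutely_integrable_cart:
  fixes f :: "real \<times> real \<Rightarrow> 'b::euclidean_space"
  shows "f absolutely_integrable_on S \<longleftrightarrow> (\<lambda>x. f (uncart x)) absolutely_integrable_on (cart ` S)"
    and "integral S f = integral (cart ` S) (\<lambda>x. f (uncart x))"
proof -
  show "f absolutely_integrable_on S \<longleftrightarrow> (\<lambda>x. f (uncart x)) absolutely_integrable_on (cart ` S)"
    unfolding absolutely_integrable_on_def integrable_on_def
    using has_integral_cart[of f _ S] has_integral_cart[of "\<lambda>x. norm (f x)" _ S] by simp
  show "integral S f = integral (cart ` S) (\<lambda>x. f (uncart x))"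
    unfolding integral_def integrable_on_def using has_integral_cart[of f _ S] by simp
qed


text \<open>The library theorem is stated for Cartesian powers \<open>real^'n\<close>.\<close>

theorem change_of_variables_plane:
  fixes g :: "real \<times> real \<Rightarrow> real \<times> real" and f :: "real \<times> real \<Rightarrow> complex"
  assumes S: "S \<in> sets borel"
    and der: "\<And>x. x \<in> S \<Longrightarrow>
      (g has_derivative (\<lambda>h. (a x * fst h + b x * snd h, c x * fst h + d x * snd h))) (at x within S)"
    and inj: "inj_on g S"
    and int: "set_integrable lebesgue S (\<lambda>x. \<bar>a x * d x - b x * c x\<bar> *\<^sub>R f (g x))"
  shows "set_integrable lebesgue (g ` S) f"
    and "(LINT y:g ` S|lebesgue. f y) = (LINT x:S|lebesgue. \<bar>a x * d x - b x * c x\<bar> *\<^sub>R f (g x))"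
proof -
  define D where "D x = \<bar>a x * d x - b x * c x\<bar>" for x
  \<comment> \<open>The values have to become vectors as well: \<open>k\<close> and
    \<open>k'\<close> identify the complex numbers with \<open>real^2\<close> by mutually inverse
    linear maps.\<close>
  define k :: "complex \<Rightarrow> real^2" where "k z = cart (Re z, Im z)" for z
  define k' :: "real^2 \<Rightarrow> complex" where "k' v = Complex (v $ 1) (v $ 2)" for v
  have k'k [simp]: "k' (k z) = z" for z by (simp add: k_def k'_def)
  have kk' [simp]: "k (k' v) = v" for v by (simp add: k_def k'_def vec_eq_iff forall_2)
  have lin: "linear k" "linear k'"
    by (auto intro!: linearI simp: k_def k'_def vec_eq_iff forall_2 complex_eq_iff)
  have bl: "bounded_linear k" "bounded_linear k'"
    using lin by (auto simp: linear_conv_bounded_linear)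
  define T where "T = cart ` S"
  define G where "G v = cart (g (uncart v))" for v
  define G' where "G' v h = cart (a (uncart v) * h $ 1 + b (uncart v) * h $ 2, c (uncart v) * h $ 1 + d (uncart v) * h $ 2)"
    for v and h :: "real^2"
  have "uncart -` S \<inter> space borel \<in> sets borel"
    using S by (intro measurable_sets[of uncart borel borel] borel_measurable_continuous_onI
        linear_continuous_on bounded_linear_uncart) auto
  moreover have "uncart -` S = T"
    unfolding T_def by (auto simp: image_iff) (metis cart_uncart(1))
  ultimately have T: "T \<in> sets lebesgue" by auto
  have GT: "G ` T = cart ` g ` S"
    unfolding G_def T_def by (auto simp: image_comp)
  have derG: "(G has_derivative G' v) (at v within T)" if "v \<in> T" for v
  proof -
    have "uncart v \<in> S" "uncart ` T = S" using that unfolding T_def by (auto simp: image_comp)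
    then have "((\<lambda>w. g (uncart w)) has_derivative
        (\<lambda>h. (a (uncart v) * fst (uncart h) + b (uncart v) * snd (uncart h), c (uncart v) * fst (uncart h) + d (uncart v) * snd (uncart h)))) (at v within T)"
      using has_derivative_in_compose[OF bounded_linear_imp_has_derivative[OF bounded_linear_uncart], of g _ v T]
        der[of "uncart v"] by auto
    from bounded_linear.has_derivative[OF bounded_linear_cart this]
    show ?thesis unfolding G_def G'_def by (simp add: uncart_def)
  qed
  have injG: "inj_on G T"
    unfolding inj_on_def G_def T_def using inj by (auto simp: inj_on_def) (metis cart_uncart(2))
  have det: "\<bar>det (matrix (G' v))\<bar> = D (uncart v)" for v
    unfolding det_2 G'_def D_def by (simp add: matrix_def axis_def)
  have gS: "S = uncart ` T" unfolding T_def by (simp add: image_comp)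
  have abs: "(\<lambda>v. D (uncart v) *\<^sub>R k (f (uncart (G v)))) absolutely_integrable_on T"
  proof -
    have "(\<lambda>x. k (D x *\<^sub>R f (g x))) absolutely_integrable_on S"
      using absolutely_integrable_linear[OF int bl(1)] by (simp add: o_def D_def)
    then have "(\<lambda>v. k (D (uncart v) *\<^sub>R f (g (uncart v)))) absolutely_integrable_on T"
      unfolding T_def by (subst (asm) absolutely_integrable_cart)
    then show ?thesis by (simp add: G_def linear_scale[OF lin(1)])
  qed
  have cov: "(\<lambda>v. k (f (uncart v))) absolutely_integrable_on G ` T"
    "integral (G ` T) (\<lambda>v. k (f (uncart v))) = integral T (\<lambda>v. D (uncart v) *\<^sub>R k (f (uncart (G v))))"
    using has_absolute_integral_change_of_variables[OF T derG injG, of "\<lambda>v. k (f (uncart v))"] abs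
    by (auto simp: det)
  have fk: "(\<lambda>x. k (f x)) absolutely_integrable_on g ` S"
    using cov(1) unfolding GT by (subst absolutely_integrable_cart)
  show 1: "set_integrable lebesgue (g ` S) f"
    using absolutely_integrable_linear[OF fk bl(2)] by (simp add: o_def)
  have "k (integral (g ` S) f) = integral (g ` S) (\<lambda>x. k (f x))"
    using integral_linear[OF set_lebesgue_integral_eq_integral(1)[OF 1] bl(1)] by (simp add: o_def)
  also have "\<dots> = integral (G ` T) (\<lambda>v. k (f (uncart v)))"
    unfolding GT by (rule absolutely_integrable_cart(2))
  also have "\<dots> = integral T (\<lambda>v. k (D (uncart v) *\<^sub>R f (g (uncart v))))"
    unfolding cov(2) by (simp add: G_def linear_scale[OF lin(1)])
  also have "\<dots> = integral S (\<lambda>x. k (D x *\<^sub>R f (g x)))"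
    unfolding T_def by (rule absolutely_integrable_cart(2)[symmetric])
  also have "\<dots> = k (integral S (\<lambda>x. D x *\<^sub>R f (g x)))"
    using integral_linear[OF set_lebesgue_integral_eq_integral(1)[OF int] bl(1)] by (simp add: o_def D_def)
  finally have "integral (g ` S) f = integral S (\<lambda>x. D x *\<^sub>R f (g x))"
    by (metis k'k)
  then show "(LINT y:g ` S|lebesgue. f y) = (LINT x:S|lebesgue. \<bar>a x * d x - b x * c x\<bar> *\<^sub>R f (g x))"
    using set_lebesgue_integral_eq_integral(2)[OF 1] set_lebesgue_integral_eq_integral(2)[OF int]
    by (simp add: D_def)
qed

subsection \<open>The space of continuously differentiable functions\<close>

text \<open>One-sided derivatives are unique only on a nondegenerate interval. With a < b the
  witness in \<open>C1\<close> must coincide with \<open>vector_derivative\<close>, which serves as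
  the derivative from here on.\<close>

lemma C1D:
  assumes "V \<in> C1 a b" "a < b"
  shows "\<And>x. x \<notin> {a..b} \<Longrightarrow> V x = 0"
    and "\<And>x. x \<in> {a..b} \<Longrightarrow> (V has_vector_derivative vector_derivative V (at x within {a..b})) (at x within {a..b})"
    and "continuous_on {a..b} (\<lambda>x. vector_derivative V (at x within {a..b}))"
    and "continuous_on {a..b} V"
proof -
  obtain V' where V': "continuous_on {a..b} V'" "\<And>x. x \<notin> {a..b} \<Longrightarrow> V x = 0"
    "\<And>x. x \<in> {a..b} \<Longrightarrow> (V has_vector_derivative V' x) (at x within {a..b})"
    using assms unfolding C1_def by auto
  have eq: "vector_derivative V (at x within {a..b}) = V' x" if "x \<in> {a..b}" for x
    using V'(3)[OF that] that assms(2)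
    by (intro vector_derivative_within_cbox[where a = a and b = b, simplified]) auto
  show "\<And>x. x \<notin> {a..b} \<Longrightarrow> V x = 0" by fact
  show "(V has_vector_derivative vector_derivative V (at x within {a..b})) (at x within {a..b})"
    if "x \<in> {a..b}" for x
    using V'(3)[OF that] eq[OF that] by simp
  show "continuous_on {a..b} (\<lambda>x. vector_derivative V (at x within {a..b}))"
    using V'(1) by (rule continuous_on_eq) (simp add: eq)
  show "continuous_on {a..b} V"
    using V'(3) by (meson continuous_on_vector_derivative)
qed

lemma C1I:
  assumes "a < b" "continuous_on {a..b} V'" "\<And>x. x \<notin> {a..b} \<Longrightarrow> V x = 0"
    "\<And>x. x \<in> {a..b} \<Longrightarrow> (V has_vector_derivative V' x) (at x within {a..b})"
  shows "V \<in> C1 a b" "\<And>x. x \<in> {a..b} \<Longrightarrow> vector_derivative V (at x within {a..b}) = V' x"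
proof -
  show "V \<in> C1 a b" using assms unfolding C1_def by auto
  show "vector_derivative V (at x within {a..b}) = V' x" if "x \<in> {a..b}" for x
    using assms(4)[OF that] that assms(1)
    by (intro vector_derivative_within_cbox[where a = a and b = b, simplified]) auto
qed

lemma C1_cong:
  assumes "V \<in> C1 a b" "\<And>x. x \<in> {a..b} \<Longrightarrow> W x = V x" "\<And>x. x \<notin> {a..b} \<Longrightarrow> W x = 0"
  shows "W = V"
  using assms unfolding C1_def by fastforce

lemma C1_norm_bounds:
  assumes "V \<in> C1 a b" "a < b" "x \<in> {a..b}"
  shows "norm (V x) \<le> C1_norm a b V"
    and "norm (vector_derivative V (at x within {a..b})) \<le> C1_norm a b V"
    and "norm (V x) + norm (vector_derivative V (at x within {a..b})) \<le> C1_norm a b V"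
proof -
  note D = C1D[OF assms(1,2)]
  have bdd: "bdd_above ((\<lambda>x. norm (V x)) ` {a..b})"
    "bdd_above ((\<lambda>x. norm (vector_derivative V (at x within {a..b}))) ` {a..b})"
    using D(3,4) by (auto intro!: bounded_imp_bdd_above compact_imp_bounded compact_continuous_image continuous_intros)
  have *: "norm (V x) \<le> (SUP x\<in>{a..b}. norm (V x))"
    "norm (vector_derivative V (at x within {a..b})) \<le> (SUP x\<in>{a..b}. norm (vector_derivative V (at x within {a..b})))"
    using assms(3) bdd by (auto intro!: cSUP_upper)
  then show "norm (V x) + norm (vector_derivative V (at x within {a..b})) \<le> C1_norm a b V"
    by (simp add: C1_norm_def)
  with norm_ge_zero[of "V x"] norm_ge_zero[of "vector_derivative V (at x within {a..b})"]
  show "norm (V x) \<le> C1_norm a b V" "norm (vector_derivative V (at x within {a..b})) \<le> C1_norm a b V"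
    by linarith+
qed

lemma C1_norm_le:
  assumes "a < b" "\<And>x. x \<in> {a..b} \<Longrightarrow> norm (V x) \<le> A"
    "\<And>x. x \<in> {a..b} \<Longrightarrow> norm (vector_derivative V (at x within {a..b})) \<le> B"
  shows "C1_norm a b V \<le> A + B"
  unfolding C1_norm_def using assms by (intro add_mono cSUP_least) auto

lemma C1_norm_nonneg: "V \<in> C1 a b \<Longrightarrow> a < b \<Longrightarrow> 0 \<le> C1_norm a b V"
  using order_trans[OF norm_ge_zero C1_norm_bounds(1)[of V a b a]] by simp

lemma C1_lincomb:
  assumes "V \<in> C1 a b" "W \<in> C1 a b" "a < b"
  shows "(\<lambda>x. c * V x + d * W x) \<in> C1 a b"
    and "C1_norm a b (\<lambda>x. c * V x + d * W x) \<le> norm c * C1_norm a b V + norm d * C1_norm a b W"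
proof -
  note V = C1D[OF assms(1,3)] note W = C1D[OF assms(2,3)]
  note * = C1I[where V = "\<lambda>x. c * V x + d * W x" and a = a and b = b and
      V' = "\<lambda>x. c * vector_derivative V (at x within {a..b}) + d * vector_derivative W (at x within {a..b})"]
  have der: "((\<lambda>x. c * V x + d * W x) has_vector_derivative
      c * vector_derivative V (at x within {a..b}) + d * vector_derivative W (at x within {a..b})) (at x within {a..b})"
    if "x \<in> {a..b}" for x
    using V(2)[OF that] W(2)[OF that] by (auto intro!: derivative_eq_intros)
  show "(\<lambda>x. c * V x + d * W x) \<in> C1 a b"
    using V W der assms(3) by (intro *) (auto intro!: continuous_intros)
  have vd: "vector_derivative (\<lambda>x. c * V x + d * W x) (at x within {a..b}) =
      c * vector_derivative V (at x within {a..b}) + d * vector_derivative W (at x within {a..b})" if "x \<in> {a..b}" for x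
    using V W der assms(3) that by (intro *(2)) (auto intro!: continuous_intros)
  define s where "s V = (SUP x\<in>{a..b}. norm (V x))" for V :: "real \<Rightarrow> complex"
  have up: "norm (f x) \<le> s f" if "continuous_on {a..b} f" "x \<in> {a..b}" for f x
    unfolding s_def using that
    by (intro cSUP_upper) (auto intro!: bounded_imp_bdd_above compact_imp_bounded compact_continuous_image continuous_intros)
  have tri: "norm (c * f x + d * g x) \<le> norm c * s f + norm d * s g"
    if "continuous_on {a..b} f" "continuous_on {a..b} g" "x \<in> {a..b}" for f g x
    using up[OF that(1,3)] up[OF that(2,3)]
    by (intro order_trans[OF norm_triangle_ineq] add_mono) (auto simp: norm_mult intro!: mult_left_mono)
  have "C1_norm a b (\<lambda>x. c * V x + d * W x) \<le>
      (norm c * s V + norm d * s W) + (norm c * s (\<lambda>x. vector_derivative V (at x within {a..b}))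
         + norm d * s (\<lambda>x. vector_derivative W (at x within {a..b})))"
    using tri[OF V(4) W(4)] tri[OF V(3) W(3)] assms(3) by (intro C1_norm_le) (auto simp: vd)
  then show "C1_norm a b (\<lambda>x. c * V x + d * W x) \<le> norm c * C1_norm a b V + norm d * C1_norm a b W"
    by (simp add: C1_norm_def s_def algebra_simps)
qed

lemma C1_zero:
  assumes "a < b"
  shows "(\<lambda>x. 0) \<in> C1 a b" "C1_norm a b (\<lambda>x. 0) = 0"
proof -
  note * = C1I[where V = "\<lambda>x. 0" and V' = "\<lambda>x. 0", OF assms]
  show "(\<lambda>x. 0) \<in> C1 a b" by (rule *(1)) auto
  have "vector_derivative (\<lambda>x. 0 :: complex) (at x within {a..b}) = 0" if "x \<in> {a..b}" for x
    using that by (intro *(2)) auto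
  then show "C1_norm a b (\<lambda>x. 0) = 0"
    using assms by (simp add: C1_norm_def)
qed

lemma C1_norm_eq_0:
  assumes "V \<in> C1 a b" "a < b" "C1_norm a b V \<le> 0"
  shows "V = (\<lambda>x. 0)"
proof (rule C1_cong[OF C1_zero(1)])
  show "V x = 0" if "x \<in> {a..b}" for x
    using order_trans[OF C1_norm_bounds(1)[OF assms(1,2) that] assms(3)] by simp
qed (use assms C1D in auto)

text \<open>This is the completeness of C^1 in the form that a Neumann series calls for. Values and
  derivatives converge uniformly by the Weierstrass test, and termwise differentiation identifies
  the limit of the derivatives. The tails of both contribute 2 B / 2^n, whence the factor 4.\<close>

lemma C1_geometric_series:
  fixes X :: "nat \<Rightarrow> real \<Rightarrow> complex"
  assumes ab: "a < b" and X: "\<And>n. X n \<in> C1 a b" and le: "\<And>n. C1_norm a b (X n) \<le> B * (1/2) ^ n"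
  obtains V where "V \<in> C1 a b" "\<And>n. C1_norm a b (\<lambda>x. V x - (\<Sum>k<n. X k x)) \<le> 4 * B * (1/2) ^ n"
proof -
  have sm: "summable (\<lambda>n. B * (1/2 :: real) ^ n)"
    by (intro summable_mult summable_geometric) auto
  have smX: "summable (\<lambda>n. X n x)" if "x \<in> {a..b}" for x
    by (rule summable_comparison_test'[OF sm, of 0]) (use C1_norm_bounds(1)[OF X ab that] le order_trans in blast)
  define D where "D n x = vector_derivative (X n) (at x within {a..b})" for n x
  have leD: "norm (D n x) \<le> B * (1/2) ^ n" if "x \<in> {a..b}" for n x
    unfolding D_def using C1_norm_bounds(2)[OF X ab that] le order_trans by blast
  have leX: "norm (X n x) \<le> B * (1/2) ^ n" if "x \<in> {a..b}" for n x
    using C1_norm_bounds(1)[OF X ab that] le order_trans by blast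
  have smD: "summable (\<lambda>n. D n x)" if "x \<in> {a..b}" for x
    by (rule summable_comparison_test'[OF sm, of 0]) (use leD that in auto)
  have uD: "uniform_limit {a..b} (\<lambda>n x. \<Sum>k<n. D k x) (\<lambda>x. \<Sum>k. D k x) sequentially"
    by (rule Weierstrass_m_test[OF _ sm]) (use leD in auto)
  have contD: "continuous_on {a..b} (\<lambda>x. \<Sum>k. D k x)"
    by (rule uniform_limit_theorem[OF always_eventually uD])
      (auto intro!: continuous_intros simp: D_def C1D(3)[OF X ab])
  have "\<exists>g. \<forall>x\<in>{a..b}. (\<lambda>n. X n x) sums g x \<and> (g has_derivative (\<lambda>h. h *\<^sub>R (\<Sum>k. D k x))) (at x within {a..b})"
  proof (rule has_derivative_series[where f' = "\<lambda>n x h. h *\<^sub>R D n x"])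
    show "\<And>n x. x \<in> {a..b} \<Longrightarrow> (X n has_derivative (\<lambda>h. h *\<^sub>R D n x)) (at x within {a..b})"
      using C1D(2)[OF X ab] by (simp add: D_def has_vector_derivative_def)
    fix e :: real assume "0 < e"
    with uD have "\<forall>\<^sub>F n in sequentially. \<forall>x\<in>{a..b}. dist (\<Sum>k<n. D k x) (\<Sum>k. D k x) < e"
      by (auto simp: uniform_limit_iff)
    then show "\<forall>\<^sub>F n in sequentially. \<forall>x\<in>{a..b}. \<forall>h. norm ((\<Sum>i<n. h *\<^sub>R D i x) - h *\<^sub>R (\<Sum>k. D k x)) \<le> e * norm h"
    proof eventually_elim
      case (elim n)
      show ?case
      proof (intro ballI allI)
        fix x h :: real assume "x \<in> {a..b}"
        then have "norm ((\<Sum>k<n. D k x) - (\<Sum>k. D k x)) \<le> e"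
          using elim unfolding dist_norm by (meson less_imp_le)
        then have "\<bar>h\<bar> * norm ((\<Sum>k<n. D k x) - (\<Sum>k. D k x)) \<le> \<bar>h\<bar> * e"
          by (rule mult_left_mono) simp
        then show "norm ((\<Sum>i<n. h *\<^sub>R D i x) - h *\<^sub>R (\<Sum>k. D k x)) \<le> e * norm h"
          unfolding scaleR_sum_right[symmetric] scaleR_diff_right[symmetric] norm_scaleR
          by (subst mult.commute[of e]) (simp only: real_norm_def)
      qed
    qed
  qed (use smX[of a] ab in \<open>auto simp: summable_sums\<close>)
  then obtain g where g: "\<And>x. x \<in> {a..b} \<Longrightarrow> (\<lambda>n. X n x) sums g x"
    "\<And>x. x \<in> {a..b} \<Longrightarrow> (g has_derivative (\<lambda>h. h *\<^sub>R (\<Sum>k. D k x))) (at x within {a..b})" by blast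
  define V where "V x = (if x \<in> {a..b} then g x else 0)" for x
  have V': "(V has_vector_derivative (\<Sum>k. D k x)) (at x within {a..b})" if "x \<in> {a..b}" for x
    using g(2)[OF that] that unfolding has_vector_derivative_def
    by (rule has_derivative_transform_within[OF _ zero_less_one]) (auto simp: V_def)
  have V: "V \<in> C1 a b"
    by (rule C1I[OF ab contD _ V']) (auto simp: V_def)
  have sumC1: "(\<lambda>x. \<Sum>k<n. X k x) \<in> C1 a b" for n
  proof (induction n)
    case (Suc n)
    show ?case using C1_lincomb(1)[OF Suc X[of n] ab, of 1 1] by simp
  qed (use C1_zero ab in auto)
  \<comment> \<open>Summing B / 2^k over k >= n gives 2 B / 2^n; this serves for the values and for
    the derivatives.\<close>
  have tail: "norm (S - (\<Sum>k<n. f k)) \<le> 2 * B * (1/2) ^ n"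
    if "f sums S" "\<And>k. norm (f k) \<le> B * (1/2) ^ k"
    for f :: "nat \<Rightarrow> complex" and S n
  proof -
    have 1: "(\<lambda>k. f (k + n)) sums (S - (\<Sum>k<n. f k))"
      by (subst sums_iff_shift) (simp only: diff_add_cancel that(1))
    have "(\<lambda>k. (B * (1/2) ^ n) * (1/2) ^ k) sums ((B * (1/2) ^ n) * (1 / (1 - 1/2)))"
      by (rule sums_mult, rule geometric_sums) simp
    note 2 = this
    have 3: "norm (f (k + n)) \<le> (B * (1/2) ^ n) * (1/2) ^ k" for k
    proof -
      have "B * (1/2) ^ (k + n) = (B * (1/2) ^ n) * (1/2) ^ k"
        by (simp only: power_add mult_ac)
      then show ?thesis using that(2)[of "k + n"] by (simp only:)
    qed
    have "norm (S - (\<Sum>k<n. f k)) \<le> (B * (1/2) ^ n) * (1 / (1 - 1/2))"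
      by (rule norm_sums_le[OF 1 2 3])
    moreover have "1 / (1 - 1/2) = (2 :: real)" by simp
    ultimately show ?thesis by (simp only: mult_ac)
  qed
  have le: "C1_norm a b (\<lambda>x. V x - (\<Sum>k<n. X k x)) \<le> 2 * B * (1/2) ^ n + 2 * B * (1/2) ^ n" for n
  proof (rule C1_norm_le[OF ab])
    fix x assume x: "x \<in> {a..b}"
    show "norm (V x - (\<Sum>k<n. X k x)) \<le> 2 * B * (1/2) ^ n"
      using tail[OF g(1)[OF x] leX[OF x], where n = n] x unfolding V_def by (simp only: if_True)
    have "((\<lambda>x. V x - (\<Sum>k<n. X k x)) has_vector_derivative ((\<Sum>k. D k x) - (\<Sum>k<n. D k x))) (at x within {a..b})"
      using C1D(2)[OF X ab x] V'[OF x]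
      by (intro has_vector_derivative_diff has_vector_derivative_sum) (auto simp: D_def)
    then have "vector_derivative (\<lambda>x. V x - (\<Sum>k<n. X k x)) (at x within {a..b}) = (\<Sum>k. D k x) - (\<Sum>k<n. D k x)"
      using x ab by (intro vector_derivative_within_cbox[where a = a and b = b, simplified]) auto
    then show "norm (vector_derivative (\<lambda>x. V x - (\<Sum>k<n. X k x)) (at x within {a..b})) \<le> 2 * B * (1/2) ^ n"
      using tail[OF summable_sums[OF smD[OF x]] leD[OF x], where n = n] by (simp only:)
  qed
  show thesis
  proof (rule that[OF V])
    fix n show "C1_norm a b (\<lambda>x. V x - (\<Sum>k<n. X k x)) \<le> 4 * B * (1/2) ^ n"
      using le[of n] by linarith
  qed
qed

text \<open>Absorbing K V in V = F V + K V gives |V| <= 2 |F V|, which yields injectivity and the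
  bound of the inverse at once. Surjectivity comes from the Neumann series.\<close>

theorem C1_bounded_operator_inverse:
  assumes ab: "a < b"
    and K: "C1_bounded_operator a b (1/2) K"
    and F: "\<And>V. V \<in> C1 a b \<Longrightarrow> F V = (\<lambda>x. V x - K V x)"
  shows "C1_bounded_operator a b 2 F" "bij_betw F (C1 a b) (C1 a b)"
    "C1_bounded_operator a b 2 (inv_into (C1 a b) F)"
proof -
  let ?C = "C1 a b" and ?n = "C1_norm a b"
  have KC: "V \<in> ?C \<Longrightarrow> K V \<in> ?C"
    and Kadd: "V \<in> ?C \<Longrightarrow> W \<in> ?C \<Longrightarrow> K (\<lambda>x. V x + W x) = (\<lambda>x. K V x + K W x)"
    and Kmul: "V \<in> ?C \<Longrightarrow> K (\<lambda>x. c * V x) = (\<lambda>x. c * K V x)"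
    and Kn: "V \<in> ?C \<Longrightarrow> ?n (K V) \<le> 1/2 * ?n V" for V W c
    using K unfolding C1_bounded_operator_def by auto
  have scale: "(\<lambda>x. c * V x) \<in> ?C" if "V \<in> ?C" for V c
    using C1_lincomb(1)[OF that that ab, of c 0] by simp
  have add: "(\<lambda>x. V x + W x) \<in> ?C" "?n (\<lambda>x. V x + W x) \<le> ?n V + ?n W" if "V \<in> ?C" "W \<in> ?C" for V W
    using C1_lincomb[OF that ab, of 1 1] by auto
  have diff: "(\<lambda>x. V x - W x) \<in> ?C" "?n (\<lambda>x. V x - W x) \<le> ?n V + ?n W" if "V \<in> ?C" "W \<in> ?C" for V W
    using C1_lincomb[OF that ab, of 1 "-1"] by auto
  have FC: "F V \<in> ?C" if "V \<in> ?C" for V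
    using diff(1)[OF that KC[OF that]] F[OF that] by simp
  have Fadd: "F (\<lambda>x. V x + W x) = (\<lambda>x. F V x + F W x)" if "V \<in> ?C" "W \<in> ?C" for V W
    using F[OF add(1)[OF that]] F[OF that(1)] F[OF that(2)] Kadd[OF that] by (auto simp: algebra_simps)
  have Fmul: "F (\<lambda>x. c * V x) = (\<lambda>x. c * F V x)" if "V \<in> ?C" for V c
    using F[OF scale[OF that]] F[OF that] Kmul[OF that] by (auto simp: algebra_simps)
  have Kdiff: "K (\<lambda>x. V x - W x) = (\<lambda>x. K V x - K W x)" if "V \<in> ?C" "W \<in> ?C" for V W
    using Kadd[OF that(1) scale[OF that(2), of "-1"]] Kmul[OF that(2), of "-1"] by simp
  have Fn: "?n (F V) \<le> 2 * ?n V" if "V \<in> ?C" for V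
    using diff(2)[OF that KC[OF that]] Kn[OF that] C1_norm_nonneg[OF that ab] by (simp add: F[OF that])
  show "C1_bounded_operator a b 2 F"
    unfolding C1_bounded_operator_def using FC Fadd Fmul Fn by auto
  have lower: "?n V \<le> 2 * ?n (F V)" if V: "V \<in> ?C" for V
  proof -
    have "V = (\<lambda>x. F V x + K V x)" using F[OF V] by auto
    then have "?n V \<le> ?n (F V) + ?n (K V)" using add(2)[OF FC[OF V] KC[OF V]] by simp
    then show ?thesis using Kn[OF V] by simp
  qed
  have inj: "inj_on F ?C"
  proof (rule inj_onI)
    fix V W assume VW: "V \<in> ?C" "W \<in> ?C" "F V = F W"
    let ?d = "\<lambda>x. V x - W x"
    have "F ?d = (\<lambda>x. F V x - F W x)"
      using F[OF diff(1)[OF VW(1,2)]] F[OF VW(1)] F[OF VW(2)] Kdiff[OF VW(1,2)] by auto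
    then have "?n ?d \<le> 0"
      using lower[OF diff(1)[OF VW(1,2)]] VW(3) C1_zero(2)[OF ab] by simp
    then have "?d = (\<lambda>x. 0)" by (rule C1_norm_eq_0[OF diff(1)[OF VW(1,2)] ab])
    then show "V = W" by (auto simp: fun_eq_iff)
  qed
  have surj: "W \<in> F ` ?C" if W: "W \<in> ?C" for W
  proof -
    define X where "X n = (K ^^ n) W" for n
    have X: "X n \<in> ?C" "?n (X n) \<le> ?n W * (1/2) ^ n" for n
    proof (induction n)
      case (Suc n)
      { case 1 show ?case using KC[OF Suc(1)] by (simp add: X_def) }
      { case 2 show ?case using Kn[OF Suc(1)] Suc(2) by (simp add: X_def) }
    qed (use W in \<open>auto simp: X_def\<close>)
    obtain V where V: "V \<in> ?C" "\<And>n. ?n (\<lambda>x. V x - (\<Sum>k<n. X k x)) \<le> 4 * ?n W * (1/2) ^ n"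
      using C1_geometric_series[OF ab X] by blast
    define S where "S n x = (\<Sum>k<n. X k x)" for n x
    have S: "S n \<in> ?C" for n
    proof (induction n)
      case (Suc n)
      show ?case using add(1)[OF Suc X(1)[of n]] by (simp add: S_def)
    qed (use C1_zero ab in \<open>auto simp: S_def\<close>)
    \<comment> \<open>The partial sums telescope: F maps the sum of the K^k W with k < n to W - K^n
      W.\<close>
    have FS: "F (S n) = (\<lambda>x. W x - X n x)" for n
    proof (induction n)
      case 0
      have "K (\<lambda>x. 0) = (\<lambda>x. 0)" using Kmul[OF W, of 0] by simp
      then show ?case using F[OF C1_zero(1)[OF ab]] by (simp add: S_def X_def)
    next
      case (Suc n)
      have "S (Suc n) = (\<lambda>x. S n x + X n x)" by (simp add: S_def fun_eq_iff)
      then show ?case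
        using Fadd[OF S X(1), of n n] Suc F[OF X(1)[of n]] by (auto simp: X_def)
    qed
    let ?R = "\<lambda>x. W x - F V x"
    have R: "?R \<in> ?C" by (rule diff(1)[OF W FC[OF V(1)]])
    \<comment> \<open>The residual is K^n W - F (V - S n). The first part contributes 1, the second
      2 * 4, because F has norm at most 2.\<close>
    have "?n ?R \<le> 9 * ?n W * (1/2) ^ n" for n
    proof -
      have d: "(\<lambda>x. V x - S n x) \<in> ?C" by (rule diff(1)[OF V(1) S])
      have "F (\<lambda>x. V x - S n x) = (\<lambda>x. F V x - F (S n) x)"
        using F[OF d] F[OF V(1)] F[OF S] Kdiff[OF V(1) S] by auto
      then have "?R = (\<lambda>x. X n x - F (\<lambda>x. V x - S n x) x)"
        by (auto simp: FS)
      then have "?n ?R \<le> ?n (X n) + ?n (F (\<lambda>x. V x - S n x))"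
        using diff(2)[OF X(1) FC[OF d], of n] by simp
      then show ?thesis
        using Fn[OF d] V(2)[of n] X(2)[of n] by (simp add: S_def)
    qed
    moreover have "(\<lambda>n. 9 * ?n W * (1/2) ^ n) \<longlonglongrightarrow> 9 * ?n W * 0"
      by (intro tendsto_mult tendsto_const LIMSEQ_power_zero) auto
    ultimately have "?n ?R \<le> 0"
      by (intro LIMSEQ_le_const[where a = "?n ?R"]) auto
    then have "?R = (\<lambda>x. 0)" by (rule C1_norm_eq_0[OF R ab])
    then have "W = F V" by (auto simp: fun_eq_iff)
    then show ?thesis using V(1) by auto
  qed
  show bij: "bij_betw F ?C ?C"
    unfolding bij_betw_def using inj surj FC by auto
  let ?G = "inv_into ?C F"
  have G: "?G W \<in> ?C" "F (?G W) = W" if "W \<in> ?C" for W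
    using inv_into_into[of W F ?C] f_inv_into_f[of W F ?C] surj[OF that] by auto
  have Geq: "?G W = V" if "V \<in> ?C" "F V = W" for V W
    using inv_into_f_f[OF inj that(1)] that(2) by simp
  show "C1_bounded_operator a b 2 ?G"
    unfolding C1_bounded_operator_def
  proof (intro conjI ballI allI)
    show "?G \<in> ?C \<rightarrow> ?C" using G by auto
    show "?G (\<lambda>x. V x + W x) = (\<lambda>x. ?G V x + ?G W x)" if "V \<in> ?C" "W \<in> ?C" for V W
      using that G by (intro Geq add(1)) (auto simp: Fadd)
    show "?G (\<lambda>x. c * V x) = (\<lambda>x. c * ?G V x)" if "V \<in> ?C" for V c
      using that G by (intro Geq scale) (auto simp: Fmul)
    show "?n (?G V) \<le> 2 * ?n V" if "V \<in> ?C" for V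
      using lower[OF G(1)[OF that]] G(2)[OF that] by simp
  qed
qed

subsection \<open>Bessel's inequality for sines\<close>

text \<open>Orthogonality of the functions sin (2 pi m t) on [0, 1/2], pulled back along t = tau x.
  The product formula turns the integrand into cosines of integer frequency, whose antiderivatives
  sin (2 pi k tau x) / (2 pi k) vanish at both ends.\<close>

lemma sin_product_integral:
  fixes \<tau> \<tau>' :: "real \<Rightarrow> real"
  assumes ab: "a \<le> b"
    and der: "\<And>x. x \<in> {a..b} \<Longrightarrow> (\<tau> has_vector_derivative \<tau>' x) (at x within {a..b})"
    and bd: "\<tau> a = 0" "\<tau> b = 1/2"
    and mn: "m \<noteq> 0" "n \<noteq> 0"
  shows "((\<lambda>x. sin (2 * pi * real m * \<tau> x) * sin (2 * pi * real n * \<tau> x) * \<tau>' x) has_integral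
    (if m = n then 1/4 else 0)) {a..b}"
proof -
  have der': "(\<tau> has_real_derivative \<tau>' x) (at x within {a..b})" if "x \<in> {a..b}" for x
    using der[OF that] by (simp add: has_real_derivative_iff_has_vector_derivative)
  have cosint: "((\<lambda>x. cos (2 * pi * k * \<tau> x) * \<tau>' x) has_integral (if k = 0 then 1/2 else 0)) {a..b}"
    if "k \<in> \<int>" for k :: real
  proof (cases "k = 0")
    case True
    then show ?thesis
      using fundamental_theorem_of_calculus[OF ab der] bd by simp
  next
    case False
    have "((\<lambda>x. cos (2 * pi * k * \<tau> x) * \<tau>' x) has_integral
        (sin (2 * pi * k * \<tau> b) / (2 * pi * k) - sin (2 * pi * k * \<tau> a) / (2 * pi * k))) {a..b}"
    proof (rule fundamental_theorem_of_calculus[OF ab])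
      fix x assume x: "x \<in> {a..b}"
      show "((\<lambda>x. sin (2 * pi * k * \<tau> x) / (2 * pi * k)) has_vector_derivative cos (2 * pi * k * \<tau> x) * \<tau>' x)
          (at x within {a..b})"
        unfolding has_real_derivative_iff_has_vector_derivative[symmetric]
        using False by (auto intro!: derivative_eq_intros der'[OF x])
    qed
    moreover have "sin (pi * k) = 0"
      using that by (auto simp: sin_zero_iff_int2 Ints_def)
    ultimately show ?thesis using False bd by simp
  qed
  have "((\<lambda>x. (cos (2 * pi * (real m - real n) * \<tau> x) * \<tau>' x - cos (2 * pi * (real m + real n) * \<tau> x) * \<tau>' x) / 2)
     has_integral ((if real m - real n = 0 then 1/2 else 0) - (if real m + real n = 0 then 1/2 else 0)) / 2) {a..b}"
    by (intro has_integral_divide has_integral_diff cosint) auto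
  moreover have "(cos (2 * pi * (real m - real n) * t) * s - cos (2 * pi * (real m + real n) * t) * s) / 2
      = sin (2 * pi * real m * t) * sin (2 * pi * real n * t) * s" for t s
    by (simp add: sin_times_sin algebra_simps)
  ultimately show ?thesis using mn by (cases "m = n") simp_all
qed

text \<open>Expand the nonnegative integral of the weighted square of G minus its orthogonal
  projection. The total weight of tau' is 1/2, so the square of G integrates to at most B^2 / 2;
  division by 4 gives the right-hand side.\<close>

lemma Bessel_sine:
  fixes \<tau> \<tau>' :: "real \<Rightarrow> real" and G :: "real \<Rightarrow> complex"
  assumes ab: "a < b"
    and der: "\<And>x. x \<in> {a..b} \<Longrightarrow> (\<tau> has_vector_derivative \<tau>' x) (at x within {a..b})"
    and bd: "\<tau> a = 0" "\<tau> b = 1/2"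
    and cont: "continuous_on {a..b} \<tau>'" "continuous_on {a..b} G"
    and pos: "\<And>x. x \<in> {a..b} \<Longrightarrow> 0 \<le> \<tau>' x"
    and B: "\<And>x. x \<in> {a..b} \<Longrightarrow> norm (G x) \<le> B"
    and A: "finite A" "0 \<notin> A"
  shows "(\<Sum>m\<in>A. (norm (integral {a..b} (\<lambda>x. (sin (2 * pi * real m * \<tau> x) * \<tau>' x) *\<^sub>R G x)))\<^sup>2) \<le> B\<^sup>2 / 8"
proof -
  have contt: "continuous_on {a..b} \<tau>"
    using der by (meson continuous_on_vector_derivative)
  define e where "e m x = sin (2 * pi * real m * \<tau> x)" for m x
  define c where "c m = integral {a..b} (\<lambda>x. (e m x * \<tau>' x) *\<^sub>R G x)" for m
  have conte: "continuous_on {a..b} (e m)" for m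
    unfolding e_def by (intro continuous_intros contt)
  have ci: "((\<lambda>x. (e m x * \<tau>' x) *\<^sub>R G x) has_integral c m) {a..b}" for m
    unfolding c_def has_integral_integral[symmetric]
    by (intro integrable_continuous_real continuous_intros conte cont)
  have ee: "((\<lambda>x. e m x * e n x * \<tau>' x) has_integral (if m = n then 1/4 else 0)) {a..b}" if "m \<in> A" "n \<in> A" for m n
    unfolding e_def using that A ab by (intro sin_product_integral[OF _ der bd]) (auto intro: ccontr)
  have cG: "((\<lambda>x. (e m x * \<tau>' x) * (c m \<bullet> G x)) has_integral (norm (c m))\<^sup>2) {a..b}" for m
    using has_integral_linear[OF ci[of m] bounded_linear_inner_right[of "c m"]]
    by (simp add: o_def power2_norm_eq_inner)
  have GG: "((\<lambda>x. (norm (G x))\<^sup>2 * \<tau>' x) has_integral integral {a..b} (\<lambda>x. (norm (G x))\<^sup>2 * \<tau>' x)) {a..b}"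
    unfolding has_integral_integral[symmetric]
    by (intro integrable_continuous_real continuous_intros cont)
  \<comment> \<open>The factor 4 is the inverse of the squared norm 1/4 of each sine, so
    \<open>?S\<close> is the orthogonal projection of G onto the span of the sines.\<close>
  let ?S = "\<lambda>x. \<Sum>m\<in>A. (4 * e m x) *\<^sub>R c m"
  have expand: "(norm (G x - ?S x))\<^sup>2 * \<tau>' x = (norm (G x))\<^sup>2 * \<tau>' x - 8 * (\<Sum>m\<in>A. (e m x * \<tau>' x) * (c m \<bullet> G x))
      + 16 * (\<Sum>m\<in>A. \<Sum>n\<in>A. (c m \<bullet> c n) * (e m x * e n x * \<tau>' x))" for x
    unfolding power2_norm_eq_inner
    by (simp add: inner_diff_left inner_diff_right inner_sum_left inner_sum_right algebra_simps
        sum_distrib_left sum_distrib_right inner_commute sum.distrib)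
  have "((\<lambda>x. (norm (G x - ?S x))\<^sup>2 * \<tau>' x) has_integral
      integral {a..b} (\<lambda>x. (norm (G x))\<^sup>2 * \<tau>' x) - 8 * (\<Sum>m\<in>A. (norm (c m))\<^sup>2)
       + 16 * (\<Sum>m\<in>A. \<Sum>n\<in>A. (c m \<bullet> c n) * (if m = n then 1/4 else 0))) {a..b}"
    unfolding expand
    by (intro has_integral_add has_integral_diff has_integral_mult_right has_integral_sum A cG GG ee)
  moreover have "(\<Sum>m\<in>A. \<Sum>n\<in>A. (c m \<bullet> c n) * (if m = n then 1/4 else 0)) = (\<Sum>m\<in>A. (norm (c m))\<^sup>2) / 4"
    using A by (simp add: sum_divide_distrib power2_norm_eq_inner if_distrib sum.delta' cong: if_cong)
  ultimately have "0 \<le> integral {a..b} (\<lambda>x. (norm (G x))\<^sup>2 * \<tau>' x) - 4 * (\<Sum>m\<in>A. (norm (c m))\<^sup>2)"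
    using pos by (auto dest!: has_integral_nonneg)
  moreover have "integral {a..b} (\<lambda>x. (norm (G x))\<^sup>2 * \<tau>' x) \<le> integral {a..b} (\<lambda>x. B\<^sup>2 * \<tau>' x)"
    using pos B by (intro integral_le integrable_continuous_real continuous_intros cont)
      (auto intro!: mult_right_mono power_mono)
  moreover have "integral {a..b} (\<lambda>x. B\<^sup>2 * \<tau>' x) = B\<^sup>2 / 2"
    using fundamental_theorem_of_calculus[OF less_imp_le[OF ab] der] bd by (auto dest: integral_unique)
  ultimately have "(\<Sum>m\<in>A. (norm (c m))\<^sup>2) \<le> B\<^sup>2 / 8" by linarith
  then show ?thesis unfolding c_def e_def .
qed

text \<open>The exact value of the full series is pi^2 / 6. Rounding it up to 2 fits the bound b^2 /
  8 of Bessel's inequality: the product of the two is a perfect square, (b / 2)^2.\<close>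

lemma sum_inverse_squares_bounded:
  assumes "finite A" "0 \<notin> (A :: nat set)"
  shows "(\<Sum>m\<in>A. (1 / real m)\<^sup>2) \<le> 2"
proof -
  have "(\<Sum>m\<in>A. (1 / real m)\<^sup>2) \<le> (\<Sum>m. (1 / real (Suc m))\<^sup>2)"
  proof -
    have "(\<Sum>m\<in>A. (1 / real m)\<^sup>2) = (\<Sum>m\<in>(\<lambda>m. m - 1) ` A. (1 / real (Suc m))\<^sup>2)"
    proof (subst sum.reindex)
      show "inj_on (\<lambda>m. m - 1) A"
        using assms by (auto simp: inj_on_def) (metis Suc_pred neq0_conv)
      have "Suc (m - 1) = m" if "m \<in> A" for m
        using that assms by (cases m) auto
      then show "(\<Sum>m\<in>A. (1 / real m)\<^sup>2) = sum ((\<lambda>m. (1 / real (Suc m))\<^sup>2) \<circ> (\<lambda>m. m - 1)) A"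
        by (intro sum.cong) (auto simp del: of_nat_Suc)
    qed
    also have "\<dots> \<le> (\<Sum>m. (1 / real (Suc m))\<^sup>2)"
      using assms inverse_squares_sums by (intro sum_le_suminf) (auto simp: sums_iff power_one_over field_simps)
    finally show ?thesis .
  qed
  also have "(\<Sum>m. (1 / real (Suc m))\<^sup>2) = pi\<^sup>2 / 6"
    using inverse_squares_sums by (simp add: sums_iff power_one_over field_simps)
  also have "\<dots> \<le> (3.2)\<^sup>2 / 6" 
    using pi_approx by (intro divide_right_mono power_mono) auto
  also have "\<dots> \<le> 2" by (simp add: power2_eq_square)
  finally show ?thesis .
qed

lemma sum_mult_le_sqrt:
  fixes f g :: "'a \<Rightarrow> real"
  assumes "(\<Sum>i\<in>A. (f i)\<^sup>2) \<le> a" "(\<Sum>i\<in>A. (g i)\<^sup>2) \<le> b" 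
  shows "(\<Sum>i\<in>A. f i * g i) \<le> sqrt a * sqrt b"
proof -
  have "(\<Sum>i\<in>A. f i * g i) \<le> L2_set f A * L2_set g A"
    by (intro order_trans[OF _ L2_set_mult_ineq] sum_mono) (simp add: abs_mult[symmetric])
  also have "\<dots> \<le> sqrt a * sqrt b"
    unfolding L2_set_def using assms by (intro mult_mono real_sqrt_le_mono) (auto intro: sum_nonneg order_trans[OF sum_nonneg assms(1)])
  finally show ?thesis .
qed

subsection \<open>Density and potential of a steady state\<close>

text \<open>Monotonicity from the origin for functions known to be differentiable only on r > 0 and
  there controlled through a limit at 0. It is used to compare the enclosed mass and the potential
  with their values at the origin.\<close>

lemma nonneg_deriv_limit:
  fixes f f' :: "real \<Rightarrow> real"
  assumes der: "\<And>x. 0 < x \<Longrightarrow> (f has_real_derivative f' x) (at x)"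
    and nn: "\<And>x. 0 < x \<Longrightarrow> 0 \<le> f' x"
    and lim: "(f \<longlongrightarrow> l) (at_right 0)" and r: "0 < r"
  shows "l \<le> f r"
proof (rule tendsto_upperbound[OF lim])
  show "\<forall>\<^sub>F x in at_right 0. f x \<le> f r"
    unfolding eventually_at_right_field
  proof (intro exI[of _ r] conjI r allI impI)
    fix y assume "0 < y" "y < r"
    then show "f y \<le> f r"
      by (intro DERIV_nonneg_imp_nondecreasing[of y r f]) (auto intro!: exI[of _ "f' x" for x] der nn)
  qed
qed simp

text \<open>The dimensionless constant that remains of the velocity integral once r and the energy
  depth are scaled out. The estimates use only its sign, which a total integral of a nonnegative
  function has in any case.\<close>

definition reduced_density :: "real \<Rightarrow> real \<Rightarrow> real" where
  "reduced_density \<mu> \<nu> = (LINT v|lebesgue. LINT l|lebesgue.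
     max 0 (1 - v\<^sup>2 / 2 - l) powr \<mu> * max 0 l powr \<nu>)"

lemma reduced_density_nonneg: "0 \<le> reduced_density \<mu> \<nu>"
  unfolding reduced_density_def by (intro Bochner_Integration.integral_nonneg) auto

lemma max_0_mult: "0 < c \<Longrightarrow> max 0 (c * x) = c * max 0 (x :: real)"
  using max_mult_distrib_left[of c 0 x] by simp

context point_mass_vlasov_poisson
begin

text \<open>Both integrations scale out: \<open>L - L0\<close> is measured in units of \<open>2 r\<^sup>2 e\<close> and \<open>w\<close> in units of
  \<open>sqrt e\<close>, where \<open>e = E0 - Psi L0 r\<close>.\<close>

lemma rho_eq:
  assumes "0 < r" "0 < L0" "0 < \<mu>" "0 < \<nu>"
  shows "rho r = \<eta> * (pi * 2 powr (\<nu> + 1) * reduced_density \<mu> \<nu>) * r powr (2 * \<nu>)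
    * max 0 (E0 - Psi L0 r) powr (\<mu> + \<nu> + 3/2)"
proof -
  define e where "e = E0 - Psi L0 r"
  define g where "g w L = \<eta> * (max 0 (e - w\<^sup>2 / 2 - (L - L0) / (2 * r\<^sup>2)) powr \<mu> * max 0 (L - L0) powr \<nu>)" for w L
  have 1: "(LINT L:{0..}|lebesgue. f_steady r w L) = (LINT L|lebesgue. g w L)" for w
    unfolding set_lebesgue_integral_def
  proof (rule Bochner_Integration.integral_cong[OF refl])
    fix L
    have "E0 - energy r w L = e - w\<^sup>2 / 2 - (L - L0) / (2 * r\<^sup>2)"
      by (simp add: energy_def Psi_def e_def diff_divide_distrib)
    then show "indicat_real {0..} L *\<^sub>R f_steady r w L = g w L"
      using assms by (cases "L \<ge> 0") (auto simp: f_steady_def phi_def g_def)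
  qed
  show ?thesis
  proof (cases "e > 0")
    case False
    \<comment> \<open>For L > L0 the first power has a nonpositive argument because e <= 0; for L <=
      L0 the second power is 0.\<close>
    have "g w L = 0" for w L
    proof (cases "L > L0")
      case True
      then have "0 < (L - L0) / (2 * r\<^sup>2)" using assms by auto
      then have "e - w\<^sup>2 / 2 - (L - L0) / (2 * r\<^sup>2) \<le> 0"
        using False zero_le_power2[of w] by linarith
      then have "max 0 (e - w\<^sup>2 / 2 - (L - L0) / (2 * r\<^sup>2)) = 0" by simp
      then show ?thesis by (simp add: g_def)
    qed (simp add: g_def)
    moreover have "max 0 (E0 - Psi L0 r) = 0" using False by (simp add: e_def)
    ultimately show ?thesis by (simp add: rho_def 1)
  next
    case True
    define c where "c = 2 * r\<^sup>2 * e"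
    have c: "c > 0" "c / (2 * r\<^sup>2) = e" using True assms by (auto simp: c_def)
    have 2: "g (sqrt e * v) (L0 + c * l) = \<eta> * e powr \<mu> * c powr \<nu> *
        (max 0 (1 - v\<^sup>2 / 2 - l) powr \<mu> * max 0 l powr \<nu>)" for v l
    proof -
      have "(L0 + c * l - L0) / (2 * r\<^sup>2) = e * l" using c(2) by (simp add: times_divide_eq_left[symmetric] del: times_divide_eq_left)
      moreover have "(sqrt e * v)\<^sup>2 = e * v\<^sup>2" using True by (simp add: power_mult_distrib)
      ultimately have *: "e - (sqrt e * v)\<^sup>2 / 2 - (L0 + c * l - L0) / (2 * r\<^sup>2) = e * (1 - v\<^sup>2 / 2 - l)"
        by (simp only: right_diff_distrib times_divide_eq_right mult_1_right)
      have "max 0 (e - (sqrt e * v)\<^sup>2 / 2 - (L0 + c * l - L0) / (2 * r\<^sup>2)) powr \<mu>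
          = e powr \<mu> * max 0 (1 - v\<^sup>2 / 2 - l) powr \<mu>"
        unfolding * max_0_mult[OF True] by (rule powr_mult)
      moreover have "max 0 (L0 + c * l - L0) powr \<nu> = c powr \<nu> * max 0 l powr \<nu>"
        unfolding add_diff_cancel_left' max_0_mult[OF c(1)] by (rule powr_mult)
      ultimately show ?thesis unfolding g_def by (simp only: mult_ac)
    qed
    have 3: "(LINT L|lebesgue. g (sqrt e * v) L) = (c * (\<eta> * e powr \<mu> * c powr \<nu>)) *
        (LINT l|lebesgue. max 0 (1 - v\<^sup>2 / 2 - l) powr \<mu> * max 0 l powr \<nu>)" for v
    proof -
      have "(LINT L|lebesgue. g (sqrt e * v) L) = \<bar>c\<bar> *\<^sub>R (LINT l|lebesgue. g (sqrt e * v) (L0 + c * l))"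
        using c(1) by (intro lebesgue_integral_real_affine) simp
      then show ?thesis
        unfolding 2 using c(1) by (simp only: integral_mult_right_zero abs_of_pos real_scaleR_def mult.assoc)
    qed
    have "(LINT w|lebesgue. LINT L|lebesgue. g w L) = \<bar>sqrt e\<bar> *\<^sub>R (LINT v|lebesgue. LINT L|lebesgue. g (0 + sqrt e * v) L)"
      using True by (intro lebesgue_integral_real_affine[of "sqrt e" "\<lambda>w. LINT L|lebesgue. g w L" 0]) simp
    also have "\<dots> = sqrt e * ((c * (\<eta> * e powr \<mu> * c powr \<nu>)) * reduced_density \<mu> \<nu>)"
      unfolding add_0 3 reduced_density_def integral_mult_right_zero real_scaleR_def
      using True by (simp only: abs_of_pos real_sqrt_gt_0_iff)
    finally have "rho r = pi / r\<^sup>2 * (sqrt e * ((c * (\<eta> * e powr \<mu> * c powr \<nu>)) * reduced_density \<mu> \<nu>))"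
      unfolding rho_def 1 by (simp only:)
    also have "\<dots> = \<eta> * (pi * reduced_density \<mu> \<nu>) * inverse (r\<^sup>2) * ((c * c powr \<nu>) * (sqrt e * e powr \<mu>))"
      unfolding divide_inverse by (simp only: mult_ac)
    \<comment> \<open>Counting exponents: c is the Jacobian in L and c powr nu comes from the power
      of L - L0, together r^(2 nu + 2) e^(nu + 1). The w-integral adds e^(mu + 1/2), and the
      prefactor 1 / r^2 removes r^2.\<close>
    also have "c * c powr \<nu> = 2 powr (\<nu> + 1) * r powr (2 * \<nu> + 2) * e powr (\<nu> + 1)"
    proof -
      have "c * c powr \<nu> = c powr (\<nu> + 1)" using c by (simp add: powr_add)
      also have "\<dots> = 2 powr (\<nu> + 1) * (r powr 2) powr (\<nu> + 1) * e powr (\<nu> + 1)"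
        using assms True by (simp add: c_def powr_mult)
      also have "(r powr 2) powr (\<nu> + 1) = r powr (2 * \<nu> + 2)"
        unfolding powr_powr by (simp add: algebra_simps)
      finally show ?thesis .
    qed
    also have "r powr (2 * \<nu> + 2) = r powr (2 * \<nu>) * r\<^sup>2"
      using assms by (simp add: powr_add)
    also have "sqrt e * e powr \<mu> = e powr (\<mu> + 1/2)"
      using True by (simp add: powr_add powr_half_sqrt)
    also have "\<eta> * (pi * reduced_density \<mu> \<nu>) * inverse (r\<^sup>2) *
        (2 powr (\<nu> + 1) * (r powr (2 * \<nu>) * r\<^sup>2) * e powr (\<nu> + 1) * e powr (\<mu> + 1/2)) =
        \<eta> * (pi * 2 powr (\<nu> + 1) * reduced_density \<mu> \<nu>) * r powr (2 * \<nu>) * (inverse (r\<^sup>2) * r\<^sup>2) *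
          (e powr (\<nu> + 1) * e powr (\<mu> + 1/2))"
      by (simp only: mult_ac)
    also have "e powr (\<nu> + 1) * e powr (\<mu> + 1/2) = e powr (\<mu> + \<nu> + 3/2)"
    proof -
      have "(\<nu> + 1) + (\<mu> + 1/2) = \<mu> + \<nu> + 3/2" by simp
      then show ?thesis unfolding powr_add[symmetric] by (simp only:)
    qed
    also have "inverse (r\<^sup>2) * r\<^sup>2 = 1" using assms by simp
    finally have "rho r = \<eta> * (pi * 2 powr (\<nu> + 1) * reduced_density \<mu> \<nu>) * r powr (2 * \<nu>) * 1 * e powr (\<mu> + \<nu> + 3/2)" .
    moreover have "max 0 (E0 - Psi L0 r) = e" using True by (simp add: e_def)
    ultimately show ?thesis by (simp only: mult_1_right)
  qed
qed

end

lemma matrix_vector_axis_inner: "(A *v axis i 1) \<bullet> axis i 1 = A $ i $ i" for A :: "real^'n^'n"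
  by (simp add: matrix_vector_mult_basis column_def inner_axis)

text \<open>At the point r e_1 the Hessian has the diagonal entries U'' and twice U' / r.
  Multiplying their sum by r^2 gives (r^2 U')'. The limits at 0 hold because the potential is
  differentiable at the origin of the space.\<close>

lemma radial_poisson:
  fixes U rh :: "real \<Rightarrow> real"
  assumes "poisson_solution (\<lambda>x. U (norm x)) (\<lambda>x. rh (norm x))"
  obtains U1 where "\<And>r. 0 < r \<Longrightarrow> (U has_real_derivative U1 r) (at r)"
    "\<And>r. 0 < r \<Longrightarrow> ((\<lambda>r. r\<^sup>2 * U1 r) has_real_derivative 4 * pi * r\<^sup>2 * rh r) (at r)"
    "((\<lambda>r. r\<^sup>2 * U1 r) \<longlongrightarrow> 0) (at_right 0)" "(U \<longlongrightarrow> U 0) (at_right 0)"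
proof -
  obtain g and H :: "real^3 \<Rightarrow> real^3^3" where
    g: "\<And>x. ((\<lambda>x. U (norm x)) has_derivative (\<lambda>h. g x \<bullet> h)) (at x)" and
    H: "\<And>x. (g has_derivative (\<lambda>h. H x *v h)) (at x)" and
    tr: "\<And>x. trace (H x) = 4 * pi * rh (norm x)"
    using assms unfolding poisson_solution_def by blast
  define e :: "3 \<Rightarrow> real^3" where "e i = axis i 1" for i
  have ne: "norm (e i) = 1" for i by (simp add: e_def)
  have ee: "e i \<bullet> e j = (if i = j then 1 else 0)" for i j by (simp add: e_def inner_axis_axis)
  define U1 where "U1 r = g (r *\<^sub>R e 1) \<bullet> e 1" for r
  have gc: "isCont g x" for x using H has_derivative_continuous by blast
  have U1: "(U has_real_derivative U1 r) (at r)" if "0 < r" for r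
  proof -
    have "((\<lambda>r. U (norm (r *\<^sub>R e 1))) has_derivative (\<lambda>h. g (r *\<^sub>R e 1) \<bullet> (h *\<^sub>R e 1))) (at r)"
      by (rule has_derivative_compose[OF _ g]) (auto intro!: derivative_eq_intros)
    then have "((\<lambda>r. U (norm (r *\<^sub>R e 1))) has_real_derivative U1 r) (at r)"
      by (simp add: has_field_derivative_def U1_def mult_commute_abs)
    then show ?thesis
      by (rule has_field_derivative_transform_within_open[of _ _ _ "{0<..}"]) (use that in \<open>auto simp: ne\<close>)
  qed
  have line: "((\<lambda>s. g (x + s *\<^sub>R e i) \<bullet> e i) has_real_derivative H (x + s *\<^sub>R e i) $ i $ i) (at s)" for x s i
  proof -
    have "((\<lambda>s. g (x + s *\<^sub>R e i)) has_derivative (\<lambda>h. H (x + s *\<^sub>R e i) *v (h *\<^sub>R e i))) (at s)"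
      by (rule has_derivative_compose[OF _ H]) (auto intro!: derivative_eq_intros)
    then have "((\<lambda>s. g (x + s *\<^sub>R e i) \<bullet> e i) has_derivative (\<lambda>h. (H (x + s *\<^sub>R e i) *v (h *\<^sub>R e i)) \<bullet> e i)) (at s)"
      by (rule has_derivative_inner_left)
    then show ?thesis
      by (simp add: has_field_derivative_def e_def matrix_vector_axis_inner matrix_vector_mult_scaleR mult_commute_abs)
  qed
  have dU1: "(U1 has_real_derivative H (r *\<^sub>R e 1) $ 1 $ 1) (at r)" for r
    using line[of 0 1 r] by (simp add: U1_def[abs_def])
  have gx: "g x \<bullet> h = U1 (norm x) * (sgn x \<bullet> h)" if "x \<noteq> 0" for x h
  proof -
    have "(U has_derivative (\<lambda>h. U1 (norm x) * h)) (at (norm x))"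
      using that U1[of "norm x"] by (simp add: has_field_derivative_def)
    from has_derivative_compose[OF has_derivative_norm[OF that] this]
    have "((\<lambda>x. U (norm x)) has_derivative (\<lambda>h. U1 (norm x) * (sgn x \<bullet> h))) (at x)"
      by (simp add: inner_commute)
    then show ?thesis using has_derivative_unique[OF g] by metis
  qed
  have off: "H (r *\<^sub>R e 1) $ i $ i = U1 r / r" if "0 < r" "i \<noteq> 1" for r i
  proof -
    let ?x = "\<lambda>s. r *\<^sub>R e 1 + s *\<^sub>R e i"
    have x1: "?x s \<bullet> e 1 = r" for s using that by (simp add: inner_add_left ee)
    have nz: "?x s \<noteq> 0" for s
    proof
      assume "?x s = 0"
      then have "?x s \<bullet> e 1 = 0" by (simp only: inner_zero_left)
      then show False using x1[of s] that by simp
    qed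
    have gs: "g (?x s) \<bullet> e i = (U1 (norm (?x s)) / norm (?x s)) * s" for s
    proof -
      have "?x s \<bullet> e i = s" using that by (simp add: inner_add_left ee)
      then have "sgn (?x s) \<bullet> e i = inverse (norm (?x s)) * s" by (simp only: sgn_div_norm inner_scaleR_left)
      then show ?thesis by (simp only: gx[OF nz] divide_inverse mult.assoc)
    qed
    have U1c: "isCont U1 y" for y using dU1 DERIV_isCont by blast
    have "isCont (\<lambda>s. U1 (norm (?x s))) 0"
      by (rule isCont_o2[OF _ U1c]) (intro continuous_intros)
    then have "isCont (\<lambda>s. U1 (norm (?x s)) / norm (?x s)) 0"
      using nz[of 0] by (intro isCont_divide) (auto intro!: continuous_intros)
    \<comment> \<open>Along a tangential line the gradient component is s times a factor that is
      continuous at s = 0. By Caratheodory's criterion its derivative there is the value of the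
      factor.\<close>
    then have "((\<lambda>s. g (?x s) \<bullet> e i) has_real_derivative U1 r / r) (at 0)"
      unfolding CARAT_DERIV using that gs[of 0]
      by (intro exI[of _ "\<lambda>s. U1 (norm (?x s)) / norm (?x s)"]) (auto simp: gs ne)
    then show ?thesis using DERIV_unique[OF line[of "r *\<^sub>R e 1" i 0]] by simp
  qed
  have "((\<lambda>r. r\<^sup>2 * U1 r) has_real_derivative 4 * pi * r\<^sup>2 * rh r) (at r)" if "0 < r" for r
  proof -
    have "4 * pi * rh r = H (r *\<^sub>R e 1) $ 1 $ 1 + 2 * (U1 r / r)"
      using tr[of "r *\<^sub>R e 1"] off[OF that, of 2] off[OF that, of 3] that by (simp add: trace_def sum_3 ne)
    then have "r\<^sup>2 * (4 * pi * rh r) = r\<^sup>2 * H (r *\<^sub>R e 1) $ 1 $ 1 + 2 * r * U1 r"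
      using that by (simp only: distrib_left) (simp add: power2_eq_square)
    then have "4 * pi * r\<^sup>2 * rh r = r\<^sup>2 * H (r *\<^sub>R e 1) $ 1 $ 1 + 2 * r * U1 r" by (simp only: mult_ac)
    then show ?thesis
      using DERIV_mult[OF DERIV_pow[of 2 r] dU1[of r]] by (simp add: add.commute mult.commute)
  qed
  moreover have "((\<lambda>r. r\<^sup>2 * U1 r) \<longlongrightarrow> 0) (at_right 0)"
  proof -
    have "isCont U1 0" using dU1 DERIV_isCont by blast
    then have "(U1 \<longlongrightarrow> U1 0) (at_right 0)" by (auto simp: isCont_def intro: tendsto_within_subset)
    then have "((\<lambda>r. r\<^sup>2 * U1 r) \<longlongrightarrow> 0\<^sup>2 * U1 0) (at_right 0)" by (intro tendsto_intros)
    then show ?thesis by simp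
  qed
  moreover have "(U \<longlongrightarrow> U 0) (at_right 0)"
  proof -
    have "isCont (\<lambda>x. U (norm x)) (0 :: real^3)" using g has_derivative_continuous by blast
    then have "isCont (\<lambda>x. U (norm x)) (0 *\<^sub>R e 1)" by simp
    then have "isCont (\<lambda>r. U (norm (r *\<^sub>R e 1))) 0"
      by (rule isCont_o2[rotated]) (intro continuous_intros)
    then have "((\<lambda>r. U (norm (r *\<^sub>R e 1))) \<longlongrightarrow> U 0) (at_right 0)"
      by (auto simp: isCont_def ne intro: tendsto_within_subset)
    then show ?thesis
      by (rule Lim_transform_eventually) (auto simp: ne eventually_at_right_field intro!: exI[of _ 1])
  qed
  ultimately show thesis using that[of U1] U1 by blast
qed

text \<open>The later analysis reads the potential only through this interface. \<open>Y1\<close>,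
  \<open>Y2\<close>, \<open>Y3\<close> are the derivatives of r^2 (U r - U 0), and eta enters the
  assumptions only through \<open>\<delta>\<close>. The conditions \<open>small\<close> keep, in
  this order, the interpolation remainder of W positive, the period increasing along
  \<open>P R\<close>, and the circular Kepler orbit with L = L0 below E0.\<close>

locale near_kepler = point_mass_vlasov_poisson M L0 \<kappa> \<mu> \<nu> \<eta> U E0
  for M L0 \<kappa> \<mu> \<nu> \<eta> U E0 +
  fixes Y1 Y2 Y3 :: "real \<Rightarrow> real" and \<delta> :: real
  assumes params: "0 < M" "0 < L0" "\<kappa> < 0" "2 < \<mu>" "1 < \<nu>"
    and E0_eq: "E0 = U 0 + \<kappa>"
    and U_bounds: "\<And>r. 0 < r \<Longrightarrow> 0 \<le> U r - U 0" "\<And>r. 0 < r \<Longrightarrow> U r - U 0 \<le> \<delta>"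
    and Y_deriv: "\<And>r. 0 < r \<Longrightarrow> ((\<lambda>r. r\<^sup>2 * (U r - U 0)) has_real_derivative Y1 r) (at r)"
      "\<And>r. 0 < r \<Longrightarrow> (Y1 has_real_derivative Y2 r) (at r)"
      "\<And>r. 0 < r \<Longrightarrow> (Y2 has_real_derivative Y3 r) (at r)"
    and Y3_cont: "continuous_on {0<..} Y3"
    and Y_bounds: "\<And>r. 0 < r \<Longrightarrow> \<bar>Y2 r\<bar> \<le> \<delta>" "\<And>r. 0 < r \<Longrightarrow> \<bar>Y3 r\<bar> \<le> \<delta>"
    and small: "8 * \<delta> \<le> - \<kappa>" "16 * \<delta> * M \<le> \<kappa>\<^sup>2" "\<delta> < \<kappa> + M\<^sup>2 / (2 * L0)"

text \<open>Multiplied by 2 r^2 the condition becomes 0 <= 2 kappa r^2 + 2 M r - L0. Dropping the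
  negative kappa term gives the lower bound, dropping L0 the upper one. As U >= U 0, the same
  interval confines the support for every eta.\<close>

lemma kepler_region:
  fixes r :: real
  assumes "0 < M" "0 < L0" "\<kappa> < 0" "0 < r" "0 \<le> \<kappa> + M / r - L0 / (2 * r\<^sup>2)"
  shows "L0 / (2 * M) < r" "r < M / (- \<kappa>)"
proof -
  have "0 \<le> (\<kappa> + M / r - L0 / (2 * r\<^sup>2)) * (2 * r\<^sup>2)" using assms by simp
  also have "\<dots> = 2 * \<kappa> * r\<^sup>2 + 2 * M * r - L0" using assms(4) by (simp add: field_simps power2_eq_square)
  finally have *: "0 \<le> 2 * \<kappa> * r\<^sup>2 + 2 * M * r - L0" .
  have "\<kappa> * r\<^sup>2 < 0" using assms by (simp add: mult_neg_pos)
  then have "L0 < 2 * M * r" using * by simp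
  then show "L0 / (2 * M) < r" using assms by (simp add: field_simps)
  have "0 < (\<kappa> * r + M) * (2 * r)" using * assms(2) by (simp add: power2_eq_square algebra_simps)
  then have "0 < \<kappa> * r + M" using assms(4) by (simp add: zero_less_mult_iff)
  then show "r < M / (- \<kappa>)" using assms by (simp add: field_simps)
qed

text \<open>The source carries a factor eta, and its support stays in the fixed interval (A, B).
  Integrating the radial Poisson equation twice from the origin therefore keeps the factor eta,
  while \<open>rho_eq\<close> gives the one derivative of the density that enters Y3.\<close>

theorem steady_state_near_kepler:
  fixes M L0 \<kappa> \<mu> \<nu> :: real
  assumes par: "0 < M" "0 < L0" "\<kappa> < 0" "2 < \<mu>" "1 < \<nu>"
  obtains C where "0 \<le> C"
    "\<And>\<eta> U E0. 0 < \<eta> \<Longrightarrow> \<eta> \<le> 1 \<Longrightarrow> point_mass_vlasov_poisson.steady_state M L0 \<kappa> \<mu> \<nu> \<eta> U E0 \<Longrightarrow>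
      8 * (C * \<eta>) \<le> - \<kappa> \<Longrightarrow> 16 * (C * \<eta>) * M \<le> \<kappa>\<^sup>2 \<Longrightarrow> C * \<eta> < \<kappa> + M\<^sup>2 / (2 * L0) \<Longrightarrow>
      \<exists>Y1 Y2 Y3. near_kepler M L0 \<kappa> \<mu> \<nu> U E0 Y1 Y2 Y3 (C * \<eta>)"
proof -
  define A B p K where "A = L0 / (2 * M)" and "B = M / (- \<kappa>)" and "p = \<mu> + \<nu> + 3/2"
    and "K = pi * 2 powr (\<nu> + 1) * reduced_density \<mu> \<nu>"
  have A: "0 < A" and B: "0 < B" and p: "4 < p" and K: "0 \<le> K"
    using par reduced_density_nonneg[of \<mu> \<nu>] by (auto simp: A_def B_def p_def K_def divide_pos_neg)
  \<comment> \<open>After division by eta, \<open>c1\<close> bounds the density, \<open>c3\<close>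
    the derivative of r^2 U', and \<open>c4\<close> the derivative of the density. The energy depth
    on the support is at most M / A.\<close>
  define c1 where "c1 = K * B powr (2 * \<nu>) * (M / A) powr p"
  define c3 where "c3 = 4 * pi * B\<^sup>2 * c1"
  define c4 where "c4 = K * (2 * \<nu> * B powr (2 * \<nu> - 1) * (M / A) powr p +
    B powr (2 * \<nu>) * (p * (M / A) powr (p - 1) * (c3 * B / A\<^sup>2 + M / A\<^sup>2 + L0 / A ^ 3)))"
  have c1: "0 \<le> c1" using K by (simp add: c1_def)
  have c3: "0 \<le> c3" using c1 by (simp add: c3_def)
  have c4: "0 \<le> c4" using K par p A B c3 unfolding c4_def
    by (intro mult_nonneg_nonneg add_nonneg_nonneg divide_nonneg_pos) auto
  \<comment> \<open>Again after division by eta, \<open>CN\<close> bounds U - U 0, and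
    \<open>C2\<close>, \<open>C3\<close> bound the second and third derivatives of Y.\<close>
  define CN where "CN = c3 * B / A"
  define C2 where "C2 = 2 * CN + 2 * c3 + c3"
  define C3 where "C3 = 16 * pi * B * c1 + 4 * pi * B\<^sup>2 * c4"
  define C where "C = CN + C2 + C3"
  have CN: "0 \<le> CN" using c3 A B by (simp add: CN_def)
  have C2: "0 \<le> C2" using CN c3 by (simp add: C2_def)
  have C3: "0 \<le> C3" using c1 c4 B by (simp add: C3_def)
  have C: "0 \<le> C" "CN \<le> C" "C2 \<le> C" "C3 \<le> C" using CN C2 C3 by (auto simp: C_def)
  show thesis
  proof (rule that[OF C(1)])
    fix \<eta> :: real and U :: "real \<Rightarrow> real" and E0 :: real
    assume eta: "0 < \<eta>" "\<eta> \<le> 1"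
      and ss: "point_mass_vlasov_poisson.steady_state M L0 \<kappa> \<mu> \<nu> \<eta> U E0"
      and sm: "8 * (C * \<eta>) \<le> - \<kappa>" "16 * (C * \<eta>) * M \<le> \<kappa>\<^sup>2" "C * \<eta> < \<kappa> + M\<^sup>2 / (2 * L0)"
    interpret point_mass_vlasov_poisson M L0 \<kappa> \<mu> \<nu> \<eta> U E0 .
    have E0: "E0 = U 0 + \<kappa>" using ss by (simp add: steady_state_def)
    obtain U1 where U1: "\<And>r. 0 < r \<Longrightarrow> (U has_real_derivative U1 r) (at r)"
      "\<And>r. 0 < r \<Longrightarrow> ((\<lambda>r. r\<^sup>2 * U1 r) has_real_derivative 4 * pi * r\<^sup>2 * rho r) (at r)"
      "((\<lambda>r. r\<^sup>2 * U1 r) \<longlongrightarrow> 0) (at_right 0)" "(U \<longlongrightarrow> U 0) (at_right 0)"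
      using ss radial_poisson[of U rho] unfolding steady_state_def by blast
    \<comment> \<open>\<open>n r\<close> is the mass of the density inside radius r, so that U' = n
      / r^2.\<close>
    define n where "n r = r\<^sup>2 * U1 r" for r
    define e where "e r = E0 - Psi L0 r" for r
    have dn: "(n has_real_derivative 4 * pi * r\<^sup>2 * rho r) (at r)" if "0 < r" for r
      using U1(2)[OF that] by (simp add: n_def[abs_def])
    have n0: "(n \<longlongrightarrow> 0) (at_right 0)" using U1(3) by (simp add: n_def[abs_def])
    have dU: "(U has_real_derivative n r / r\<^sup>2) (at r)" if "0 < r" for r
      using U1(1)[OF that] that by (simp add: n_def)
    have nc: "isCont n r" and Uc: "isCont U r" if "0 < r" for r
      using dn[OF that] dU[OF that] DERIV_isCont by blast+
    have rho: "rho r = \<eta> * K * r powr (2 * \<nu>) * max 0 (e r) powr p" if "0 < r" for r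
      using rho_eq[OF that] par by (simp add: K_def p_def e_def)
    have rho_nn: "0 \<le> rho r" if "0 < r" for r using K eta by (simp add: rho[OF that])
    have n_nn: "0 \<le> n r" if "0 < r" for r
      by (rule nonneg_deriv_limit[OF dn _ n0 that]) (simp_all add: rho_nn)
    have N_nn: "0 \<le> U r - U 0" if "0 < r" for r
      using nonneg_deriv_limit[OF dU _ U1(4) that] n_nn by simp
    have e_eq: "e r = \<kappa> - (U r - U 0) + M / r - L0 / (2 * r\<^sup>2)" for r
      by (simp add: e_def E0 Psi_def)
    \<comment> \<open>The self-consistent field only raises the potential relative to its central
      value, so the support lies inside the region allowed by pure Kepler motion.\<close>
    have e_le: "e r \<le> \<kappa> + M / r - L0 / (2 * r\<^sup>2)" if "0 < r" for r
      using N_nn[OF that] by (simp add: e_eq)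
    have supp: "A < r" "r < B" "e r \<le> M / A" if "0 < r" "0 < e r" for r
    proof -
      have "0 \<le> \<kappa> + M / r - L0 / (2 * r\<^sup>2)" using e_le[OF that(1)] that(2) by simp
      from kepler_region[OF par(1,2,3) that(1) this]
      show AB: "A < r" "r < B" by (auto simp: A_def B_def)
      have "M / r \<le> M / A" using AB A par by (intro divide_left_mono) auto
      moreover have "0 \<le> L0 / (2 * r\<^sup>2)" using par by simp
      ultimately show "e r \<le> M / A" using e_le[OF that(1)] par by linarith
    qed
    have rho0: "rho r = 0" if "0 < r" "\<not> (A < r \<and> r < B)" for r
    proof -
      have "\<not> 0 < e r" using supp(1,2)[OF that(1)] that(2) by blast
      then have "max 0 (e r) = 0" by simp
      then show ?thesis using p by (simp add: rho[OF that(1)])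
    qed
    have powle: "r powr s \<le> B powr s" if "0 < r" "r < B" "0 \<le> s" for r s
      using that by (intro powr_mono2) auto
    have rho_le: "rho r \<le> \<eta> * c1" if "0 < r" for r
    proof (cases "0 < e r")
      case True
      have "r powr (2 * \<nu>) * max 0 (e r) powr p \<le> B powr (2 * \<nu>) * (M / A) powr p"
        using supp[OF that True] that True p par
        by (intro mult_mono powle powr_mono2) auto
      from mult_left_mono[OF this, of "\<eta> * K"] show ?thesis
        using K eta by (simp add: rho[OF that] c1_def mult_ac)
    next
      case False
      then have "max 0 (e r) = 0" by simp
      then show ?thesis using c1 eta p by (simp add: rho[OF that])
    qed
    have dn_le: "4 * pi * r\<^sup>2 * rho r \<le> \<eta> * c3" if "0 < r" for r
    proof (cases "A < r \<and> r < B")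
      case True
      have "r\<^sup>2 * rho r \<le> B\<^sup>2 * (\<eta> * c1)"
        using True that rho_le[OF that] rho_nn[OF that] by (intro mult_mono power_mono) auto
      then show ?thesis by (simp add: c3_def algebra_simps)
    qed (use rho0[OF that] c3 eta in auto)
    have n_le1: "n r \<le> \<eta> * c3 * r" if "0 < r" for r
    proof -
      have "0 \<le> \<eta> * c3 * r - n r"
      proof (rule nonneg_deriv_limit[OF _ _ _ that])
        show "((\<lambda>r. \<eta> * c3 * r - n r) has_real_derivative \<eta> * c3 - 4 * pi * r\<^sup>2 * rho r) (at r)" if "0 < r" for r
          by (auto intro!: derivative_eq_intros dn that)
        show "((\<lambda>r. \<eta> * c3 * r - n r) \<longlongrightarrow> 0) (at_right 0)"
          by (auto intro!: tendsto_eq_intros n0)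
      qed (use dn_le in simp)
      then show ?thesis by simp
    qed
    have n_le2: "n r \<le> \<eta> * c3 * B" if "0 < r" for r
    proof (cases "r \<le> B")
      case True
      then show ?thesis using n_le1[OF that] c3 eta by (meson mult_left_mono mult_nonneg_nonneg less_imp_le order_trans)
    next
      case False
      then have "n r = n B"
      proof (intro DERIV_isconst_end[of B r n])
        show "continuous_on {B..r} n"
          using B by (intro continuous_at_imp_continuous_on) (auto intro!: nc)
        show "DERIV n x :> 0" if "B < x" "x < r" for x
          using dn[of x] rho0[of x] that B by simp
      qed auto
      then show ?thesis using n_le1[OF B] by simp
    qed
    \<comment> \<open>There is no mass inside radius A, hence U is constant there, and n / s^2 only
      has to be integrated from A outwards.\<close>
    have n_zero: "n r = 0" if "0 < r" "r \<le> A" for r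
    proof -
      have "0 \<le> - n r"
      \<comment> \<open>Freezing n at its value beyond A produces a function with zero derivative on
        all of r > 0, to which the comparison lemma applies.\<close>
      proof (rule nonneg_deriv_limit[where f = "\<lambda>x. - n (min x A)" and r = r and f' = "\<lambda>_. 0", THEN order_trans])
        show "- n (min r A) \<le> - n r" using that by simp
        show "((\<lambda>x. - n (min x A)) \<longlongrightarrow> 0) (at_right 0)"
        proof (rule Lim_transform_eventually)
          show "((\<lambda>x. - n x) \<longlongrightarrow> 0) (at_right 0)" using tendsto_minus[OF n0] by simp
          show "\<forall>\<^sub>F x in at_right 0. - n x = - n (min x A)"
            using A by (auto simp: eventually_at_right_field intro!: exI[of _ A])
        qed
        fix x :: real assume x: "0 < x"
        have cst: "n y = n A" if "0 < y" "y \<le> A" for y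
        proof (cases "y = A")
          case False
          then show ?thesis
          proof (intro DERIV_isconst_end[symmetric, of y A n])
            show "continuous_on {y..A} n"
              using that by (intro continuous_at_imp_continuous_on) (auto intro!: nc)
            show "DERIV n z :> 0" if "y < z" "z < A" for z
              using dn[of z] rho0[of z] that \<open>0 < y\<close> by simp
          qed (use that in auto)
        qed simp
        have mincst: "- n A = - n (min y A)" if "y \<in> {0<..}" for y
          using cst[of "min y A"] that A by (cases "y \<le> A") (simp_all only: min_absorb1 min_absorb2 greaterThan_iff min_less_iff_conj)
        have "((\<lambda>x. - n A) has_real_derivative 0) (at x)" by simp
        then show "((\<lambda>x. - n (min x A)) has_real_derivative 0) (at x)"
          by (rule has_field_derivative_transform_within_open[OF _ open_greaterThan[of 0] _ mincst]) (use x in auto)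
      qed (use that in auto)
      then show ?thesis using n_nn[OF that(1)] by simp
    qed
    have N_le: "U r - U 0 \<le> \<eta> * CN" if "0 < r" for r
    proof -
      have U_le_A: "U x = U 0" if "0 < x" "x \<le> A" for x
      proof -
        have "U y = U x" if "0 < y" "y < x" for y
          using that \<open>x \<le> A\<close>
        proof (intro DERIV_isconst_end[symmetric, of y x U])
          show "continuous_on {y..x} U"
            using that by (intro continuous_at_imp_continuous_on) (auto intro!: Uc)
          show "DERIV U z :> 0" if "y < z" "z < x" for z
            using dU[of z] n_zero[of z] that \<open>0 < y\<close> \<open>x \<le> A\<close> by simp
        qed auto
        then have "\<forall>\<^sub>F y in at_right 0. U y = U x"
          using \<open>0 < x\<close> by (auto simp: eventually_at_right_field)
        then have "(U \<longlongrightarrow> U x) (at_right 0)" by (rule tendsto_eventually)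
        then show ?thesis using U1(4) tendsto_unique trivial_limit_at_right_real by blast
      qed
      show ?thesis
      proof (cases "r \<le> A")
        case True
        then show ?thesis using U_le_A[OF that] CN eta by simp
      next
        case False
        \<comment> \<open>The derivative of - eta c3 B / x is eta c3 B / x^2 and dominates U' = n /
          x^2. So h increases from A, where U still has its central value.\<close>
        define h where "h x = - \<eta> * c3 * B / x - U x" for x
        have "h A \<le> h r"
        proof (rule DERIV_nonneg_imp_nondecreasing[where f = h])
          fix x assume x: "A \<le> x" "x \<le> r"
          have "(h has_real_derivative \<eta> * c3 * B / x\<^sup>2 - n x / x\<^sup>2) (at x)"
            unfolding h_def using x A dU[of x]
            by (auto intro!: derivative_eq_intros simp: power2_eq_square)
          moreover have "0 \<le> \<eta> * c3 * B / x\<^sup>2 - n x / x\<^sup>2"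
            using n_le2[of x] x A by (simp add: divide_right_mono)
          ultimately show "\<exists>y. DERIV h x :> y \<and> 0 \<le> y" by blast
        qed (use False in simp)
        moreover have "0 \<le> \<eta> * c3 * B / r" using eta c3 B that by simp
        ultimately show ?thesis using U_le_A[of A] A by (simp add: h_def CN_def)
      qed
    qed
    define Y1 where "Y1 r = 2 * r * (U r - U 0) + n r" for r
    define Y2 where "Y2 r = 2 * (U r - U 0) + 2 * (n r / r) + 4 * pi * r\<^sup>2 * rho r" for r
    define e' where "e' r = - (n r / r\<^sup>2) - M / r\<^sup>2 + L0 / r ^ 3" for r
    define rho' where "rho' r = \<eta> * K * (2 * \<nu> * r powr (2 * \<nu> - 1) * max 0 (e r) powr p
      + r powr (2 * \<nu>) * (p * max 0 (e r) powr (p - 1) * e' r))" for r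
    define Y3 where "Y3 r = 16 * pi * r * rho r + 4 * pi * r\<^sup>2 * rho' r" for r
    have de: "(e has_real_derivative e' r) (at r)" if "0 < r" for r
      unfolding e_eq[abs_def] e'_def using that dU[OF that]
      by (auto intro!: derivative_eq_intros simp: field_simps power2_eq_square power3_eq_cube)
    have drho: "(rho has_real_derivative rho' r) (at r)" if "0 < r" for r
    proof -
      have "((\<lambda>r. max 0 (e r) powr p) has_real_derivative p * max 0 (e r) powr (p - 1) * e' r) (at r)"
        using DERIV_chain2[OF DERIV_max_powr[of p "e r"] de[OF that]] p by simp
      note a = this
      have b: "((\<lambda>r. r powr (2 * \<nu>)) has_real_derivative 2 * \<nu> * r powr (2 * \<nu> - 1)) (at r)"
        by (rule has_real_derivative_powr[OF that])
      have "((\<lambda>r. \<eta> * K * (r powr (2 * \<nu>) * max 0 (e r) powr p)) has_real_derivative rho' r) (at r)"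
        by (rule DERIV_cong[OF DERIV_cmult[OF DERIV_mult[OF b a]]]) (simp add: rho'_def mult.commute)
      then show ?thesis
        by (rule has_field_derivative_transform_within_open[of _ _ _ "{0<..}"]) (use that rho in auto)
    qed
    have rho'_zero: "rho' r = 0" if "0 < r" "\<not> 0 < e r" for r
    proof -
      have "max 0 (e r) = 0" using that by simp
      then show ?thesis using p by (simp add: rho'_def)
    qed
    have rho'_le: "\<bar>rho' r\<bar> \<le> \<eta> * c4" if "0 < r" for r
    proof (cases "0 < e r")
      case True
      note s = supp[OF that True]
      have "\<bar>e' r\<bar> \<le> n r / r\<^sup>2 + M / r\<^sup>2 + L0 / r ^ 3"
        unfolding e'_def using n_nn[OF that] par that
        by (intro order_trans[OF abs_triangle_ineq] add_mono order_trans[OF abs_triangle_ineq4]) auto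
      also have "\<dots> \<le> c3 * B / A\<^sup>2 + M / A\<^sup>2 + L0 / A ^ 3"
      proof (intro add_mono frac_le power_mono)
        have "\<eta> * (c3 * B) \<le> 1 * (c3 * B)" using eta c3 B by (intro mult_right_mono) auto
        then show "n r \<le> c3 * B" using n_le2[OF that] by simp
      qed (use c3 B A s par in auto)
      finally have e': "\<bar>e' r\<bar> \<le> c3 * B / A\<^sup>2 + M / A\<^sup>2 + L0 / A ^ 3" .
      have "\<bar>rho' r\<bar> = \<eta> * K * \<bar>2 * \<nu> * r powr (2 * \<nu> - 1) * max 0 (e r) powr p
          + r powr (2 * \<nu>) * (p * max 0 (e r) powr (p - 1) * e' r)\<bar>"
        using eta K by (simp add: rho'_def abs_mult)
      also have "\<dots> \<le> \<eta> * K * (2 * \<nu> * B powr (2 * \<nu> - 1) * (M / A) powr p +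
          B powr (2 * \<nu>) * (p * (M / A) powr (p - 1) * (c3 * B / A\<^sup>2 + M / A\<^sup>2 + L0 / A ^ 3)))"
      proof (intro mult_left_mono order_trans[OF abs_triangle_ineq] add_mono)
        show "\<bar>2 * \<nu> * r powr (2 * \<nu> - 1) * max 0 (e r) powr p\<bar> \<le> 2 * \<nu> * B powr (2 * \<nu> - 1) * (M / A) powr p"
          unfolding abs_mult using s that par True p
          by (intro mult_mono) (auto intro!: powle powr_mono2)
        show "\<bar>r powr (2 * \<nu>) * (p * max 0 (e r) powr (p - 1) * e' r)\<bar> \<le> B powr (2 * \<nu>) * (p * (M / A) powr (p - 1) * (c3 * B / A\<^sup>2 + M / A\<^sup>2 + L0 / A ^ 3))"
          unfolding abs_mult using s that par True p e'
          by (intro mult_mono) (auto intro!: powle powr_mono2)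
      qed (use eta K in auto)
      finally show ?thesis by (simp add: c4_def mult.assoc)
    qed (use rho'_zero[OF that] c4 eta in simp)
    have "near_kepler M L0 \<kappa> \<mu> \<nu> U E0 Y1 Y2 Y3 (C * \<eta>)"
    proof unfold_locales
      show "0 < M" "0 < L0" "\<kappa> < 0" "2 < \<mu>" "1 < \<nu>" by fact+
      show "E0 = U 0 + \<kappa>" by fact
      show "0 \<le> U r - U 0" if "0 < r" for r using N_nn[OF that] .
      show "U r - U 0 \<le> C * \<eta>" if "0 < r" for r
        using N_le[OF that] C eta by (metis mult.commute mult_right_mono less_imp_le order_trans)
      show "((\<lambda>r. r\<^sup>2 * (U r - U 0)) has_real_derivative Y1 r) (at r)" if "0 < r" for r
        unfolding Y1_def using that dU[OF that]
        by (auto intro!: derivative_eq_intros simp: power2_eq_square)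
      show "(Y1 has_real_derivative Y2 r) (at r)" if "0 < r" for r
        unfolding Y1_def Y2_def using that dU[OF that] dn[OF that]
        by (auto intro!: derivative_eq_intros simp: power2_eq_square)
      show "(Y2 has_real_derivative Y3 r) (at r)" if "0 < r" for r
        unfolding Y2_def Y3_def using that dU[OF that] dn[OF that] drho[OF that]
        by (auto intro!: derivative_eq_intros simp: power2_eq_square field_simps)
      show "continuous_on {0<..} Y3"
      proof -
        have c: "continuous_on {0<..} U" "continuous_on {0<..} n" "continuous_on {0<..} rho" "continuous_on {0<..} e"
          using nc Uc DERIV_isCont[OF drho] DERIV_isCont[OF de] by (auto intro!: continuous_at_imp_continuous_on)
        have mp: "continuous_on {0<..} (\<lambda>r. max 0 (e r) powr p)" "continuous_on {0<..} (\<lambda>r. max 0 (e r) powr (p - 1))"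
          using p by (auto intro!: continuous_on_max_powr[OF c(4)])
        have pw: "continuous_on {0<..} (\<lambda>r :: real. r powr s)" for s
          by (intro continuous_on_powr continuous_on_id continuous_on_const) auto
        have e'c: "continuous_on {0<..} e'"
          unfolding e'_def by (intro continuous_intros c) auto
        have "continuous_on {0<..} rho'"
          unfolding rho'_def
          by (intro continuous_on_mult continuous_on_add continuous_on_const mp pw e'c)
        then show ?thesis unfolding Y3_def using c by (intro continuous_intros)
      qed
      show "\<bar>Y2 r\<bar> \<le> C * \<eta>" if "0 < r" for r
      proof -
        have "n r / r \<le> \<eta> * c3" using n_le1[OF that] that by (simp add: field_simps)
        moreover have "0 \<le> n r / r" "0 \<le> 4 * pi * r\<^sup>2 * rho r" using n_nn[OF that] rho_nn[OF that] that by auto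
        moreover have "\<eta> * C2 = 2 * (\<eta> * CN) + 2 * (\<eta> * c3) + \<eta> * c3" by (simp add: C2_def algebra_simps)
        moreover have "\<bar>2 * a + 2 * b + c\<bar> \<le> 2 * x + 2 * y + y"
          if "0 \<le> a" "a \<le> x" "0 \<le> b" "b \<le> y" "0 \<le> c" "c \<le> y" for a b c x y :: real
          using that by linarith
        ultimately have "\<bar>Y2 r\<bar> \<le> \<eta> * C2"
          using N_nn[OF that] N_le[OF that] dn_le[OF that] unfolding Y2_def by metis
        then show ?thesis using C eta by (metis mult.commute mult_right_mono less_imp_le order_trans)
      qed
      show "\<bar>Y3 r\<bar> \<le> C * \<eta>" if "0 < r" for r
      proof (cases "0 < e r")
        case True
        note s = supp[OF that True]
        have "\<bar>Y3 r\<bar> \<le> 16 * pi * r * rho r + 4 * pi * r\<^sup>2 * \<bar>rho' r\<bar>"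
          unfolding Y3_def using rho_nn[OF that] that
          by (intro order_trans[OF abs_triangle_ineq]) (simp add: abs_mult)
        also have "\<dots> \<le> 16 * pi * B * (\<eta> * c1) + 4 * pi * B\<^sup>2 * (\<eta> * c4)"
          using s that rho_le[OF that] rho_nn[OF that] rho'_le[OF that] B
          by (intro add_mono mult_mono power_mono) auto
        also have "\<dots> = \<eta> * C3" by (simp add: C3_def algebra_simps)
        finally show ?thesis using C eta by (metis mult.commute mult_right_mono less_imp_le order_trans)
      next
        case False
        then have "max 0 (e r) = 0" by simp
        then have "rho r = 0" using p by (simp add: rho[OF that])
        then show ?thesis using rho'_zero[OF that False] C eta by (simp add: Y3_def)
      qed
    qed (use sm in auto)
    then show "\<exists>Y1 Y2 Y3. near_kepler M L0 \<kappa> \<mu> \<nu> U E0 Y1 Y2 Y3 (C * \<eta>)" by blast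
  qed
qed

subsection \<open>Turning points\<close>

context near_kepler
begin

definition Y :: "real \<Rightarrow> real" where "Y r = r\<^sup>2 * (U r - U 0)"

text \<open>This is the squared radial momentum multiplied by r^2, for r > 0. The multiplication
  removes the singular terms: what remains is a quadratic polynomial in r minus the small smooth
  perturbation 2 Y.\<close>

definition W :: "real \<Rightarrow> real \<Rightarrow> real \<Rightarrow> real" where
  "W E L r = 2 * (E - U 0) * r\<^sup>2 + 2 * M * r - L - 2 * Y r"

definition I :: "real \<Rightarrow> real \<Rightarrow> real" where
  "I a r = integral {0..1} (\<lambda>t. t * Y2 (a + t * (r - a)))"

lemma delta_nonneg: "0 \<le> \<delta>"
  using U_bounds[of 1] by simp

lemma segment_pos: "0 < a \<Longrightarrow> 0 < r \<Longrightarrow> t \<in> {0..1} \<Longrightarrow> 0 < a + t * (r - a)" for a r t :: real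
proof -
  assume *: "0 < a" "0 < r" "t \<in> {0..1}"
  have "a + t * (r - a) = (1 - t) * a + t * r" by (simp add: algebra_simps)
  moreover have "0 < (1 - t) * a + t * r"
    using * by (cases "t = 0") (auto intro: add_nonneg_pos)
  ultimately show ?thesis by simp
qed

lemma Y_DERIV: "0 < r \<Longrightarrow> (Y has_real_derivative Y1 r) (at r)"
  using Y_deriv(1) unfolding Y_def[abs_def] .

lemma Y_nonneg: "0 < r \<Longrightarrow> 0 \<le> Y r"
  using U_bounds by (simp add: Y_def)

lemma continuous_Y2: "continuous_on {0<..} Y2"
  using Y_deriv(3) DERIV_isCont by (auto intro!: continuous_at_imp_continuous_on)

lemma continuous_Y1: "continuous_on {0<..} Y1"
  using Y_deriv(2) DERIV_isCont by (auto intro!: continuous_at_imp_continuous_on)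

lemma continuous_on_segment:
  fixes f :: "real \<Rightarrow> real"
  assumes "0 < a" "0 < r" "continuous_on {0<..} f"
  shows "continuous_on {0..1} (\<lambda>t. f (a + t * (r - a)))"
  using assms segment_pos[OF assms(1,2)]
  by (intro continuous_on_compose2[OF assms(3)]) (auto intro!: continuous_intros)

text \<open>\<open>I a r\<close> is the divided difference of \<open>Y\<close> at \<open>a, r, r\<close>.\<close>

lemma I_eq:
  assumes a: "0 < a" and r: "0 < r"
  shows "I a r * (r - a)\<^sup>2 = (r - a) * Y1 r - (Y r - Y a)"
proof -
  let ?s = "\<lambda>t. a + t * (r - a)"
  have "((\<lambda>t. (t * Y2 (?s t)) * (r - a)\<^sup>2) has_integral
      (1 * (r - a) * Y1 (?s 1) - Y (?s 1)) - (0 * (r - a) * Y1 (?s 0) - Y (?s 0))) {0..1}"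
  proof (rule fundamental_theorem_of_calculus)
    fix t :: real assume t: "t \<in> {0..1}"
    note p = segment_pos[OF a r t]
    have s: "(?s has_real_derivative (r - a)) (at t within {0..1})"
      by (auto intro!: derivative_eq_intros)
    have 1: "((\<lambda>t. Y1 (?s t)) has_real_derivative Y2 (?s t) * (r - a)) (at t within {0..1})"
      by (rule DERIV_chain2[OF Y_deriv(2)[OF p] s])
    have 0: "((\<lambda>t. Y (?s t)) has_real_derivative Y1 (?s t) * (r - a)) (at t within {0..1})"
      by (rule DERIV_chain2[OF Y_DERIV[OF p] s])
    have "((\<lambda>t. t * (r - a) * Y1 (?s t) - Y (?s t)) has_real_derivative
        ((r - a) * Y1 (?s t) + Y2 (?s t) * (r - a) * (t * (r - a))) - Y1 (?s t) * (r - a)) (at t within {0..1})"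
      by (intro DERIV_diff DERIV_mult 1 0) (auto intro!: derivative_eq_intros)
    then show "((\<lambda>t. t * (r - a) * Y1 (?s t) - Y (?s t)) has_vector_derivative (t * Y2 (?s t)) * (r - a)\<^sup>2)
        (at t within {0..1})"
      by (simp add: has_real_derivative_iff_has_vector_derivative power2_eq_square algebra_simps)
  qed simp
  note 1 = this
  have "((\<lambda>t. (t * Y2 (?s t)) * (r - a)\<^sup>2) has_integral I a r * (r - a)\<^sup>2) {0..1}"
    unfolding I_def
    by (intro has_integral_mult_left integrable_integral integrable_continuous_real continuous_intros
        continuous_on_segment[OF a r continuous_Y2])
  from has_integral_unique[OF this 1] show ?thesis by simp
qed

lemma integral_weight_bound:
  fixes f g :: "real \<Rightarrow> real"
  assumes "continuous_on {0..1} g" "continuous_on {0..1} f" "\<And>t. t \<in> {0..1} \<Longrightarrow> \<bar>g t\<bar> \<le> 1" "\<And>t. t \<in> {0..1} \<Longrightarrow> \<bar>f t\<bar> \<le> B"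
  shows "\<bar>integral {0..1} (\<lambda>t. g t * f t)\<bar> \<le> B"
proof -
  have "norm (integral {0..1} (\<lambda>t. g t * f t)) \<le> B * (1 - 0)"
  proof (rule integral_bound)
    show "norm (g t * f t) \<le> B" if "t \<in> {0..1}" for t
      using mult_mono[OF assms(3,4)[OF that]] by (simp add: abs_mult)
  qed (use assms in \<open>auto intro!: continuous_intros\<close>)
  then show ?thesis by simp
qed

lemma I_bound: "0 < a \<Longrightarrow> 0 < r \<Longrightarrow> \<bar>I a r\<bar> \<le> \<delta>"
  unfolding I_def
  by (rule integral_weight_bound) (auto intro!: continuous_intros continuous_on_segment continuous_Y2 Y_bounds segment_pos)

lemma W_eq: "0 < r \<Longrightarrow> W E L r = 2 * r\<^sup>2 * (E - Psi L r)"
  by (simp add: W_def Y_def Psi_def field_simps power2_eq_square)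

lemma W_pos_iff: "0 < r \<Longrightarrow> 0 < W E L r \<longleftrightarrow> Psi L r < E"
  and W_zero_iff: "0 < r \<Longrightarrow> W E L r = 0 \<longleftrightarrow> Psi L r = E"
  and W_neg_iff: "0 < r \<Longrightarrow> W E L r < 0 \<longleftrightarrow> E < Psi L r"
  by (auto simp: W_eq zero_less_mult_iff mult_less_0_iff)

text \<open>Linear interpolation between a and b with an exact remainder. The quadratic term of W
  contributes - 2 (E - U 0) (b - a). For Y both expansions are made at r, weighted so that the terms
  with Y1 r cancel and only the divided differences are left.\<close>

lemma W_interpolation:
  assumes "0 < a" "0 < b" "0 < r"
  shows "W E L r * (b - a) = (b - r) * W E L a + (r - a) * W E L b
    + (r - a) * (b - r) * (- 2 * (E - U 0) * (b - a) + 2 * ((r - a) * I a r + (b - r) * I b r))"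
proof -
  define i j where "i = I a r" and "j = I b r"
  have "i * (r - a)\<^sup>2 = (r - a) * Y1 r - (Y r - Y a)" "j * (r - b)\<^sup>2 = (r - b) * Y1 r - (Y r - Y b)"
    unfolding i_def j_def using I_eq assms by auto
  then have "(b - r) * (i * (r - a)\<^sup>2) + (r - a) * (j * (r - b)\<^sup>2)
      = (b - r) * ((r - a) * Y1 r - (Y r - Y a)) + (r - a) * ((r - b) * Y1 r - (Y r - Y b))"
    by (simp only:)
  then show ?thesis
    unfolding i_def[symmetric] j_def[symmetric] W_def by algebra
qed

text \<open>The Kepler part is at least - kappa per unit length, and the perturbation takes away at
  most 2 delta, a quarter of that; at least half survives. The range up to U 0 + kappa / 2 leaves
  room above E0 = U 0 + kappa.\<close>

lemma interp_weight_pos: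
  assumes "0 < a" "a < b" "a \<le> r" "r \<le> b" "E \<le> U 0 + \<kappa> / 2"
  shows "- \<kappa> / 2 * (b - a) \<le> - 2 * (E - U 0) * (b - a) + 2 * ((r - a) * I a r + (b - r) * I b r)"
proof -
  have "0 \<le> (r - a) * (\<delta> + I a r)" "0 \<le> (b - r) * (\<delta> + I b r)"
    using I_bound[of a r] I_bound[of b r] assms by (auto intro!: mult_nonneg_nonneg)
  then have "- ((r - a) * I a r + (b - r) * I b r) \<le> \<delta> * (b - a)" by (simp add: algebra_simps)
  moreover have "- \<kappa> * (b - a) \<le> - 2 * (E - U 0) * (b - a)"
    using assms by (intro mult_right_mono) auto
  moreover have "8 * \<delta> * (b - a) \<le> - \<kappa> * (b - a)"
    using assms small(1) by (intro mult_right_mono) auto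
  moreover have "0 \<le> - \<kappa> * (b - a)" using params assms by (intro mult_nonneg_nonneg) auto
  moreover have "k / 2 \<le> y + 2 * x" if "- x \<le> d" "k \<le> y" "8 * d \<le> k" "0 \<le> k" for x y k d :: real
    using that by linarith
  moreover have "- \<kappa> / 2 * (b - a) = - \<kappa> * (b - a) / 2" "8 * \<delta> * (b - a) = 8 * (\<delta> * (b - a))" by simp_all
  ultimately show ?thesis by metis
qed

lemma W_concave:
  assumes "0 < a" "a < r" "r < b" "E \<le> U 0 + \<kappa> / 2"
  shows "(b - r) * W E L a + (r - a) * W E L b < W E L r * (b - a)"
proof -
  have "0 < - \<kappa> / 2 * (b - a)" using params assms by (intro mult_pos_pos) auto
  then have "0 < (r - a) * (b - r) * (- 2 * (E - U 0) * (b - a) + 2 * ((r - a) * I a r + (b - r) * I b r))"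
    using interp_weight_pos[of a b r E] assms by (intro mult_pos_pos) auto
  then show ?thesis using W_interpolation[of a b r E L] assms by simp
qed

text \<open>An open set that contains the noncircular admissible orbits: the bounds on E and L are
  strict and lie beyond E0 and L0. Thus derivatives at orbits with E = E0 or L = L0 are genuine
  two-sided derivatives, as \<open>deriv\<close> requires.\<close>

definition dom :: "(real \<times> real) set" where
  "dom = {(E, L). 0 < L \<and> E < U 0 + \<kappa> / 2 \<and> (\<exists>r>0. Psi L r < E)}"

lemma continuous_W: "continuous_on {0<..} (W E L)"
  unfolding W_def using Y_DERIV DERIV_isCont
  by (auto intro!: continuous_intros continuous_at_imp_continuous_on[of _ Y])

lemma W_le: "0 < r \<Longrightarrow> W E L r \<le> 2 * (E - U 0) * r\<^sup>2 + 2 * M * r - L"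
  using Y_nonneg[of r] by (simp add: W_def)

lemma dom_roots:
  assumes "(E, L) \<in> dom"
  obtains r1 r2 where "0 < r1" "r1 < r2" "Psi L r1 = E" "Psi L r2 = E"
    "\<And>r. 0 < r \<Longrightarrow> Psi L r < E \<longleftrightarrow> r1 < r \<and> r < r2"
    "\<And>r. 0 < r \<Longrightarrow> Psi L r = E \<longleftrightarrow> r = r1 \<or> r = r2"
proof -
  from assms obtain m where L: "0 < L" and E: "E < U 0 + \<kappa> / 2" and m: "0 < m" "0 < W E L m"
    by (auto simp: dom_def W_pos_iff)
  \<comment> \<open>\<open>a\<close> is so small that 2 M a < L, and \<open>b\<close> so large that
    the term kappa b^2 outweighs 2 M b. Both make W negative, with the positive value at m between
    them.\<close>
  define a b where "a = min (m / 2) (L / (4 * M))" and "b = max (2 * m) (- 2 * M / \<kappa>)"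
  have a: "0 < a" "a < m" "2 * M * a < L" and b: "m < b" "0 \<le> - \<kappa> * b - 2 * M"
    using m L params by (auto simp: a_def b_def min_def max_def field_simps)
  have "(E - U 0) * a\<^sup>2 \<le> 0" using E params a by (intro mult_nonpos_nonneg) auto
  then have Wa: "W E L a < 0" using W_le[of a E L] a by linarith
  have "2 * (E - U 0) * b\<^sup>2 \<le> \<kappa> * b\<^sup>2" using E by (intro mult_right_mono) auto
  moreover have "0 \<le> (- \<kappa> * b - 2 * M) * b" using b m by (intro mult_nonneg_nonneg) auto
  ultimately have Wb: "W E L b < 0"
    using W_le[of b E L] b m L by (simp add: power2_eq_square algebra_simps)
  have cont: "continuous_on {x..y} (W E L)" if "0 < x" for x y
    using that by (intro continuous_on_subset[OF continuous_W]) auto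
  obtain r1 where r1: "a \<le> r1" "r1 \<le> m" "W E L r1 = 0"
    using IVT'[of "W E L" a 0 m] Wa m a cont by auto
  obtain r2 where r2: "m \<le> r2" "r2 \<le> b" "W E L r2 = 0"
    using IVT2'[of "W E L" b 0 m] Wb m b cont by auto
  have r: "0 < r1" "r1 < m" "m < r2" using r1 r2 a m by (auto simp: order_less_le)
  \<comment> \<open>Concavity fixes the sign of W everywhere once two zeros are known, so there is
    no third one.\<close>
  have pos: "0 < W E L x" if "r1 < x" "x < r2" for x
    using W_concave[of r1 x r2 E L] that r r1 r2 E by (simp add: zero_less_mult_iff)
  have neg1: "W E L x < 0" if "0 < x" "x < r1" for x
    using W_concave[of x r1 r2 E L] that r r1 r2 E by (simp add: mult_less_0_iff)
  have neg2: "W E L x < 0" if "r2 < x" for x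
    using W_concave[of r1 r2 x E L] that r r1 r2 E by (simp add: mult_less_0_iff)
  show thesis
  proof (rule that[of r1 r2])
    show "Psi L x < E \<longleftrightarrow> r1 < x \<and> x < r2" if "0 < x" for x
      using pos[of x] neg1[of x] neg2[of x] r1(3) r2(3) that unfolding W_pos_iff[OF that, symmetric]
      by (metis less_asym less_irrefl linorder_less_linear)
    show "Psi L x = E \<longleftrightarrow> x = r1 \<or> x = r2" if "0 < x" for x
      using pos[of x] neg1[of x] neg2[of x] r1(3) r2(3) that unfolding W_zero_iff[OF that, symmetric]
      by (metis less_irrefl linorder_less_linear)
    show "Psi L r1 = E" "Psi L r2 = E" using r1 r2 r W_zero_iff by auto
  qed (use r in auto)
qed

lemma turning_points:
  assumes "(E, L) \<in> dom"
  shows "0 < r_minus E L" "r_minus E L < r_plus E L"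
    "Psi L (r_minus E L) = E" "Psi L (r_plus E L) = E"
    "\<And>r. 0 < r \<Longrightarrow> Psi L r < E \<longleftrightarrow> r_minus E L < r \<and> r < r_plus E L"
    "\<And>r. 0 < r \<Longrightarrow> Psi L r = E \<longleftrightarrow> r = r_minus E L \<or> r = r_plus E L"
proof -
  obtain r1 r2 where r: "0 < r1" "r1 < r2" "Psi L r1 = E" "Psi L r2 = E"
    "\<And>r. 0 < r \<Longrightarrow> Psi L r < E \<longleftrightarrow> r1 < r \<and> r < r2"
    "\<And>r. 0 < r \<Longrightarrow> Psi L r = E \<longleftrightarrow> r = r1 \<or> r = r2"
    by (rule dom_roots[OF assms]) (rule that)
  have "{r. 0 < r \<and> Psi L r = E} = {r1, r2}" using r by auto
  then have "r_minus E L = r1" "r_plus E L = r2"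
    using r by (auto simp: r_minus_def r_plus_def cInf_insert cSup_insert sup_real_def inf_real_def)
  with r show "0 < r_minus E L" "r_minus E L < r_plus E L"
    "Psi L (r_minus E L) = E" "Psi L (r_plus E L) = E"
    "\<And>r. 0 < r \<Longrightarrow> Psi L r < E \<longleftrightarrow> r_minus E L < r \<and> r < r_plus E L"
    "\<And>r. 0 < r \<Longrightarrow> Psi L r = E \<longleftrightarrow> r = r_minus E L \<or> r = r_plus E L"
    by auto
qed

lemma continuous_Psi: "continuous_on {0<..} (Psi L)"
proof -
  have "continuous_on {0<..} (\<lambda>r. - (W 0 L r / (2 * r\<^sup>2)))"
    by (intro continuous_intros continuous_W) auto
  then show ?thesis
    by (rule continuous_on_eq) (auto simp: W_eq)
qed

text \<open>\<open>r_L\<close> is a definite description, so its minimiser must be unique: at two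
  minimisers W with E = Psi L m would vanish, and concavity would make Psi smaller between them. The
  lemma selects the first branch in the definition of \<open>period\<close>.\<close>

lemma E_min_less:
  assumes "(E, L) \<in> dom"
  shows "E_min L < E"
proof -
  note tp = turning_points[OF assms]
  let ?J = "{r_minus E L..r_plus E L}"
  have "continuous_on ?J (Psi L)"
    using tp by (intro continuous_on_subset[OF continuous_Psi]) auto
  then obtain m where m: "m \<in> ?J" "\<And>r. r \<in> ?J \<Longrightarrow> Psi L m \<le> Psi L r"
    using continuous_attains_inf[of ?J "Psi L"] tp by auto
  have "Psi L ((r_minus E L + r_plus E L) / 2) < E"
    using tp by (subst tp(5)) auto
  moreover have "Psi L m \<le> Psi L ((r_minus E L + r_plus E L) / 2)" using tp by (intro m) auto
  ultimately have mE: "Psi L m < E" by linarith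
  have m0: "0 < m" using m tp by auto
  have gm: "Psi L m \<le> Psi L r" if "0 < r" for r
    using m(2)[of r] tp(5)[OF that] mE by (cases "r \<in> ?J") auto
  have "r_L L = m"
    unfolding r_L_def
  proof (rule the_equality)
    show "0 < m \<and> (\<forall>s>0. Psi L m \<le> Psi L s)" using m0 gm by auto
    fix x assume x: "0 < x \<and> (\<forall>s>0. Psi L x \<le> Psi L s)"
    show "x = m"
    proof (rule ccontr)
      assume "x \<noteq> m"
      define a b where "a = min x m" and "b = max x m"
      have ab: "0 < a" "a < b" using x m0 \<open>x \<noteq> m\<close> by (auto simp: a_def b_def)
      have "Psi L x = Psi L m" using x m0 gm by (meson order_antisym)
      then have W0: "W (Psi L m) L a = 0" "W (Psi L m) L b = 0"
        using ab by (auto simp: W_zero_iff a_def b_def min_def max_def)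
      have "Psi L m \<le> U 0 + \<kappa> / 2" using mE assms by (auto simp: dom_def)
      then have "0 < W (Psi L m) L ((a + b) / 2) * (b - a)"
        using W_concave[of a "(a + b) / 2" b "Psi L m" L] ab W0 by simp
      then have "Psi L ((a + b) / 2) < Psi L m"
        using ab by (simp add: zero_less_mult_iff W_pos_iff)
      then show False using gm[of "(a + b) / 2"] ab by simp
    qed
  qed
  then show ?thesis using mE by (simp add: E_min_def)
qed

lemma E_min_le: "(E, L) \<in> dom \<Longrightarrow> period E L = period_integral E L"
  using E_min_less by (simp add: period_def)

section \<open>Support of the steady state and admissible orbits\<close>

definition A :: real where "A = L0 / (2 * M)"
definition B :: real where "B = M / (- \<kappa>)"

lemma A_pos: "0 < A" and B_pos: "0 < B"
  using params by (auto simp: A_def B_def divide_pos_neg)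

lemma allowed_region:
  assumes "0 < r" "L0 \<le> L" "E \<le> E0" "Psi L r \<le> E"
  shows "A < r" "r < B"
proof -
  have "L0 / (2 * r\<^sup>2) \<le> L / (2 * r\<^sup>2)" using assms by (intro divide_right_mono) auto
  then have "0 \<le> \<kappa> + M / r - L0 / (2 * r\<^sup>2)"
    using assms U_bounds[of r] by (simp add: E0_eq Psi_def)
  from kepler_region[OF params(1,2,3) assms(1) this] show "A < r" "r < B" by (auto simp: A_def B_def)
qed

lemma Omega_set: "{(r, w, L). 0 < r \<and> 0 \<le> L \<and> phi (energy r w L) L \<noteq> 0} =
    {(r, w, L). 0 < r \<and> L0 < L \<and> energy r w L < E0}"
  using params by (auto simp: phi_def)

lemma Psi_le_energy: "Psi L r \<le> energy r w L"
  by (simp add: energy_def)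

lemma Omega_bounds:
  assumes "(r, w, L) \<in> Omega"
  shows "A \<le> r" "r \<le> B" "L \<le> 2 * M * B"
proof -
  have "Omega \<subseteq> {A..B} \<times> UNIV \<times> {..2 * M * B}"
    unfolding Omega_def Omega_set
  proof (rule closure_minimal)
    show "{(r, w, L). 0 < r \<and> L0 < L \<and> energy r w L < E0} \<subseteq> {A..B} \<times> UNIV \<times> {..2 * M * B}"
    proof
      fix x assume "x \<in> {(r, w, L). 0 < r \<and> L0 < L \<and> energy r w L < E0}"
      then obtain r w L where x: "x = (r, w, L)" and *: "0 < r" "L0 < L" "energy r w L < E0" by auto
      then have P: "Psi L r < E0" using Psi_le_energy[of L r w] by linarith
      note AB = allowed_region[of r L E0]
      have "0 < W E0 L r" using * P by (simp add: W_pos_iff)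
      moreover have "(E0 - U 0) * r\<^sup>2 \<le> 0" using params by (intro mult_nonpos_nonneg) (auto simp: E0_eq)
      ultimately have "L < 2 * M * r" using W_le[of r E0 L] * by linarith
      moreover have "2 * M * r \<le> 2 * M * B" using AB * P params by (intro mult_left_mono) auto
      ultimately show "x \<in> {A..B} \<times> UNIV \<times> {..2 * M * B}"
        using AB * P unfolding x by auto
    qed
    show "closed ({A..B} \<times> (UNIV :: real set) \<times> {..2 * M * B})"
      by (intro closed_Times) auto
  qed
  with assms show "A \<le> r" "r \<le> B" "L \<le> 2 * M * B" by auto
qed

lemma Omega_memI: "0 < r \<Longrightarrow> L0 < L \<Longrightarrow> Psi L r < E0 \<Longrightarrow> (r, 0, L) \<in> Omega"
  unfolding Omega_def Omega_set by (rule subsetD[OF closure_subset]) (auto simp: energy_def)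

text \<open>The steady state vanishes at L = L0, whereas admissible orbits include it. Raising L by
  r^2 times the energy surplus uses up half of that surplus and lands in the support with L >
  L0.\<close>

lemma Psi_larger_L:
  assumes "0 < r" "Psi L r < E"
  obtains L' where "L < L'" "Psi L' r < E"
proof
  show "L < L + r\<^sup>2 * (E - Psi L r)" using assms by simp
  have "Psi (L + r\<^sup>2 * (E - Psi L r)) r = Psi L r + (E - Psi L r) / 2"
    using assms by (simp add: Psi_def add_divide_distrib)
  then show "Psi (L + r\<^sup>2 * (E - Psi L r)) r < E" using assms by (simp add: field_simps)
qed

lemma R_bounds:
  assumes "0 < r" "Psi L0 r < E0"
  shows "R_min \<le> r" "r \<le> R_max"
proof -
  obtain L where L: "L0 < L" "Psi L r < E0" using Psi_larger_L[OF assms] .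
  then have r: "r \<in> (\<lambda>(r, w, L). r) ` Omega" using Omega_memI[OF assms(1) L] by force
  have "bdd_below ((\<lambda>(r, w, L). r) ` Omega)" "bdd_above ((\<lambda>(r, w, L). r) ` Omega)"
    using Omega_bounds by (auto intro!: bdd_belowI[of _ A] bdd_aboveI[of _ B])
  then show "R_min \<le> r" "r \<le> R_max"
    unfolding R_min_def R_max_def by (simp_all only: cInf_lower[OF r] cSup_upper[OF r])
qed

lemma L_le_L_max:
  assumes "0 < r" "Psi L r < E0" "L0 \<le> L"
  shows "L \<le> L_max"
proof -
  obtain L' where L': "L < L'" "Psi L' r < E0" using Psi_larger_L[OF assms(1,2)] .
  then have r: "L' \<in> (\<lambda>(r, w, L). L) ` Omega" using Omega_memI[OF assms(1), of L'] assms(3) by force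
  have "bdd_above ((\<lambda>(r, w, L). L) ` Omega)"
    using Omega_bounds by (auto intro!: bdd_aboveI[of _ "2 * M * B"])
  then have "L' \<le> L_max" unfolding L_max_def by (rule cSup_upper[OF r])
  then show ?thesis using L'(1) by simp
qed

text \<open>L0 / M is the radius of the circular Kepler orbit with angular momentum L0, whose energy
  is - M^2 / (2 L0). The third smallness condition leaves room for the shift by
  \<open>\<delta>\<close>.\<close>

lemma Kepler_center: "0 < L0 / M" "Psi L0 (L0 / M) < E0"
proof -
  show 1: "0 < L0 / M" using params by simp
  have "Psi L0 (L0 / M) \<le> U 0 + \<delta> - M\<^sup>2 / (2 * L0)"
  proof -
    have "M / (L0 / M) - L0 / (2 * (L0 / M)\<^sup>2) = M\<^sup>2 / (2 * L0)"
      using params by (simp add: field_simps power2_eq_square)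
    then show ?thesis using U_bounds(2)[OF 1] unfolding Psi_def by linarith
  qed
  then show "Psi L0 (L0 / M) < E0" using small(3) by (simp add: E0_eq)
qed

lemma R_min_max: "A \<le> R_min" "R_max \<le> B" "R_min < R_max" "0 < R_min"
proof -
  have "L0 / M \<in> {r. 0 < r \<and> Psi L0 r < E0}" using Kepler_center by auto
  moreover have "open {r \<in> {0<..}. Psi L0 r < E0}"
    using continuous_open_preimage[OF continuous_Psi, of "{..<E0}" L0]
    by (simp add: vimage_def Int_def)
  moreover have "{r. 0 < r \<and> Psi L0 r < E0} = {r \<in> {0<..}. Psi L0 r < E0}" by auto
  ultimately obtain e where e: "0 < e" "ball (L0 / M) e \<subseteq> {r. 0 < r \<and> Psi L0 r < E0}"
    by (metis openE)
  have "L0 / M + e / 2 \<in> ball (L0 / M) e" using e by (simp add: dist_real_def)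
  then have "0 < L0 / M + e / 2 \<and> Psi L0 (L0 / M + e / 2) < E0" using e by blast
  then show "R_min < R_max"
    using R_bounds[OF Kepler_center] R_bounds[of "L0 / M + e / 2"] e by linarith
  obtain L where L: "L0 < L" "Psi L (L0 / M) < E0" using Psi_larger_L[OF Kepler_center] .
  have ne: "(\<lambda>(r, w, L). r) ` Omega \<noteq> {}" using Omega_memI[OF Kepler_center(1) L] by blast
  then show "A \<le> R_min" "R_max \<le> B"
    unfolding R_min_def R_max_def using Omega_bounds by (auto intro!: cInf_greatest cSup_least)
  then show "0 < R_min" using A_pos by simp
qed

text \<open>The orbits that cross radius R with nonzero radial velocity. The bounds through
  \<open>E_min\<close> and \<open>L_max\<close> in \<open>action_set\<close> follow from these
  explicit inequalities, see \<open>D_action_set\<close>.\<close>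

definition D :: "real \<Rightarrow> (real \<times> real) set" where
  "D R = {(E, L). L0 \<le> L \<and> Psi L R < E \<and> E \<le> E0}"

lemma D_dom: "0 < R \<Longrightarrow> x \<in> D R \<Longrightarrow> x \<in> dom"
  unfolding D_def dom_def using params E0_eq by auto

lemma D_action_set:
  assumes "0 < R"
  shows "D R = {(E, L) \<in> action_set. Psi L R < E}"
  using L_le_L_max[OF assms] E_min_less[OF D_dom[OF assms]]
  by (fastforce simp: D_def action_set_def)

text \<open>Elements of \<open>C1\<close> carry information only on [R_min, R_max], so the whole
  orbit has to stay there. Radii strictly between the turning points belong to the support at L0;
  the turning points follow as limits.\<close>

lemma D_orbit:
  assumes R: "0 < R" and x: "(E, L) \<in> D R"
  shows "R_min \<le> r_minus E L" "r_plus E L \<le> R_max" "r_minus E L < R" "R < r_plus E L"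
    "A < r_minus E L" "r_plus E L < B"
proof -
  note d = D_dom[OF R x]
  note tp = turning_points[OF d]
  have x': "L0 \<le> L" "Psi L R < E" "E \<le> E0" using x by (auto simp: D_def)
  show "r_minus E L < R" "R < r_plus E L" using tp(5)[OF R] x' by auto
  have in_R: "R_min \<le> r \<and> r \<le> R_max" if "r_minus E L < r" "r < r_plus E L" for r
  proof -
    have r: "0 < r" using that tp by linarith
    have "Psi L0 r \<le> Psi L r" using x' r by (simp add: Psi_def divide_right_mono)
    also have "\<dots> < E0" using tp(5)[OF r] that x' by simp
    finally show ?thesis using R_bounds[OF r] by simp
  qed
  show "R_min \<le> r_minus E L"
    using tp(2) in_R by (intro dense_ge_bounded[of "r_minus E L" "r_plus E L"]) auto
  show "r_plus E L \<le> R_max"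
    using tp(2) in_R by (intro dense_le_bounded[of "r_minus E L" "r_plus E L"]) auto
  show "A < r_minus E L" "r_plus E L < B"
    using allowed_region[of "r_minus E L" L E] allowed_region[of "r_plus E L" L E] tp x' by auto
qed

end

subsection \<open>Action-angle variables\<close>

context near_kepler
begin

text \<open>The orbit is parametrized by the eccentric-anomaly-like variable \<open>x\<close>, in which the period
  integral loses its endpoint singularities.\<close>

definition rad :: "real \<Rightarrow> real \<Rightarrow> real \<Rightarrow> real" where
  "rad E L x = r_minus E L * ((1 + cos x) / 2) + r_plus E L * ((1 - cos x) / 2)"

text \<open>The factor of W left after both roots are split off, see \<open>W_rad\<close>. The
  quotients (r - r_minus) / (r_plus - r_minus) and (r_plus - r) / (r_plus - r_minus) are (1 - cos x)
  / 2 and (1 + cos x) / 2, so no division by the width of the orbit occurs.\<close>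

definition gap :: "real \<Rightarrow> real \<Rightarrow> real \<Rightarrow> real" where
  "gap E L x = - 2 * (E - U 0) + 2 * ((1 - cos x) / 2 * I (r_minus E L) (rad E L x)
     + (1 + cos x) / 2 * I (r_plus E L) (rad E L x))"

text \<open>Time per unit of x. Hence \<open>clock\<close> is the time elapsed since the inner
  turning point, and \<open>tau\<close> is the angle on the outgoing half of the orbit.\<close>

definition speed :: "real \<Rightarrow> real \<Rightarrow> real \<Rightarrow> real" where
  "speed E L x = rad E L x / sqrt (gap E L x)"

definition clock :: "real \<Rightarrow> real \<Rightarrow> real \<Rightarrow> real" where
  "clock E L x = integral {0..x} (speed E L)"

definition tau :: "real \<Rightarrow> real \<Rightarrow> real \<Rightarrow> real" where
  "tau E L x = clock E L x / (2 * clock E L pi)"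

lemma rad_minus: "rad E L x - r_minus E L = (r_plus E L - r_minus E L) * ((1 - cos x) / 2)"
  and rad_plus: "r_plus E L - rad E L x = (r_plus E L - r_minus E L) * ((1 + cos x) / 2)"
  by (simp_all add: rad_def field_simps)

lemma rad_DERIV: "(rad E L has_real_derivative (r_plus E L - r_minus E L) / 2 * sin x) (at x within X)"
  unfolding rad_def by (auto intro!: derivative_eq_intros simp: field_simps)

lemma rad_0 [simp]: "rad E L 0 = r_minus E L" and rad_pi [simp]: "rad E L pi = r_plus E L"
  by (simp_all add: rad_def)

lemma continuous_rad: "continuous_on X (rad E L)"
  unfolding rad_def by (intro continuous_intros) auto

lemma one_minus_cos: "0 \<le> 1 - cos x" "0 \<le> 1 + cos x" for x :: real
  using cos_ge_minus_one[of x] cos_le_one[of x] by linarith+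

lemma rad_range:
  assumes "(E, L) \<in> dom"
  shows "r_minus E L \<le> rad E L x" "rad E L x \<le> r_plus E L" "0 < rad E L x"
proof -
  note tp = turning_points(1,2)[OF assms]
  have "0 \<le> rad E L x - r_minus E L" "0 \<le> r_plus E L - rad E L x"
    unfolding rad_minus rad_plus using tp one_minus_cos[of x] by (auto intro!: mult_nonneg_nonneg)
  then show "r_minus E L \<le> rad E L x" "rad E L x \<le> r_plus E L" "0 < rad E L x" using tp by auto
qed

lemma rad_strict_mono:
  assumes "(E, L) \<in> dom" "x \<in> {0..pi}" "y \<in> {0..pi}" "x < y"
  shows "rad E L x < rad E L y"
proof -
  have "cos y < cos x" using assms by (intro cos_monotone_0_pi) auto
  then have "0 < (r_plus E L - r_minus E L) * ((cos x - cos y) / 2)"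
    using turning_points(2)[OF assms(1)] by simp
  also have "\<dots> = rad E L y - rad E L x" by (simp add: rad_def field_simps)
  finally show ?thesis by simp
qed

lemma rad_inj:
  assumes "(E, L) \<in> dom" "x \<in> {0..pi}" "y \<in> {0..pi}" "rad E L x = rad E L y"
  shows "x = y"
  using rad_strict_mono[OF assms(1,2,3)] rad_strict_mono[OF assms(1,3,2)] assms(4) by (metis less_irrefl linorder_less_linear)

lemma rad_surj:
  assumes "(E, L) \<in> dom" "r_minus E L \<le> r" "r \<le> r_plus E L"
  obtains x where "x \<in> {0..pi}" "rad E L x = r"
  using IVT'[of "rad E L" 0 r pi] continuous_rad assms by auto

lemma continuous_I: "0 < a \<Longrightarrow> continuous_on {0<..} (I a)"
proof -
  assume a: "0 < a"
  have "continuous_on {0<..} (\<lambda>r. integral (cbox 0 1) (\<lambda>t. t * Y2 (a + t * (r - a))))"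
  proof (rule integral_continuous_on_param)
    have "continuous_on ({0<..} \<times> cbox 0 1) (\<lambda>z. snd z * Y2 (a + snd z * (fst z - a)))"
      using segment_pos[OF a]
      by (intro continuous_intros continuous_on_compose2[OF continuous_Y2]) auto
    then show "continuous_on ({0<..} \<times> cbox 0 1) (\<lambda>(r, t). t * Y2 (a + t * (r - a)))"
      by (simp add: split_beta)
  qed
  then show ?thesis by (simp add: I_def[abs_def])
qed

lemma gap_bounds:
  assumes "(E, L) \<in> dom"
  shows "- \<kappa> / 2 \<le> gap E L x" "gap E L x \<le> - 2 * (E - U 0) + 2 * \<delta>" "0 < gap E L x"
proof -
  note tp = turning_points(1,2)[OF assms]
  note rr = rad_range[OF assms, of x]
  define d where "d = r_plus E L - r_minus E L"
  have d: "0 < d" using tp by (simp add: d_def)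
  have "- \<kappa> / 2 * d \<le> - 2 * (E - U 0) * d + 2 * ((rad E L x - r_minus E L) * I (r_minus E L) (rad E L x)
      + (r_plus E L - rad E L x) * I (r_plus E L) (rad E L x))"
    unfolding d_def using tp rr assms by (intro interp_weight_pos) (auto simp: dom_def)
  also have "\<dots> = gap E L x * d"
    unfolding rad_minus rad_plus d_def[symmetric] gap_def by (simp add: algebra_simps)
  finally have "- \<kappa> / 2 * d \<le> gap E L x * d" .
  from mult_right_le_imp_le[OF this d] show g: "- \<kappa> / 2 \<le> gap E L x" .
  then show "0 < gap E L x" using params by linarith
  have "(1 - cos x) / 2 * I (r_minus E L) (rad E L x) \<le> (1 - cos x) / 2 * \<delta>"
    "(1 + cos x) / 2 * I (r_plus E L) (rad E L x) \<le> (1 + cos x) / 2 * \<delta>"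
    using I_bound[of "r_minus E L" "rad E L x"] I_bound[of "r_plus E L" "rad E L x"] tp rr one_minus_cos[of x]
    by (auto intro!: mult_left_mono divide_right_mono)
  then have "(1 - cos x) / 2 * I (r_minus E L) (rad E L x) + (1 + cos x) / 2 * I (r_plus E L) (rad E L x)
      \<le> (1 - cos x) / 2 * \<delta> + (1 + cos x) / 2 * \<delta>" by linarith
  also have "\<dots> = \<delta>" by (simp add: field_simps)
  finally show "gap E L x \<le> - 2 * (E - U 0) + 2 * \<delta>" by (simp add: gap_def)
qed

lemma W_rad:
  assumes "(E, L) \<in> dom"
  shows "W E L (rad E L x) = ((r_plus E L - r_minus E L) / 2 * sin x)\<^sup>2 * gap E L x"
proof -
  note tp = turning_points[OF assms]
  note rr = rad_range[OF assms, of x]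
  define d where "d = r_plus E L - r_minus E L"
  have d: "0 < d" using tp by (simp add: d_def)
  have "W E L (r_minus E L) = 0" "W E L (r_plus E L) = 0"
    using tp by (auto simp: W_zero_iff)
  then have "W E L (rad E L x) * d = (d * ((1 - cos x) / 2)) * (d * ((1 + cos x) / 2)) *
     (- 2 * (E - U 0) * d + 2 * (d * ((1 - cos x) / 2) * I (r_minus E L) (rad E L x)
      + (d * ((1 + cos x) / 2)) * I (r_plus E L) (rad E L x)))"
    using W_interpolation[of "r_minus E L" "r_plus E L" "rad E L x" E L] tp rr
    unfolding rad_minus rad_plus d_def[symmetric] by simp
  also have "\<dots> = (d\<^sup>2 * ((1 - cos x) * (1 + cos x)) / 4 * gap E L x) * d"
    unfolding gap_def by (simp add: field_simps power2_eq_square)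
  also have "(1 - cos x) * (1 + cos x) = (sin x)\<^sup>2"
    using sin_cos_squared_add[of x] by (simp add: power2_eq_square algebra_simps)
  finally show ?thesis using d by (simp add: d_def power_mult_distrib power_divide)
qed

lemma continuous_gap:
  assumes "(E, L) \<in> dom"
  shows "continuous_on X (gap E L)"
proof -
  have "0 < r_minus E L" "0 < r_plus E L" using turning_points(1,2)[OF assms] by auto
  then show ?thesis
    unfolding gap_def using rad_range(3)[OF assms]
    by (intro continuous_intros continuous_on_compose2[OF continuous_I continuous_rad]) auto
qed

lemma continuous_speed: "(E, L) \<in> dom \<Longrightarrow> continuous_on X (speed E L)"
  unfolding speed_def using gap_bounds(3)
  by (intro continuous_intros continuous_gap continuous_rad) (auto simp: less_imp_neq[symmetric])

lemma speed_pos: "(E, L) \<in> dom \<Longrightarrow> 0 < speed E L x"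
  unfolding speed_def using gap_bounds(3) rad_range(3) by simp

lemma clock_has_integral: "(E, L) \<in> dom \<Longrightarrow> (speed E L has_integral clock E L x) {0..x}"
  unfolding clock_def by (intro integrable_integral integrable_continuous_real continuous_speed)

lemma clock_vector_derivative:
  assumes "(E, L) \<in> dom" "x \<in> {0..pi}"
  shows "(clock E L has_vector_derivative speed E L x) (at x within {0..pi})"
  unfolding clock_def by (rule integral_has_vector_derivative[OF continuous_speed[OF assms(1)] assms(2)])

lemma clock_strict_mono:
  assumes "(E, L) \<in> dom" "0 \<le> x" "x < y"
  shows "clock E L x < clock E L y"
proof -
  have "integral {0..x} (speed E L) + integral {x..y} (speed E L) = integral {0..y} (speed E L)"
    using assms by (intro Henstock_Kurzweil_Integration.integral_combine integrable_continuous_real continuous_speed) auto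
  moreover have "0 < integral {x..y} (speed E L)"
    using assms speed_pos integral_less_real[where f = "\<lambda>_. 0" and g = "speed E L" and a = x and b = y] continuous_speed[of E L "{x..y}"] by simp
  ultimately show ?thesis by (simp add: clock_def)
qed

lemma clock_0 [simp]: "clock E L 0 = 0"
  by (simp add: clock_def)

lemma clock_pi_pos: "(E, L) \<in> dom \<Longrightarrow> 0 < clock E L pi"
  using clock_strict_mono[of E L 0 pi] by simp

lemma tau_0 [simp]: "tau E L 0 = 0"
  by (simp add: tau_def)

lemma tau_pi: "(E, L) \<in> dom \<Longrightarrow> tau E L pi = 1 / 2"
  using clock_pi_pos[of E L] by (simp add: tau_def)

lemma tau_strict_mono: "(E, L) \<in> dom \<Longrightarrow> 0 \<le> x \<Longrightarrow> x < y \<Longrightarrow> tau E L x < tau E L y"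
  unfolding tau_def using clock_strict_mono clock_pi_pos by (simp add: divide_strict_right_mono)

lemma tau_inj:
  assumes "(E, L) \<in> dom" "0 \<le> x" "0 \<le> y" "tau E L x = tau E L y"
  shows "x = y"
  using tau_strict_mono[OF assms(1,2)] tau_strict_mono[OF assms(1,3)] assms(4) by (metis less_irrefl linorder_less_linear)

lemma tau_vector_derivative:
  assumes "(E, L) \<in> dom" "x \<in> {0..pi}"
  shows "(tau E L has_vector_derivative speed E L x / (2 * clock E L pi)) (at x within {0..pi})"
  unfolding tau_def using clock_vector_derivative[OF assms]
  unfolding has_real_derivative_iff_has_vector_derivative[symmetric] by (rule DERIV_cdivide)

lemma continuous_tau: "(E, L) \<in> dom \<Longrightarrow> continuous_on {0..pi} (tau E L)"
  using tau_vector_derivative by (meson continuous_on_vector_derivative)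

lemma tau_range:
  assumes "(E, L) \<in> dom" "x \<in> {0..pi}"
  shows "0 \<le> tau E L x" "tau E L x \<le> 1 / 2"
  using tau_strict_mono[OF assms(1), of 0 x] tau_strict_mono[OF assms(1), of x pi] assms(2) tau_pi[OF assms(1)]
  by (cases "x = 0"; cases "x = pi"; force)+

lemma tau_surj:
  assumes "(E, L) \<in> dom" "t \<in> {0..1/2}"
  obtains x where "x \<in> {0..pi}" "tau E L x = t"
  using IVT'[of "tau E L" 0 t pi] continuous_tau[OF assms(1)] assms tau_pi[OF assms(1)] by auto

section \<open>Period and angle in the new variable\<close>

lemma radial_speed:
  assumes d: "(E, L) \<in> dom" and x: "0 < x" "x < pi"
  shows "1 / sqrt (2 * E - 2 * Psi L (rad E L x)) * ((r_plus E L - r_minus E L) / 2 * sin x) = speed E L x"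
proof -
  let ?r = "rad E L x" and ?c = "(r_plus E L - r_minus E L) / 2 * sin x"
  have r: "0 < ?r" using rad_range(3)[OF d] .
  have c: "0 < ?c" using turning_points(2)[OF d] sin_gt_zero[OF x] by simp
  have "2 * E - 2 * Psi L ?r = W E L ?r / ?r\<^sup>2"
    using r by (simp add: W_eq)
  also have "\<dots> = (?c / ?r)\<^sup>2 * gap E L x"
    unfolding W_rad[OF d] by (simp add: power_divide)
  finally have "sqrt (2 * E - 2 * Psi L ?r) = ?c / ?r * sqrt (gap E L x)"
    using c r by (simp add: real_sqrt_mult)
  moreover have "1 / (c / r * s) * c = r / s" if "0 < c" "0 < r" "0 < s" for c r s :: real
    using that by (simp add: field_simps)
  ultimately show ?thesis
    using c r gap_bounds(3)[OF d, of x] by (simp only: speed_def real_sqrt_gt_0_iff)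
qed

text \<open>The integrand is singular at a turning point. Substitution for nonnegative integrals
  asks for no integrability in advance, and the factor sin x of the substitution cancels the
  singularity; finiteness is read off from the result.\<close>

lemma time_integral:
  assumes d: "(E, L) \<in> dom" and x: "x \<in> {0..pi}"
  shows "(LINT s:{r_minus E L..rad E L x}|lebesgue. 1 / sqrt (2 * E - 2 * Psi L s)) = clock E L x"
proof -
  let ?r1 = "r_minus E L" and ?r = "rad E L x"
  define f where "f s = 1 / sqrt (2 * E - 2 * Psi L s)" for s
  define c where "c y = (r_plus E L - ?r1) / 2 * sin y" for y
  note tp = turning_points[OF d]
  have pos: "0 < s" if "s \<in> {?r1..?r}" for s using that tp by auto
  have le: "Psi L s \<le> E" if "s \<in> {?r1..?r}" for s
    using tp(5)[OF pos[OF that]] tp(6)[OF pos[OF that]] that rad_range(2)[OF d, of x] by (auto simp: le_less)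
  define h where "h s = indicator {?r1..?r} s *\<^sub>R Psi L s" for s
  have h: "h \<in> borel_measurable borel"
    unfolding h_def using pos
    by (intro borel_measurable_continuous_on_indicator continuous_on_subset[OF continuous_Psi]) auto
  have eq: "(\<lambda>s. indicator {?r1..?r} s *\<^sub>R f s) = (\<lambda>s. indicator {?r1..?r} s *\<^sub>R (1 / sqrt (2 * E - 2 * h s)))"
    by (auto simp: f_def h_def indicator_def)
  have meas: "set_borel_measurable borel {?r1..?r} f"
    unfolding set_borel_measurable_def eq using h by measurable
  have "(\<integral>\<^sup>+s. f s * indicator {rad E L 0..?r} s \<partial>lborel) = (\<integral>\<^sup>+y. f (rad E L y) * c y * indicator {0..x} y \<partial>lborel)"
  proof (rule nn_integral_substitution)
    show "set_borel_measurable borel {rad E L 0..?r} f" using meas by simp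
    show "(rad E L has_real_derivative c y) (at y)" for y
      unfolding c_def by (rule rad_DERIV)
    show "continuous_on {0..x} c" unfolding c_def by (intro continuous_intros)
    show "0 \<le> c y" if "y \<in> {0..x}" for y
      unfolding c_def using tp(2) that x by (intro mult_nonneg_nonneg sin_ge_zero) auto
  qed (use x in auto)
  also have "\<dots> = (\<integral>\<^sup>+y. speed E L y * indicator {0..x} y \<partial>lborel)"
  proof (rule nn_integral_cong_AE)
    \<comment> \<open>At a turning point the left side is 0 by the convention 1 / 0 = 0, while
      \<open>speed\<close> is positive; the two ends have measure zero.\<close>
    have "AE y in lborel. y \<noteq> 0 \<and> y \<noteq> x"
      using AE_lborel_singleton[of 0] AE_lborel_singleton[of x] by auto
    then show "AE y in lborel. ennreal (f (rad E L y) * c y * indicator {0..x} y) = ennreal (speed E L y * indicator {0..x} y)"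
    proof eventually_elim
      case (elim y)
      then show ?case
        using radial_speed[OF d, of y] x by (auto simp: indicator_def f_def c_def)
    qed
  qed
  also have "\<dots> = ennreal (clock E L x)"
  proof -
    have "((\<lambda>y. speed E L y) has_integral clock E L x) {0..x}" by (rule clock_has_integral[OF d])
    then have "(\<integral>\<^sup>+y. ennreal (indicator {0..x} y * speed E L y) \<partial>lborel) = ennreal (clock E L x)"
      using speed_pos[OF d]
      by (intro nn_integral_has_integral_lebesgue) (auto intro: less_imp_le)
    then show ?thesis by (simp add: mult.commute)
  qed
  finally have nn: "(\<integral>\<^sup>+s. f s * indicator {?r1..?r} s \<partial>lborel) = ennreal (clock E L x)" by simp
  have m: "(\<lambda>s. f s * indicator {?r1..?r} s) \<in> borel_measurable lborel"
    using meas by (simp add: set_borel_measurable_def mult.commute)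
  have "(LINT s:{?r1..?r}|lebesgue. f s) = (LINT s|lebesgue. f s * indicator {?r1..?r} s)"
    by (simp add: set_lebesgue_integral_def mult.commute)
  also have "\<dots> = (LINT s|lborel. f s * indicator {?r1..?r} s)"
    by (rule integral_completion[OF m])
  also have "\<dots> = enn2real (\<integral>\<^sup>+s. f s * indicator {?r1..?r} s \<partial>lborel)"
    using le by (intro integral_eq_nn_integral m) (auto simp: f_def indicator_def)
  also have "\<dots> = clock E L x"
    unfolding nn using x clock_strict_mono[OF d, of 0 x] by (cases "x = 0") auto
  finally show ?thesis by (simp add: f_def)
qed

lemma period_eq: "(E, L) \<in> dom \<Longrightarrow> period E L = 2 * clock E L pi"
  using time_integral[of E L pi] by (simp add: E_min_le period_integral_def)

lemma angle_rad:
  assumes d: "(E, L) \<in> dom" and x: "x \<in> {0..pi}" and e: "energy (rad E L x) w L = E"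
  shows "angle (rad E L x) w L = (if 0 \<le> w then tau E L x else 1 - tau E L x)"
  using time_integral[OF d x] by (simp add: angle_def e period_eq[OF d] tau_def Let_def)

lemma energy_orbit:
  assumes d: "(E, L) \<in> dom" and "0 < r" "energy r w L = E"
  obtains x where "x \<in> {0..pi}" "r = rad E L x"
proof -
  have "Psi L r \<le> E" using assms(3) by (auto simp: energy_def)
  then have "r_minus E L \<le> r" "r \<le> r_plus E L"
    using turning_points(5,6)[OF d assms(2)] turning_points(2)[OF d] by (auto simp: le_less)
  then show thesis using rad_surj[OF d] that by metis
qed

section \<open>The inverse of the angle map\<close>

lemma energy_iff: "energy r w L = E \<longleftrightarrow> w\<^sup>2 = 2 * E - 2 * Psi L r"
  unfolding energy_def by linarith

lemma Psi_rad_le: "(E, L) \<in> dom \<Longrightarrow> Psi L (rad E L x) \<le> E"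
  using W_rad[of E L x] gap_bounds(3)[of E L x] rad_range(3)[of E L x]
  by (metis W_neg_iff less_eq_real_def linorder_not_less mult_nonneg_nonneg zero_le_power2)

lemma r_of_angle_tau:
  assumes d: "(E, L) \<in> dom" and x: "x \<in> {0..pi}"
  shows "r_of_angle (tau E L x) E L = rad E L x"
proof -
  let ?w = "sqrt (2 * E - 2 * Psi L (rad E L x))"
  have fr: "frac (tau E L x) = tau E L x"
    using tau_range[OF d x] by (simp add: frac_eq)
  have e: "energy (rad E L x) ?w L = E"
    using Psi_rad_le[OF d, of x] by (simp add: energy_iff)
  have "rw_of_angle (tau E L x) E L = (rad E L x, ?w)"
    unfolding rw_of_angle_def fr
  proof (rule the_equality)
    show "case (rad E L x, ?w) of (r, w) \<Rightarrow> 0 < r \<and> energy r w L = E \<and> angle r w L = tau E L x"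
      using rad_range(3)[OF d] e angle_rad[OF d x e] Psi_rad_le[OF d, of x] by auto
    fix p assume p: "case p of (r, w) \<Rightarrow> 0 < r \<and> energy r w L = E \<and> angle r w L = tau E L x"
    obtain r w where pr: "p = (r, w)" by (cases p)
    have r: "0 < r" and ew: "energy r w L = E" and aw: "angle r w L = tau E L x" using p pr by auto
    obtain y where y: "y \<in> {0..pi}" "r = rad E L y" using energy_orbit[OF d r ew] .
    have ang: "(if 0 \<le> w then tau E L y else 1 - tau E L y) = tau E L x"
      using angle_rad[OF d y(1)] ew aw y(2) by simp
    \<comment> \<open>An incoming candidate has angle at least 1/2. Equality with an outgoing angle
      is possible only at the outer turning point, where w = 0.\<close>
    have "0 \<le> w"
    proof (rule ccontr)
      assume w: "\<not> 0 \<le> w"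
      then have "tau E L y = 1/2" using ang tau_range[OF d x] tau_range[OF d y(1)] by simp
      then have "y = pi" using tau_inj[OF d, of y pi] y(1) tau_pi[OF d] by simp
      then have "Psi L r = E" using y(2) turning_points(4)[OF d] by simp
      then have "w\<^sup>2 = 0" using ew by (simp add: energy_iff)
      then show False using w by simp
    qed
    then have "y = x" using ang tau_inj[OF d, of y x] x y(1) by simp
    moreover have "w = sqrt (2 * E - 2 * Psi L r)"
      using ew \<open>0 \<le> w\<close> by (simp add: energy_iff[symmetric] real_sqrt_unique)
    ultimately show "p = (rad E L x, ?w)" using pr y(2) by simp
  qed
  then show ?thesis by (simp add: r_of_angle_def)
qed

lemma r_of_angle_reflect:
  assumes d: "(E, L) \<in> dom" and x: "x \<in> {0..pi}"
  shows "r_of_angle (1 - tau E L x) E L = rad E L x"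
proof -
  consider "x = 0" | "x = pi" | "0 < x" "x < pi" using x by force
  then show ?thesis
  proof cases
    case 1
    \<comment> \<open>At the inner turning point the reflected angle is 1, which \<open>frac\<close>
      sends back to 0.\<close>
    have "r_of_angle (1 - tau E L x) E L = r_of_angle (tau E L 0) E L"
      using 1 by (simp add: r_of_angle_def rw_of_angle_def frac_def)
    then show ?thesis using r_of_angle_tau[OF d, of 0] 1 by simp
  next
    case 2
    moreover have "1 - tau E L pi = tau E L pi" using tau_pi[OF d] by simp
    ultimately show ?thesis using r_of_angle_tau[OF d x] by (simp only:)
  next
    case 3
    have t: "0 < tau E L x" "tau E L x < 1/2"
      using tau_strict_mono[OF d, of 0 x] tau_strict_mono[OF d, of x pi] 3 tau_pi[OF d] by auto
    let ?w = "- sqrt (2 * E - 2 * Psi L (rad E L x))"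
    have fr: "frac (1 - tau E L x) = 1 - tau E L x" using t by (simp add: frac_eq)
    have e: "energy (rad E L x) ?w L = E"
      using Psi_rad_le[OF d, of x] by (simp add: energy_iff)
    have "r_minus E L < rad E L x" "rad E L x < r_plus E L"
      using rad_strict_mono[OF d, of 0 x] rad_strict_mono[OF d, of x pi] 3 by auto
    then have w: "?w < 0" using turning_points(5)[OF d rad_range(3)[OF d]] by simp
    have "rw_of_angle (1 - tau E L x) E L = (rad E L x, ?w)"
      unfolding rw_of_angle_def fr
    proof (rule the_equality)
      show "case (rad E L x, ?w) of (r, w) \<Rightarrow> 0 < r \<and> energy r w L = E \<and> angle r w L = 1 - tau E L x"
        using rad_range(3)[OF d] e angle_rad[OF d x e] w by auto
      fix p assume p: "case p of (r, w) \<Rightarrow> 0 < r \<and> energy r w L = E \<and> angle r w L = 1 - tau E L x"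
      obtain r v where pr: "p = (r, v)" by (cases p)
      have r: "0 < r" and ew: "energy r v L = E" and aw: "angle r v L = 1 - tau E L x" using p pr by auto
      obtain y where y: "y \<in> {0..pi}" "r = rad E L y" using energy_orbit[OF d r ew] .
      have ang: "(if 0 \<le> v then tau E L y else 1 - tau E L y) = 1 - tau E L x"
        using angle_rad[OF d y(1)] ew aw y(2) by simp
      have v: "v < 0"
      proof (rule ccontr)
        assume "\<not> v < 0"
        then have "tau E L y = 1 - tau E L x" using ang by simp
        then show False using t tau_range[OF d y(1)] by simp
      qed
      then have "y = x" using ang tau_inj[OF d, of y x] x y(1) by simp
      moreover have "- v = sqrt (2 * E - 2 * Psi L r)"
        using ew v by (intro real_sqrt_unique[symmetric]) (auto simp: energy_iff)
      ultimately show "p = (rad E L x, ?w)" using pr y(2) by simp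
    qed
    then show ?thesis by (simp add: r_of_angle_def)
  qed
qed

lemma angle_at_rad:
  assumes d: "(E, L) \<in> dom" and x: "x \<in> {0..pi}"
  shows "angle_at (rad E L x) E L = tau E L x"
  unfolding angle_at_def
proof (rule the_equality)
  show "tau E L x \<in> {0..1/2} \<and> r_of_angle (tau E L x) E L = rad E L x"
    using tau_range[OF d x] r_of_angle_tau[OF d x] by auto
  fix t assume t: "t \<in> {0..1/2} \<and> r_of_angle t E L = rad E L x"
  obtain y where y: "y \<in> {0..pi}" "tau E L y = t" using tau_surj[OF d, of t] t by auto
  then have "rad E L y = rad E L x" using r_of_angle_tau[OF d y(1)] t by simp
  then show "t = tau E L x" using rad_inj[OF d y(1) x] y by simp
qed

end

subsection \<open>Fourier coefficients\<close>

lemma sum_int_le_sum_nat: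
  fixes f :: "nat \<Rightarrow> real"
  assumes "finite X" "(0::int) \<notin> X"
    and le: "\<And>N. finite N \<Longrightarrow> 0 \<notin> N \<Longrightarrow> (\<Sum>n\<in>N. f n) \<le> c"
  shows "(\<Sum>m\<in>X. f (nat \<bar>m\<bar>)) \<le> 2 * c"
proof -
  have *: "(\<Sum>m\<in>Z. f (nat \<bar>m\<bar>)) \<le> c" if "Z \<subseteq> X" "inj_on (\<lambda>m. nat \<bar>m\<bar>) Z" for Z
  proof -
    have "(\<Sum>m\<in>Z. f (nat \<bar>m\<bar>)) = (\<Sum>n\<in>(\<lambda>m. nat \<bar>m\<bar>) ` Z. f n)"
      using that(2) by (simp add: sum.reindex o_def)
    also have "\<dots> \<le> c"
      using that assms(1,2) by (intro le) (auto intro: finite_subset)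
    finally show ?thesis .
  qed
  have "{m \<in> X. 0 < m} \<union> {m \<in> X. m < 0} = X" using assms(2) by (auto simp: not_less le_less)
  moreover have "(\<Sum>m\<in>{m \<in> X. 0 < m} \<union> {m \<in> X. m < 0}. f (nat \<bar>m\<bar>)) =
      (\<Sum>m\<in>{m \<in> X. 0 < m}. f (nat \<bar>m\<bar>)) + (\<Sum>m\<in>{m \<in> X. m < 0}. f (nat \<bar>m\<bar>))"
    using assms(1) by (intro sum.union_disjoint) auto
  ultimately have "(\<Sum>m\<in>X. f (nat \<bar>m\<bar>)) = (\<Sum>m\<in>{m \<in> X. 0 < m}. f (nat \<bar>m\<bar>)) + (\<Sum>m\<in>{m \<in> X. m < 0}. f (nat \<bar>m\<bar>))"
    by simp
  also have "\<dots> \<le> c + c"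
    by (intro add_mono *) (auto simp: inj_on_def)
  finally show ?thesis by simp
qed

lemma exp_int_period: "exp (- (2 * of_real pi * \<i> * of_int m * of_real (1 - t))) = exp (2 * of_real pi * \<i> * of_int m * of_real t)"
proof -
  have "exp (- (2 * of_real pi * \<i> * of_int m * of_real (1 - t))) =
      exp (2 * of_real pi * \<i> * of_int m * of_real t + 2 * of_int (- m) * of_real pi * \<i>)"
    by (simp add: algebra_simps)
  also have "\<dots> = exp (2 * of_real pi * \<i> * of_int m * of_real t)"
    unfolding exp_eq by (rule exI[of _ "- m"]) simp
  finally show ?thesis .
qed

context near_kepler
begin

definition phase_rate :: "real \<Rightarrow> real \<Rightarrow> real \<Rightarrow> real" where
  "phase_rate E L x = speed E L x / (2 * clock E L pi)"

text \<open>The orbit passes each radius twice, at the angles tau and 1 - tau. Substituting on the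
  two halves and adding the conjugate exponentials leaves twice a cosine integral over the outgoing
  half.\<close>

lemma fourier_coeff_eq:
  assumes d: "(E, L) \<in> dom" and V: "continuous_on {r_minus E L..r_plus E L} V"
  shows "fourier_coeff V m E L =
    2 * integral {0..pi} (\<lambda>x. (cos (2 * pi * of_int m * tau E L x) * phase_rate E L x) *\<^sub>R V (rad E L x))"
proof -
  define v where "v t = V (r_of_angle t E L)" for t
  define ex where "ex t = exp (- (2 * of_real pi * \<i> * of_int m * of_real t))" for t
  have tau_im: "tau E L ` {0..pi} = {0..1/2}"
  proof (intro subset_antisym subsetI)
    fix t assume "t \<in> {0..1/2 :: real}"
    then show "t \<in> tau E L ` {0..pi}" using tau_surj[OF d, of t] by blast
  qed (use tau_range[OF d] in auto)
  have tauD: "(tau E L has_field_derivative phase_rate E L x) (at x within {0..pi})" if "x \<in> {0..pi}" for x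
    using tau_vector_derivative[OF d that] by (simp add: phase_rate_def has_real_derivative_iff_has_vector_derivative)
  have v_tau: "v (tau E L x) = V (rad E L x)" "v (1 - tau E L x) = V (rad E L x)" if "x \<in> {0..pi}" for x
    using r_of_angle_tau[OF d that] r_of_angle_reflect[OF d that] by (auto simp: v_def)
  \<comment> \<open>\<open>r_of_angle\<close> is a definite description, so its continuity in the
    angle is not visible. It is obtained from the continuous inverse of \<open>tau\<close> on a
    compact interval and makes both integrals exist.\<close>
  define g where "g = inv_into {0..pi} (tau E L)"
  have inj: "inj_on (tau E L) {0..pi}" using tau_inj[OF d] by (auto simp: inj_on_def)
  have gt: "g (tau E L x) = x" if "x \<in> {0..pi}" for x
    unfolding g_def using inv_into_f_f[OF inj that] .
  have g: "continuous_on {0..1/2} g"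
    using continuous_on_inv[OF continuous_tau[OF d], of g] gt by (simp add: tau_im)
  have g_im: "g t \<in> {0..pi}" "tau E L (g t) = t" if t: "t \<in> {0..1/2}" for t
  proof -
    obtain x where "x \<in> {0..pi}" "tau E L x = t" using tau_surj[OF d t] .
    then show "g t \<in> {0..pi}" "tau E L (g t) = t" using gt by auto
  qed
  have "continuous_on {0..1/2} (\<lambda>t. V (rad E L (g t)))"
    using rad_range[OF d]
    by (intro continuous_on_compose2[OF V] continuous_on_compose2[OF continuous_rad[of UNIV] g]) auto
  then have v1: "continuous_on {0..1/2} v"
    by (rule continuous_on_eq) (use v_tau(1) g_im in metis)
  have "continuous_on {1/2..1} (\<lambda>t. v (1 - t))"
    by (intro continuous_on_compose2[OF v1] continuous_intros) auto
  then have v2: "continuous_on {1/2..1} v"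
  proof (rule continuous_on_eq)
    fix t :: real assume "t \<in> {1/2..1}"
    then have t: "1 - t \<in> {0..1/2}" by auto
    show "v (1 - t) = v t"
      using v_tau[OF g_im(1)[OF t]] g_im(2)[OF t] by simp
  qed
  have exc: "continuous_on X ex" for X unfolding ex_def by (intro continuous_intros)
  have vc: "continuous_on {0..1} v"
    using continuous_on_closed_Un[OF _ _ v1 v2] ivl_disj_un_two_touch(4)[of 0 "1/2" "1::real"] by simp
  let ?q = "\<lambda>t. v t * ex t"
  have qc: "continuous_on {0..1} ?q" by (intro continuous_intros vc exc)
  have q1: "continuous_on {0..1/2} ?q" and q2: "continuous_on {1/2..1} ?q"
    by (intro continuous_intros v1 v2 exc)+
  have "fourier_coeff V m E L = integral {0..1} ?q"
    unfolding fourier_coeff_def v_def[symmetric] ex_def[symmetric]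
    by (rule set_lebesgue_integral_eq_integral(2)[OF absolutely_integrable_continuous_real[OF qc]])
  also have "\<dots> = integral {0..1/2} ?q + integral {1/2..1} ?q"
    by (rule Henstock_Kurzweil_Integration.integral_combine[symmetric])
      (auto intro: integrable_continuous_real qc)
  also have "integral {0..1/2} ?q = integral {0..pi} (\<lambda>x. phase_rate E L x *\<^sub>R (V (rad E L x) * ex (tau E L x)))"
  proof -
    have "((\<lambda>x. phase_rate E L x *\<^sub>R ?q (tau E L x)) has_integral
       (integral {tau E L 0..tau E L pi} ?q - integral {tau E L pi..tau E L 0} ?q)) {0..pi}"
      by (rule has_integral_substitution_general[of "{}" _ _ _ 0 "1/2"])
        (use tau_im q1 continuous_tau[OF d] tauD in auto)
    then have "((\<lambda>x. phase_rate E L x *\<^sub>R ?q (tau E L x)) has_integral integral {0..1/2} ?q) {0..pi}"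
      by (simp add: tau_pi[OF d])
    then have "((\<lambda>x. phase_rate E L x *\<^sub>R (V (rad E L x) * ex (tau E L x))) has_integral integral {0..1/2} ?q) {0..pi}"
      by (rule has_integral_eq[rotated]) (simp add: v_tau)
    then show ?thesis by (simp add: integral_unique)
  qed
  also have "integral {1/2..1} ?q = integral {0..pi} (\<lambda>x. phase_rate E L x *\<^sub>R (V (rad E L x) * ex (1 - tau E L x)))"
  proof -
    have "((\<lambda>x. (- phase_rate E L x) *\<^sub>R ?q (1 - tau E L x)) has_integral
       (integral {1 - tau E L 0..1 - tau E L pi} ?q - integral {1 - tau E L pi..1 - tau E L 0} ?q)) {0..pi}"
    proof (rule has_integral_substitution_general[of "{}" _ _ "\<lambda>x. 1 - tau E L x" "1/2" 1])
      show "(\<lambda>x. 1 - tau E L x) ` {0..pi} \<subseteq> {1/2..1}" using tau_range[OF d] by force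
      show "continuous_on {0..pi} (\<lambda>x. 1 - tau E L x)" by (intro continuous_intros continuous_tau[OF d])
      show "((\<lambda>x. 1 - tau E L x) has_real_derivative - phase_rate E L x) (at x within {0..pi})" if "x \<in> {0..pi} - {}" for x
        using DERIV_diff[OF DERIV_const tauD[of x], of 1] that by simp
    qed (use q2 in auto)
    from has_integral_neg[OF this]
    have "((\<lambda>x. phase_rate E L x *\<^sub>R ?q (1 - tau E L x)) has_integral integral {1/2..1} ?q) {0..pi}"
      by (simp add: tau_pi[OF d])
    then have "((\<lambda>x. phase_rate E L x *\<^sub>R (V (rad E L x) * ex (1 - tau E L x))) has_integral integral {1/2..1} ?q) {0..pi}"
      by (rule has_integral_eq[rotated]) (simp add: v_tau)
    then show ?thesis by (simp add: integral_unique)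
  qed
  also have "integral {0..pi} (\<lambda>x. phase_rate E L x *\<^sub>R (V (rad E L x) * ex (tau E L x))) +
      integral {0..pi} (\<lambda>x. phase_rate E L x *\<^sub>R (V (rad E L x) * ex (1 - tau E L x))) =
      integral {0..pi} (\<lambda>x. phase_rate E L x *\<^sub>R (V (rad E L x) * ex (tau E L x)) + phase_rate E L x *\<^sub>R (V (rad E L x) * ex (1 - tau E L x)))"
  proof (rule Henstock_Kurzweil_Integration.integral_add[symmetric])
    have c: "continuous_on {0..pi} (\<lambda>x. V (rad E L x))"
      using rad_range[OF d] by (intro continuous_on_compose2[OF V] continuous_rad) auto
    have k: "continuous_on {0..pi} (phase_rate E L)"
      unfolding phase_rate_def using clock_pi_pos[OF d] by (intro continuous_intros continuous_speed[OF d]) auto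
    show "(\<lambda>x. phase_rate E L x *\<^sub>R (V (rad E L x) * ex (tau E L x))) integrable_on {0..pi}"
      "(\<lambda>x. phase_rate E L x *\<^sub>R (V (rad E L x) * ex (1 - tau E L x))) integrable_on {0..pi}"
      by (intro integrable_continuous_real continuous_intros c k continuous_on_compose2[OF exc[of UNIV]] continuous_tau[OF d]; simp)+
  qed
  also have "(\<lambda>x. phase_rate E L x *\<^sub>R (V (rad E L x) * ex (tau E L x)) + phase_rate E L x *\<^sub>R (V (rad E L x) * ex (1 - tau E L x)))
     = (\<lambda>x. (2 * (cos (2 * pi * of_int m * tau E L x) * phase_rate E L x)) *\<^sub>R V (rad E L x))"
  proof
    fix x
    have "ex t + ex (1 - t) = 2 * of_real (cos (2 * pi * of_int m * t))" for t
    proof -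
      have "ex (1 - t) = exp (\<i> * of_real (2 * pi * of_int m * t))"
        unfolding ex_def exp_int_period by (simp add: mult_ac)
      moreover have "ex t = exp (- (\<i> * of_real (2 * pi * of_int m * t)))"
        unfolding ex_def by (simp add: mult_ac)
      ultimately show ?thesis
        by (simp only: cos_of_real[symmetric] cos_exp_eq) (simp add: add.commute)
    qed
    then have "V (rad E L x) * ex (tau E L x) + V (rad E L x) * ex (1 - tau E L x) =
        (2 * cos (2 * pi * of_int m * tau E L x)) *\<^sub>R V (rad E L x)"
      unfolding distrib_left[symmetric] by (simp add: scaleR_conv_of_real mult.commute)
    then show "phase_rate E L x *\<^sub>R (V (rad E L x) * ex (tau E L x)) + phase_rate E L x *\<^sub>R (V (rad E L x) * ex (1 - tau E L x))
      = (2 * (cos (2 * pi * of_int m * tau E L x) * phase_rate E L x)) *\<^sub>R V (rad E L x)"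
      unfolding scaleR_right_distrib[symmetric] by (simp add: mult_ac)
  qed
  also have "integral {0..pi} (\<lambda>x. (2 * (cos (2 * pi * of_int m * tau E L x) * phase_rate E L x)) *\<^sub>R V (rad E L x)) =
      2 * integral {0..pi} (\<lambda>x. (cos (2 * pi * of_int m * tau E L x) * phase_rate E L x) *\<^sub>R V (rad E L x))"
    unfolding scaleR_scaleR[symmetric] integral_cmul by (simp add: scaleR_conv_of_real)
  finally show ?thesis .
qed

definition dV :: "(real \<Rightarrow> complex) \<Rightarrow> real \<Rightarrow> complex" where
  "dV V r = vector_derivative V (at r within {R_min..R_max})"

text \<open>The vector factor is the derivative of V along the orbit with respect to the angle, that
  is dr/dx divided by dtheta/dx, times V'. Keeping \<open>phase_rate\<close> as a separate weight
  gives the shape required by \<open>Bessel_sine\<close>.\<close>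

definition sine_coeff :: "(real \<Rightarrow> complex) \<Rightarrow> real \<Rightarrow> real \<Rightarrow> nat \<Rightarrow> complex" where
  "sine_coeff V E L n = integral {0..pi} (\<lambda>x. (sin (2 * pi * real n * tau E L x) * phase_rate E L x) *\<^sub>R
     (((r_plus E L - r_minus E L) / 2 * sin x / phase_rate E L x) *\<^sub>R dV V (rad E L x)))"

lemma phase_rate_pos: "(E, L) \<in> dom \<Longrightarrow> 0 < phase_rate E L x"
  using speed_pos clock_pi_pos by (simp add: phase_rate_def)

lemma continuous_phase_rate: "(E, L) \<in> dom \<Longrightarrow> continuous_on X (phase_rate E L)"
  unfolding phase_rate_def using clock_pi_pos[of E L] by (intro continuous_intros continuous_speed) auto

text \<open>Integrate the cosine by parts: the boundary terms vanish, because sin (2 pi m tau) is 0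
  at tau = 0 and at tau = 1/2. The sign of m only affects the sign of the sine integral.\<close>

lemma fourier_coeff_by_parts:
  assumes R: "0 < R" and x: "(E, L) \<in> D R" and V: "V \<in> C1 R_min R_max" and m: "m \<noteq> 0"
  shows "norm (fourier_coeff V m E L) = norm (sine_coeff V E L (nat \<bar>m\<bar>)) / (pi * \<bar>m\<bar>)"
proof -
  note d = D_dom[OF R x]
  note VD = C1D[OF V R_min_max(3)]
  note orb = D_orbit[OF R x]
  have sub: "{r_minus E L..r_plus E L} \<subseteq> {R_min..R_max}" using orb by auto
  have inR: "rad E L t \<in> {R_min..R_max}" for t using rad_range[OF d, of t] sub by auto
  define c where "c t = (r_plus E L - r_minus E L) / 2 * sin t" for t
  let ?p = "2 * pi * of_int m"
  have Vr: "((\<lambda>t. V (rad E L t)) has_vector_derivative c t *\<^sub>R dV V (rad E L t)) (at t within {0..pi})" for t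
  proof -
    have 1: "(rad E L has_vector_derivative c t) (at t within {0..pi})"
      using rad_DERIV[of E L t "{0..pi}"] by (simp add: has_real_derivative_iff_has_vector_derivative c_def)
    have 2: "(V has_vector_derivative dV V (rad E L t)) (at (rad E L t) within rad E L ` {0..pi})"
      unfolding dV_def by (rule has_vector_derivative_within_subset[OF VD(2)[OF inR]]) (use inR in auto)
    show ?thesis using vector_diff_chain_within[OF 1 2] by (simp add: o_def)
  qed
  have tauD: "(tau E L has_real_derivative phase_rate E L t) (at t within {0..pi})" if "t \<in> {0..pi}" for t
    using tau_vector_derivative[OF d that] by (simp add: phase_rate_def has_real_derivative_iff_has_vector_derivative)
  have cV: "continuous_on {0..pi} (\<lambda>t. V (rad E L t))" "continuous_on {0..pi} (\<lambda>t. dV V (rad E L t))"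
    unfolding dV_def
    by (rule continuous_on_compose2[OF VD(4) continuous_rad], use inR in blast,
        rule continuous_on_compose2[OF VD(3) continuous_rad], use inR in blast)
  have cc: "continuous_on {0..pi} c" unfolding c_def by (intro continuous_intros) auto
  let ?a = "\<lambda>t. (?p * (cos (?p * tau E L t) * phase_rate E L t)) *\<^sub>R V (rad E L t)"
  let ?b = "\<lambda>t. (sin (?p * tau E L t) * c t) *\<^sub>R dV V (rad E L t)"
  have "((\<lambda>t. ?b t + ?a t) has_integral
      (sin (?p * tau E L pi) *\<^sub>R V (rad E L pi) - sin (?p * tau E L 0) *\<^sub>R V (rad E L 0))) {0..pi}"
  proof (rule fundamental_theorem_of_calculus)
    fix t assume t: "t \<in> {0..pi}"
    have s: "((\<lambda>t. sin (?p * tau E L t)) has_real_derivative ?p * (cos (?p * tau E L t) * phase_rate E L t)) (at t within {0..pi})"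
      by (auto intro!: derivative_eq_intros tauD[OF t])
    show "((\<lambda>t. sin (?p * tau E L t) *\<^sub>R V (rad E L t)) has_vector_derivative ?b t + ?a t) (at t within {0..pi})"
      using has_vector_derivative_scaleR[OF s Vr] by simp
  qed simp
  moreover have "sin (?p * tau E L pi) = 0"
    by (simp add: tau_pi[OF d])
  ultimately have z: "((\<lambda>t. ?b t + ?a t) has_integral 0) {0..pi}" by simp
  have ib: "?b integrable_on {0..pi}" and ia: "?a integrable_on {0..pi}"
    by (intro integrable_continuous_real continuous_intros cV cc continuous_tau[OF d] continuous_phase_rate[OF d])+
  have "integral {0..pi} ?b + integral {0..pi} ?a = integral {0..pi} (\<lambda>t. ?b t + ?a t)"
    by (rule Henstock_Kurzweil_Integration.integral_add[OF ib ia, symmetric])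
  also have "\<dots> = 0" by (rule integral_unique[OF z])
  finally have "integral {0..pi} ?b + integral {0..pi} ?a = 0" .
  moreover have "integral {0..pi} ?a = ?p *\<^sub>R integral {0..pi} (\<lambda>t. (cos (?p * tau E L t) * phase_rate E L t) *\<^sub>R V (rad E L t))"
    unfolding scaleR_scaleR[symmetric] integral_cmul ..
  moreover have "fourier_coeff V m E L = 2 * integral {0..pi} (\<lambda>t. (cos (?p * tau E L t) * phase_rate E L t) *\<^sub>R V (rad E L t))"
    using fourier_coeff_eq[OF d continuous_on_subset[OF VD(4) sub]] .
  ultimately have "integral {0..pi} ?b = - ((pi * of_int m) *\<^sub>R fourier_coeff V m E L)"
    by (simp add: scaleR_conv_of_real eq_neg_iff_add_eq_0 mult_ac)
  then have 1: "norm (integral {0..pi} ?b) = pi * \<bar>m\<bar> * norm (fourier_coeff V m E L)"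
    by (simp add: abs_mult)
  have ph: "phase_rate E L t \<noteq> 0" for t using phase_rate_pos[OF d, of t] by simp
  have "sine_coeff V E L (nat \<bar>m\<bar>) = integral {0..pi} (\<lambda>t. of_int (sgn m) *\<^sub>R ?b t)"
    unfolding sine_coeff_def
  proof (rule Henstock_Kurzweil_Integration.integral_cong)
    fix t
    have "sin (2 * pi * real (nat \<bar>m\<bar>) * tau E L t) = of_int (sgn m) * sin (?p * tau E L t)"
      using m by (cases "0 < m") (auto simp: sgn_if)
    then show "(sin (2 * pi * real (nat \<bar>m\<bar>) * tau E L t) * phase_rate E L t) *\<^sub>R
       (((r_plus E L - r_minus E L) / 2 * sin t / phase_rate E L t) *\<^sub>R dV V (rad E L t)) = of_int (sgn m) *\<^sub>R ?b t"
      using ph[of t] by (simp add: c_def)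
  qed
  also have "\<dots> = of_int (sgn m) *\<^sub>R integral {0..pi} ?b"
    by (rule integral_cmul)
  finally have "norm (sine_coeff V E L (nat \<bar>m\<bar>)) = norm (integral {0..pi} ?b)"
    using m by (simp add: sgn_if)
  then show ?thesis using 1 m by simp
qed

text \<open>A bound for |dr/dtheta|: amplitude at most B, times the bound on the period, over the
  lower bound of \<open>speed\<close>.\<close>

definition fourier_const :: real where
  "fourier_const = B * (2 * (pi * (B / sqrt (- \<kappa> / 2)))) / (A / sqrt (2 * M / A - \<kappa>))"

lemma speed_bounds:
  assumes R: "0 < R" and x: "(E, L) \<in> D R"
  shows "A / sqrt (2 * M / A - \<kappa>) \<le> speed E L t" "speed E L t \<le> B / sqrt (- \<kappa> / 2)"
proof -
  note d = D_dom[OF R x]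
  note orb = D_orbit[OF R x]
  note rr = rad_range[OF d, of t]
  have "0 \<le> L / (2 * R\<^sup>2)" using d by (auto simp: dom_def)
  moreover have "M / R \<le> M / A" using orb params A_pos by (intro divide_left_mono) auto
  ultimately have "U 0 - M / A \<le> E"
    using x U_bounds(1)[OF R] by (auto simp: D_def Psi_def)
  then have "gap E L t \<le> 2 * M / A - \<kappa>"
    using gap_bounds(2)[OF d, of t] small(1) params by simp
  then show "A / sqrt (2 * M / A - \<kappa>) \<le> speed E L t"
    unfolding speed_def using orb rr A_pos gap_bounds(3)[OF d, of t] by (intro frac_le) auto
  show "speed E L t \<le> B / sqrt (- \<kappa> / 2)"
    unfolding speed_def using orb rr B_pos gap_bounds(1)[OF d, of t] params
    by (intro frac_le real_sqrt_le_mono) auto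
qed

lemma clock_bounds:
  assumes R: "0 < R" and x: "(E, L) \<in> D R"
  shows "clock E L pi \<le> pi * (B / sqrt (- \<kappa> / 2))"
proof -
  have "integral {0..pi} (speed E L) \<le> integral {0..pi} (\<lambda>_. B / sqrt (- \<kappa> / 2))"
    using speed_bounds(2)[OF R x]
    by (intro integral_le integrable_continuous_real continuous_speed[OF D_dom[OF R x]]) auto
  then show ?thesis by (simp add: clock_def mult.commute)
qed

lemma fourier_const_nonneg: "0 \<le> fourier_const"
proof -
  have "0 \<le> 2 * M / A" using A_pos params by simp
  then have "0 \<le> 2 * M / A - \<kappa>" using params by simp
  then show ?thesis
    unfolding fourier_const_def using A_pos B_pos params
    by (intro divide_nonneg_nonneg mult_nonneg_nonneg) auto
qed

text \<open>Cauchy-Schwarz between 1/n and the sine coefficients, whose squares are summable by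
  Bessel's inequality. The positive and the negative m each contribute half of the bound.\<close>

lemma fourier_coeff_sum_bound:
  assumes R: "0 < R" and x: "(E, L) \<in> D R" and V: "V \<in> C1 R_min R_max"
    and X: "finite X" "(0::int) \<notin> X"
  shows "(\<Sum>m\<in>X. norm (fourier_coeff V m E L)) \<le> fourier_const * C1_norm R_min R_max V"
proof -
  note d = D_dom[OF R x]
  note orb = D_orbit[OF R x]
  note VD = C1D[OF V R_min_max(3)]
  have inR: "rad E L t \<in> {R_min..R_max}" for t using rad_range[OF d, of t] orb by auto
  define G where "G t = ((r_plus E L - r_minus E L) / 2 * sin t / phase_rate E L t) *\<^sub>R dV V (rad E L t)" for t
  define b where "b = fourier_const * C1_norm R_min R_max V"
  have b: "0 \<le> b" using fourier_const_nonneg C1_norm_nonneg[OF V R_min_max(3)] by (simp add: b_def)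
  have Gc: "continuous_on {0..pi} G"
    unfolding G_def dV_def using inR phase_rate_pos[OF d]
    by (intro continuous_intros continuous_phase_rate[OF d] continuous_on_compose2[OF VD(3) continuous_rad])
       (auto simp: less_imp_neq[symmetric])
  have Gb: "norm (G t) \<le> b" for t
  proof -
    let ?sm = "A / sqrt (2 * M / A - \<kappa>)" and ?T = "2 * (pi * (B / sqrt (- \<kappa> / 2)))"
    have "0 < 2 * M / A" using A_pos params by simp
    then have "0 < 2 * M / A - \<kappa>" using params by simp
    then have sm: "0 < ?sm" using A_pos by simp
    have "0 < ?T" using B_pos params by auto
    define k where "k = ?sm / ?T"
    have k: "0 < k" unfolding k_def using sm \<open>0 < ?T\<close> by (rule divide_pos_pos)
    have "k \<le> phase_rate E L t"
      unfolding k_def phase_rate_def using speed_bounds(1)[OF R x, of t] clock_bounds[OF R x] clock_pi_pos[OF d] sm speed_pos[OF d, of t]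
      by (intro frac_le) auto
    moreover have "\<bar>(r_plus E L - r_minus E L) / 2 * sin t\<bar> \<le> B * 1"
      unfolding abs_mult using orb turning_points(1,2)[OF d] A_pos by (intro mult_mono) auto
    ultimately have "\<bar>(r_plus E L - r_minus E L) / 2 * sin t / phase_rate E L t\<bar> \<le> B * 1 / k"
      unfolding abs_divide using k B_pos phase_rate_pos[OF d, of t]
      by (intro frac_le) auto
    also have "\<dots> = fourier_const" by (simp add: fourier_const_def k_def mult_ac)
    finally have "norm (G t) \<le> fourier_const * norm (dV V (rad E L t))"
      unfolding G_def norm_scaleR by (intro mult_right_mono) auto
    also have "\<dots> \<le> b"
      unfolding b_def dV_def using C1_norm_bounds(2)[OF V R_min_max(3) inR] fourier_const_nonneg
      by (intro mult_left_mono) auto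
    finally show ?thesis .
  qed
  have nat_bound: "(\<Sum>n\<in>N. norm (sine_coeff V E L n) / (pi * real n)) \<le> b / 2" if N: "finite N" "0 \<notin> N" for N
  proof -
    have "(\<Sum>n\<in>N. (norm (sine_coeff V E L n))\<^sup>2) \<le> b\<^sup>2 / 8"
      unfolding sine_coeff_def G_def[symmetric]
      using tau_vector_derivative[OF d] tau_pi[OF d] Gc Gb N phase_rate_pos[OF d]
      by (intro Bessel_sine[where a = 0 and b = pi and \<tau> = "tau E L" and \<tau>' = "phase_rate E L"] continuous_phase_rate[OF d])
        (auto simp: phase_rate_def[abs_def] intro: less_imp_le)
    from sum_mult_le_sqrt[OF sum_inverse_squares_bounded[OF N] this]
    have "(\<Sum>n\<in>N. 1 / real n * norm (sine_coeff V E L n)) \<le> sqrt (2 * (b\<^sup>2 / 8))"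
      by (simp only: real_sqrt_mult)
    also have "2 * (b\<^sup>2 / 8) = (b / 2)\<^sup>2" by (simp add: power2_eq_square)
    also have "sqrt ((b / 2)\<^sup>2) = b / 2" using b by simp
    finally have *: "(\<Sum>n\<in>N. 1 / real n * norm (sine_coeff V E L n)) \<le> b / 2" .
    \<comment> \<open>The gain 1 / pi is given away here, which keeps the final constant free of
      it.\<close>
    have "(\<Sum>n\<in>N. norm (sine_coeff V E L n) / (pi * real n)) \<le> (\<Sum>n\<in>N. 1 / real n * norm (sine_coeff V E L n))"
    proof (rule sum_mono)
      fix n assume "n \<in> N"
      then have "0 < real n" using N by (cases n) auto
      moreover have "1 \<le> pi" using pi_gt3 by simp
      ultimately have "real n \<le> pi * real n" by simp
      then have "norm (sine_coeff V E L n) / (pi * real n) \<le> norm (sine_coeff V E L n) / real n"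
        using \<open>0 < real n\<close> by (intro divide_left_mono) auto
      then show "norm (sine_coeff V E L n) / (pi * real n) \<le> 1 / real n * norm (sine_coeff V E L n)" by simp
    qed
    with * show ?thesis by linarith
  qed
  have "(\<Sum>m\<in>X. norm (fourier_coeff V m E L)) = (\<Sum>m\<in>X. norm (sine_coeff V E L (nat \<bar>m\<bar>)) / (pi * real (nat \<bar>m\<bar>)))"
    using X by (intro sum.cong refl, subst fourier_coeff_by_parts[OF R x V]) auto
  also have "\<dots> \<le> 2 * (b / 2)"
    by (rule sum_int_le_sum_nat[OF X nat_bound])
  finally show ?thesis by (simp add: b_def)
qed

end

subsection \<open>Differentiability of the turning points\<close>

context near_kepler
begin

definition dPsi :: "real \<Rightarrow> real \<Rightarrow> real" where
  "dPsi L r = Y1 r / r\<^sup>2 - 2 * Y r / r ^ 3 + M / r\<^sup>2 - L / r ^ 3"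

lemma Psi_DERIV:
  assumes "0 < r"
  shows "(Psi L has_real_derivative dPsi L r) (at r)"
proof -
  have "((\<lambda>r. U 0 + Y r / r\<^sup>2 - M / r + L / (2 * r\<^sup>2)) has_real_derivative dPsi L r) (at r)"
    unfolding dPsi_def using assms
    by (auto intro!: derivative_eq_intros Y_DERIV simp: field_simps power2_eq_square power3_eq_cube)
  then show ?thesis
    by (rule has_field_derivative_transform_within_open[OF _ open_greaterThan[of 0]])
      (use assms in \<open>auto simp: Psi_def Y_def\<close>)
qed

text \<open>At a root, 2 r^2 dPsi is minus the derivative of W, and splitting off the other root
  evaluates it. The formula exhibits the factor r_plus - r_minus, which degenerates at circular
  orbits and must later be compensated by the numerator.\<close>

lemma turning_points_dPsi:
  assumes d: "(E, L) \<in> dom"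
  shows "dPsi L (r_minus E L) = - ((r_plus E L - r_minus E L) * gap E L 0 / (2 * (r_minus E L)\<^sup>2))"
    and "dPsi L (r_plus E L) = (r_plus E L - r_minus E L) * gap E L pi / (2 * (r_plus E L)\<^sup>2)"
proof -
  note tp = turning_points[OF d]
  \<comment> \<open>The two equations W = 0 at r and at s eliminate L and the values of Y, up to a
    factor r that is cancelled at the end.\<close>
  have key: "2 * r\<^sup>2 * dPsi L r = (r - s) * (- 2 * (E - U 0) + 2 * I s r)"
    if rs: "0 < r" "0 < s" "r \<noteq> s" and Wr: "W E L r = 0" and Ws: "W E L s = 0" for r s
  proof -
    define i where "i = I s r"
    have i: "i * (r - s)\<^sup>2 = (r - s) * Y1 r - (Y r - Y s)" unfolding i_def using rs by (intro I_eq)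
    have e: "2 * r\<^sup>2 * dPsi L r * r = 2 * Y1 r * r - 4 * Y r + 2 * M * r - 2 * L"
      using rs by (simp add: dPsi_def field_simps power2_eq_square power3_eq_cube)
    have w: "2 * (E - U 0) * r\<^sup>2 + 2 * M * r - L - 2 * Y r = 0" "2 * (E - U 0) * s\<^sup>2 + 2 * M * s - L - 2 * Y s = 0"
      using Wr Ws by (auto simp: W_def)
    have "(2 * r\<^sup>2 * dPsi L r * r) * (r - s) = ((r - s) * (- 2 * (E - U 0) + 2 * i) * r) * (r - s)"
      unfolding e using i w by algebra
    then show ?thesis using rs by (simp add: i_def)
  qed
  have W0: "W E L (r_minus E L) = 0" "W E L (r_plus E L) = 0" using tp by (auto simp: W_zero_iff)
  have "2 * (r_minus E L)\<^sup>2 * dPsi L (r_minus E L) = - ((r_plus E L - r_minus E L) * gap E L 0)"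
    using key[of "r_minus E L" "r_plus E L"] tp W0 by (simp add: gap_def algebra_simps)
  then show "dPsi L (r_minus E L) = - ((r_plus E L - r_minus E L) * gap E L 0 / (2 * (r_minus E L)\<^sup>2))"
    using tp by (simp add: field_simps)
  have "2 * (r_plus E L)\<^sup>2 * dPsi L (r_plus E L) = (r_plus E L - r_minus E L) * gap E L pi"
    using key[of "r_plus E L" "r_minus E L"] tp W0 by (simp add: gap_def algebra_simps)
  then show "dPsi L (r_plus E L) = (r_plus E L - r_minus E L) * gap E L pi / (2 * (r_plus E L)\<^sup>2)"
    using tp by (simp add: field_simps)
qed

lemma turning_points_dPsi_sign:
  assumes d: "(E, L) \<in> dom"
  shows "dPsi L (r_minus E L) < 0" "0 < dPsi L (r_plus E L)"
  unfolding turning_points_dPsi[OF d]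
  using turning_points(1,2)[OF d] gap_bounds(3)[OF d] by auto

lemma continuous_Y: "continuous_on {0<..} Y"
  using Y_DERIV DERIV_isCont by (auto intro!: continuous_at_imp_continuous_on)

lemma continuous_Psi_joint: "continuous_on ({0<..} \<times> UNIV) (\<lambda>z. Psi (snd z) (fst z))"
proof -
  have "continuous_on ({0<..} \<times> UNIV) (\<lambda>z. Psi 0 (fst z) + snd z / (2 * (fst z)\<^sup>2) :: real)"
    by (intro continuous_intros continuous_on_compose2[OF continuous_Psi]) auto
  then show ?thesis by (rule continuous_on_eq) (auto simp: Psi_def)
qed

lemma continuous_dPsi_joint: "continuous_on ({0<..} \<times> UNIV) (\<lambda>z. dPsi (snd z) (fst z))"
  unfolding dPsi_def
  by (intro continuous_intros continuous_on_compose2[OF continuous_Y] continuous_on_compose2[OF continuous_Y1]) auto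

lemma open_positive_preimage:
  assumes "continuous_on ({0<..} \<times> UNIV) f"
  shows "open {z :: real \<times> real. 0 < fst z \<and> f z < (c :: real)}"
proof -
  have "open (({0<..} \<times> UNIV) \<inter> f -` {..<c})"
    by (rule continuous_open_preimage[OF assms]) (auto intro!: open_Times)
  moreover have "({0<..} \<times> UNIV) \<inter> f -` {..<c} = {z. 0 < fst z \<and> f z < c}" by auto
  ultimately show ?thesis by simp
qed

lemma open_dom: "open dom"
proof -
  have eq: "dom = (\<Union>r\<in>{0<..}. {z. 0 < snd z} \<inter> {z. fst z < U 0 + \<kappa> / 2} \<inter> {z. Psi (snd z) r < fst z})"
    by (auto simp: dom_def)
  have "open ({z. 0 < snd z} \<inter> {z. fst z < U 0 + \<kappa> / 2} \<inter> {z :: real \<times> real. Psi (snd z) r < fst z})" if "0 < r" for r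
    unfolding Psi_def using that by (intro open_Int open_Collect_less continuous_intros) auto
  then show ?thesis unfolding eq by (intro open_UN ballI) simp
qed

lemma Psi_joint_derivative:
  assumes "0 < r"
  shows "((\<lambda>z. (Psi (snd z) (fst z), snd z)) has_derivative (\<lambda>h. (dPsi L r * fst h + snd h / (2 * r\<^sup>2), snd h))) (at (r, L))"
proof -
  have 1: "((\<lambda>z. Psi 0 (fst z)) has_derivative (\<lambda>h. dPsi 0 r * fst h)) (at (r, L))"
  proof -
    have "(Psi 0 has_derivative (\<lambda>h. dPsi 0 r * h)) (at (fst (r, L)))"
      using Psi_DERIV[OF assms, of 0] by (simp add: has_field_derivative_def)
    from has_derivative_compose[OF has_derivative_fst[OF has_derivative_ident] this] show ?thesis by simp
  qed
  have 2: "((\<lambda>z. snd z / (2 * (fst z)\<^sup>2)) has_derivative (\<lambda>h. snd h / (2 * r\<^sup>2) - L / r ^ 3 * fst h)) (at (r, L))"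
    using assms by (auto intro!: derivative_eq_intros simp: field_simps power2_eq_square power3_eq_cube)
  have "((\<lambda>z. (Psi 0 (fst z) + snd z / (2 * (fst z)\<^sup>2), snd z)) has_derivative
      (\<lambda>h. (dPsi 0 r * fst h + (snd h / (2 * r\<^sup>2) - L / r ^ 3 * fst h), snd h))) (at (r, L))"
    by (intro has_derivative_Pair has_derivative_add 1 2 has_derivative_snd has_derivative_ident)
  moreover have "dPsi 0 r * h - L / r ^ 3 * h = dPsi L r * h" for h
    by (simp add: dPsi_def algebra_simps)
  moreover have "(\<lambda>z. (Psi 0 (fst z) + snd z / (2 * (fst z)\<^sup>2), snd z)) = (\<lambda>z. (Psi (snd z) (fst z), snd z))"
    by (auto simp: Psi_def)
  ultimately show ?thesis by (simp add: algebra_simps)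
qed

text \<open>Implicit differentiation of Psi L r = E with respect to (E, L).\<close>

definition root_deriv :: "real \<Rightarrow> real \<Rightarrow> real \<times> real \<Rightarrow> real" where
  "root_deriv L r h = (fst h - snd h / (2 * r\<^sup>2)) / dPsi L r"

text \<open>The map (r, L) to (Psi L r, L) has an invertible differential where dPsi is nonzero, and
  its inverse is (E, L) to (rho E L, L). The inverse function theorem applies because rho recovers r
  on a whole neighbourhood.\<close>

lemma root_has_derivative:
  assumes X: "open X" "(r, L) \<in> X" "X \<subseteq> {0<..} \<times> UNIV"
    and inv: "\<And>z. z \<in> X \<Longrightarrow> \<rho> (Psi (snd z) (fst z)) (snd z) = fst z"
    and nz: "dPsi L r \<noteq> 0"
  shows "((\<lambda>z. \<rho> (fst z) (snd z)) has_derivative root_deriv L r) (at (Psi L r, L))"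
proof -
  have r: "0 < r" using X by auto
  have "((\<lambda>z. (\<rho> (fst z) (snd z), snd z)) has_derivative (\<lambda>h. (root_deriv L r h, snd h)))
      (at ((\<lambda>z. (Psi (snd z) (fst z), snd z)) (r, L)))"
  proof (rule has_derivative_inverse_strong[OF X(1,2) _ _ Psi_joint_derivative[OF r]])
    show "continuous_on X (\<lambda>z. (Psi (snd z) (fst z), snd z))"
      by (intro continuous_intros continuous_on_subset[OF continuous_Psi_joint X(3)])
    show "(\<rho> (fst (Psi (snd z) (fst z), snd z)) (snd (Psi (snd z) (fst z), snd z)), snd (Psi (snd z) (fst z), snd z)) = z"
      if "z \<in> X" for z
      using inv[OF that] by simp
    show "(\<lambda>h. (dPsi L r * fst h + snd h / (2 * r\<^sup>2), snd h)) \<circ> (\<lambda>h. (root_deriv L r h, snd h)) = id"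
      using nz by (auto simp: fun_eq_iff root_deriv_def)
  qed
  from has_derivative_fst[OF this] show ?thesis by simp
qed

lemma r_minus_derivative:
  assumes d: "(E, L) \<in> dom"
  shows "((\<lambda>z. r_minus (fst z) (snd z)) has_derivative root_deriv L (r_minus E L)) (at (E, L))"
proof -
  note tp = turning_points[OF d]
  \<comment> \<open>A negative slope of Psi distinguishes the inner turning point from the outer
    one, so on this open set \<open>r_minus\<close> recovers the radius from its energy.\<close>
  define X where "X = {z. 0 < fst z \<and> Psi (snd z) (fst z) < U 0 + \<kappa> / 2} \<inter> {z. 0 < fst z \<and> dPsi (snd z) (fst z) < 0} \<inter> {z. 0 < snd z}"
  have X: "open X" unfolding X_def
    by (intro open_Int open_positive_preimage continuous_Psi_joint continuous_dPsi_joint open_Collect_less continuous_intros)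
  have mem: "(r_minus E L, L) \<in> X"
    using d tp(1-4) turning_points_dPsi_sign[OF d] unfolding X_def dom_def by simp
  have inv: "r_minus (Psi (snd z) (fst z)) (snd z) = fst z" if z: "z \<in> X" for z
  proof -
    obtain r l where rl: "z = (r, l)" by (cases z)
    have r: "0 < r" "Psi l r < U 0 + \<kappa> / 2" "dPsi l r < 0" "0 < l" using z by (auto simp: rl X_def)
    obtain e where e: "0 < e" "\<And>h. 0 < h \<Longrightarrow> h < e \<Longrightarrow> Psi l (r + h) < Psi l r"
      using DERIV_neg_dec_right[OF Psi_DERIV[OF r(1)] r(3)] by auto
    obtain e' where e': "0 < e'" "\<And>h. 0 < h \<Longrightarrow> h < e' \<Longrightarrow> Psi l r < Psi l (r - h)"
      using DERIV_neg_dec_left[OF Psi_DERIV[OF r(1)] r(3)] by auto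
    \<comment> \<open>A small step outwards lowers Psi, so the level Psi l r is not minimal and the
      pair belongs to \<open>dom\<close>.\<close>
    have dd: "(Psi l r, l) \<in> dom"
      unfolding dom_def using r e(2)[of "e / 2"] e(1) by (auto intro!: exI[of _ "r + e / 2"])
    note tp' = turning_points[OF dd]
    have "r = r_minus (Psi l r) l \<or> r = r_plus (Psi l r) l" using tp'(6)[OF r(1)] by simp
    \<comment> \<open>Just inside an outer turning point Psi would be below the level, whereas the
      negative slope puts it above.\<close>
    moreover have "r \<noteq> r_plus (Psi l r) l"
    proof
      assume rp: "r = r_plus (Psi l r) l"
      define h where "h = min (e' / 2) ((r - r_minus (Psi l r) l) / 2)"
      have lt: "r_minus (Psi l r) l < r" using tp'(2) rp by (metis (no_types))
      then have h0: "0 < h" unfolding h_def using e'(1) by simp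
      have "h \<le> e' / 2" "h \<le> (r - r_minus (Psi l r) l) / 2" unfolding h_def by (rule min.cobounded1, rule min.cobounded2)
      moreover have "p < r - h" if "h \<le> (r - p) / 2" "p < r" for p :: real
        using that by (simp add: field_simps)
      ultimately have h: "0 < h" "h < e'" "r_minus (Psi l r) l < r - h" using e'(1) h0 lt by auto
      have "0 < r - h" using h(3) tp'(1) by simp
      moreover have "r - h < r_plus (Psi l r) l" using h(1) by (subst rp[symmetric]) simp
      ultimately have "Psi l (r - h) < Psi l r" using tp'(5) h(3) by blast
      then show False using e'(2)[OF h(1,2)] by simp
    qed
    ultimately show ?thesis by (simp add: rl)
  qed
  have "X \<subseteq> {0<..} \<times> UNIV" by (auto simp: X_def)
  from root_has_derivative[OF X mem this inv] turning_points_dPsi_sign[OF d] tp(3)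
  show ?thesis by simp
qed

lemma r_plus_derivative:
  assumes d: "(E, L) \<in> dom"
  shows "((\<lambda>z. r_plus (fst z) (snd z)) has_derivative root_deriv L (r_plus E L)) (at (E, L))"
proof -
  note tp = turning_points[OF d]
  define X where "X = {z. 0 < fst z \<and> Psi (snd z) (fst z) < U 0 + \<kappa> / 2} \<inter> {z. 0 < fst z \<and> - dPsi (snd z) (fst z) < 0} \<inter> {z. 0 < snd z}"
  have X: "open X" unfolding X_def
    by (intro open_Int open_positive_preimage continuous_Psi_joint continuous_on_minus continuous_dPsi_joint open_Collect_less continuous_intros)
  have mem: "(r_plus E L, L) \<in> X"
    using d tp(1-4) turning_points_dPsi_sign[OF d] unfolding X_def dom_def by simp
  have inv: "r_plus (Psi (snd z) (fst z)) (snd z) = fst z" if z: "z \<in> X" for z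
  proof -
    obtain r l where rl: "z = (r, l)" by (cases z)
    have r: "0 < r" "Psi l r < U 0 + \<kappa> / 2" "0 < dPsi l r" "0 < l" using z by (auto simp: rl X_def)
    obtain e where e: "0 < e" "\<And>h. 0 < h \<Longrightarrow> h < e \<Longrightarrow> Psi l (r - h) < Psi l r"
      using DERIV_pos_inc_left[OF Psi_DERIV[OF r(1)] r(3)] by auto
    obtain e' where e': "0 < e'" "\<And>h. 0 < h \<Longrightarrow> h < e' \<Longrightarrow> Psi l r < Psi l (r + h)"
      using DERIV_pos_inc_right[OF Psi_DERIV[OF r(1)] r(3)] by auto
    define k where "k = min (e / 2) (r / 2)"
    have k: "0 < k" "k < e" "0 < r - k" using e r by (auto simp: k_def min_def)
    have dd: "(Psi l r, l) \<in> dom"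
      unfolding dom_def using r e(2)[OF k(1,2)] k by (auto intro!: exI[of _ "r - k"])
    note tp' = turning_points[OF dd]
    have "r = r_minus (Psi l r) l \<or> r = r_plus (Psi l r) l" using tp'(6)[OF r(1)] by simp
    moreover have "r \<noteq> r_minus (Psi l r) l"
    proof
      assume rp: "r = r_minus (Psi l r) l"
      define h where "h = min (e' / 2) ((r_plus (Psi l r) l - r) / 2)"
      have lt: "r < r_plus (Psi l r) l" using tp'(2) rp by (metis (no_types))
      then have h0: "0 < h" unfolding h_def using e'(1) by simp
      have "h \<le> e' / 2" "h \<le> (r_plus (Psi l r) l - r) / 2" unfolding h_def by (rule min.cobounded1, rule min.cobounded2)
      moreover have "r + h < p" if "h \<le> (p - r) / 2" "r < p" for p :: real
        using that by (simp add: field_simps)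
      ultimately have h: "0 < h" "h < e'" "r + h < r_plus (Psi l r) l" using e'(1) h0 lt by auto
      have "0 < r + h" using h(1) r(1) by simp
      moreover have "r_minus (Psi l r) l < r + h" using h(1) by (subst rp[symmetric]) simp
      ultimately have "Psi l (r + h) < Psi l r" using tp'(5) h(3) by blast
      then show False using e'(2)[OF h(1,2)] by simp
    qed
    ultimately show ?thesis by (simp add: rl)
  qed
  have "X \<subseteq> {0<..} \<times> UNIV" by (auto simp: X_def)
  from root_has_derivative[OF X mem this inv] turning_points_dPsi_sign[OF d] tp(4)
  show ?thesis by simp
qed

lemma continuous_roots:
  "continuous_on dom (\<lambda>z. r_minus (fst z) (snd z))" "continuous_on dom (\<lambda>z. r_plus (fst z) (snd z))"
  using has_derivative_continuous[OF r_minus_derivative] has_derivative_continuous[OF r_plus_derivative]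
  by (auto intro!: continuous_at_imp_continuous_on)

text \<open>\<open>Ia\<close> and \<open>Ir\<close> are the partial derivatives of \<open>I\<close>
  in its first and second argument, obtained under the integral sign.\<close>

definition Ia :: "real \<Rightarrow> real \<Rightarrow> real" where
  "Ia a r = integral {0..1} (\<lambda>t. t * (1 - t) * Y3 (a + t * (r - a)))"
definition Ir :: "real \<Rightarrow> real \<Rightarrow> real" where
  "Ir a r = integral {0..1} (\<lambda>t. t * t * Y3 (a + t * (r - a)))"

lemma Ia_bound: "0 < a \<Longrightarrow> 0 < r \<Longrightarrow> \<bar>Ia a r\<bar> \<le> \<delta>"
  and Ir_bound: "0 < a \<Longrightarrow> 0 < r \<Longrightarrow> \<bar>Ir a r\<bar> \<le> \<delta>"
  unfolding Ia_def Ir_def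
  by (rule integral_weight_bound; auto intro!: continuous_intros continuous_on_segment Y3_cont Y_bounds segment_pos
      simp: abs_mult mult_le_one)+

lemma continuous_segment_joint:
  fixes g :: "real \<Rightarrow> real"
  assumes "continuous_on {0<..} f" "continuous_on UNIV g"
  shows "continuous_on (({0<..} \<times> {0<..}) \<times> {0..1}) (\<lambda>(z, t). g t * f (fst z + t * (snd z - fst z)) :: real)"
proof -
  have "continuous_on (({0<..} \<times> {0<..}) \<times> {0..1}) (\<lambda>y. g (snd y) * f (fst (fst y) + snd y * (snd (fst y) - fst (fst y))))"
    using segment_pos
    by (intro continuous_intros continuous_on_compose2[OF assms(1)] continuous_on_compose2[OF assms(2)]) auto
  then show ?thesis by (simp add: split_beta)
qed

lemma continuous_I_joint:
  "continuous_on ({0<..} \<times> {0<..}) (\<lambda>z. I (fst z) (snd z))"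
  "continuous_on ({0<..} \<times> {0<..}) (\<lambda>z. Ia (fst z) (snd z))"
  "continuous_on ({0<..} \<times> {0<..}) (\<lambda>z. Ir (fst z) (snd z))"
proof -
  have *: "continuous_on ({0<..} \<times> {0<..}) (\<lambda>z. integral {0..1} (\<lambda>t. g t * f (fst z + t * (snd z - fst z))))"
    if "continuous_on {0<..} f" "continuous_on UNIV g" for f g :: "real \<Rightarrow> real"
    using integral_continuous_on_param[of "{0<..} \<times> {0<..}" 0 1 "\<lambda>z t. g t * f (fst z + t * (snd z - fst z))"]
      continuous_segment_joint[OF that] by simp
  show "continuous_on ({0<..} \<times> {0<..}) (\<lambda>z. I (fst z) (snd z))"
    "continuous_on ({0<..} \<times> {0<..}) (\<lambda>z. Ia (fst z) (snd z))"
    "continuous_on ({0<..} \<times> {0<..}) (\<lambda>z. Ir (fst z) (snd z))"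
    unfolding I_def Ia_def Ir_def
    by (intro * continuous_Y2 Y3_cont continuous_intros)+
qed

lemma I_has_derivative:
  assumes "0 < a" "0 < r"
  shows "((\<lambda>z. I (fst z) (snd z)) has_derivative (\<lambda>h. Ia a r * fst h + Ir a r * snd h)) (at (a, r))"
proof -
  let ?U = "{0<..} \<times> {0<..} :: (real \<times> real) set"
  have "((\<lambda>z. integral {0..1} (\<lambda>t. t * Y2 (fst z + t * (snd z - fst z)))) has_derivative
     (\<lambda>h. integral {0..1} (\<lambda>t. t * (1 - t) * Y3 (fst (a, r) + t * (snd (a, r) - fst (a, r)))) * fst h +
       integral {0..1} (\<lambda>t. t * t * Y3 (fst (a, r) + t * (snd (a, r) - fst (a, r)))) * snd h)) (at (a, r))"
  proof (rule has_derivative_integral_param_pair[where U = ?U])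
    show "open ?U" by (intro open_Times) auto
    show "(a, r) \<in> ?U" using assms by simp
    show "((\<lambda>z. t * Y2 (fst z + t * (snd z - fst z))) has_derivative
        (\<lambda>h. t * (1 - t) * Y3 (fst z + t * (snd z - fst z)) * fst h + t * t * Y3 (fst z + t * (snd z - fst z)) * snd h)) (at z)"
      if z: "z \<in> ?U" "t \<in> {0..1}" for z t
    proof -
      have p: "0 < fst z + t * (snd z - fst z)" using z segment_pos by auto
      have "(Y2 has_derivative (\<lambda>h. Y3 (fst z + t * (snd z - fst z)) * h)) (at (fst z + t * (snd z - fst z)))"
        using Y_deriv(3)[OF p] by (simp add: has_field_derivative_def)
      moreover have "((\<lambda>z. fst z + t * (snd z - fst z)) has_derivative (\<lambda>h. fst h + t * (snd h - fst h))) (at z)"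
        by (auto intro!: derivative_eq_intros)
      ultimately have "((\<lambda>z. Y2 (fst z + t * (snd z - fst z))) has_derivative
          (\<lambda>h. Y3 (fst z + t * (snd z - fst z)) * (fst h + t * (snd h - fst h)))) (at z)"
        by (rule has_derivative_compose[rotated])
      from has_derivative_mult_right[OF this, of t] show ?thesis
        by (simp add: algebra_simps)
    qed
    show "continuous_on {0..1} (\<lambda>t. t * Y2 (fst z + t * (snd z - fst z)))" if "z \<in> ?U" for z
      using that by (intro continuous_intros continuous_on_segment continuous_Y2) auto
    show "continuous_on (?U \<times> {0..1}) (\<lambda>(z, t). t * (1 - t) * Y3 (fst z + t * (snd z - fst z)))"
      "continuous_on (?U \<times> {0..1}) (\<lambda>(z, t). t * t * Y3 (fst z + t * (snd z - fst z)))"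
      by (intro continuous_segment_joint Y3_cont continuous_intros)+
  qed
  then show ?thesis by (simp add: I_def Ia_def Ir_def)
qed

end

subsection \<open>Differentiability and monotonicity of the frequency\<close>

context near_kepler
begin

text \<open>The suffix \<open>_d\<close> marks differentials in (E, L) at fixed anomaly x, applied
  to the direction h = (dE, dL).\<close>

definition rad_d :: "real \<Rightarrow> real \<Rightarrow> real \<Rightarrow> real \<times> real \<Rightarrow> real" where
  "rad_d E L x h = root_deriv L (r_minus E L) h * ((1 + cos x) / 2) + root_deriv L (r_plus E L) h * ((1 - cos x) / 2)"

definition gap_d :: "real \<Rightarrow> real \<Rightarrow> real \<Rightarrow> real \<times> real \<Rightarrow> real" where
  "gap_d E L x h = - 2 * fst h + 2 * (
      (1 - cos x) / 2 * (Ia (r_minus E L) (rad E L x) * root_deriv L (r_minus E L) h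
        + Ir (r_minus E L) (rad E L x) * rad_d E L x h)
    + (1 + cos x) / 2 * (Ia (r_plus E L) (rad E L x) * root_deriv L (r_plus E L) h
        + Ir (r_plus E L) (rad E L x) * rad_d E L x h))"

definition speed_d :: "real \<Rightarrow> real \<Rightarrow> real \<Rightarrow> real \<times> real \<Rightarrow> real" where
  "speed_d E L x h = rad_d E L x h / sqrt (gap E L x)
     - rad E L x * gap_d E L x h / (2 * gap E L x * sqrt (gap E L x))"

definition clock_d :: "real \<Rightarrow> real \<Rightarrow> real \<times> real \<Rightarrow> real" where
  "clock_d E L h = integral {0..pi} (\<lambda>x. speed_d E L x h)"

definition omega_d :: "real \<Rightarrow> real \<Rightarrow> real \<times> real \<Rightarrow> real" where
  "omega_d E L h = - (clock_d E L h / (2 * (clock E L pi)\<^sup>2))"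

lemma root_deriv_linear: "root_deriv L r h = root_deriv L r (1, 0) * fst h + root_deriv L r (0, 1) * snd h"
  by (simp add: root_deriv_def diff_divide_distrib)

lemma rad_d_linear: "rad_d E L x h = rad_d E L x (1, 0) * fst h + rad_d E L x (0, 1) * snd h"
  unfolding rad_d_def by (subst (1 2) root_deriv_linear) (simp add: algebra_simps)

lemma gap_d_linear: "gap_d E L x h = gap_d E L x (1, 0) * fst h + gap_d E L x (0, 1) * snd h"
  unfolding gap_d_def by (subst (1 2) root_deriv_linear, subst (1 2) rad_d_linear) (simp add: algebra_simps)

lemma speed_d_linear: "speed_d E L x h = speed_d E L x (1, 0) * fst h + speed_d E L x (0, 1) * snd h"
  unfolding speed_d_def by (subst rad_d_linear, subst gap_d_linear) (simp add: algebra_simps add_divide_distrib)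

lemma rad_has_derivative:
  assumes "(E, L) \<in> dom"
  shows "((\<lambda>z. rad (fst z) (snd z) x) has_derivative rad_d E L x) (at (E, L))"
  unfolding rad_def rad_d_def
  by (intro has_derivative_add has_derivative_mult_left r_minus_derivative r_plus_derivative assms)

lemma I_rad_has_derivative:
  assumes a: "(a has_derivative a') (at z)" and r: "(r has_derivative r') (at z)" and pos: "0 < a z" "0 < r z"
  shows "((\<lambda>z. I (a z) (r z)) has_derivative (\<lambda>h. Ia (a z) (r z) * a' h + Ir (a z) (r z) * r' h)) (at z)"
proof -
  have "((\<lambda>z. (a z, r z)) has_derivative (\<lambda>h. (a' h, r' h))) (at z)"
    by (intro has_derivative_Pair a r)
  from has_derivative_compose[OF this I_has_derivative[OF pos]] show ?thesis by simp
qed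

lemma gap_has_derivative:
  assumes d: "(E, L) \<in> dom"
  shows "((\<lambda>z. gap (fst z) (snd z) x) has_derivative gap_d E L x) (at (E, L))"
proof -
  note tp = turning_points(1,2)[OF d]
  have 1: "((\<lambda>z. I (r_minus (fst z) (snd z)) (rad (fst z) (snd z) x)) has_derivative
     (\<lambda>h. Ia (r_minus E L) (rad E L x) * root_deriv L (r_minus E L) h + Ir (r_minus E L) (rad E L x) * rad_d E L x h)) (at (E, L))"
    using I_rad_has_derivative[OF r_minus_derivative[OF d] rad_has_derivative[OF d, of x]] tp rad_range(3)[OF d] by simp
  have 2: "((\<lambda>z. I (r_plus (fst z) (snd z)) (rad (fst z) (snd z) x)) has_derivative
     (\<lambda>h. Ia (r_plus E L) (rad E L x) * root_deriv L (r_plus E L) h + Ir (r_plus E L) (rad E L x) * rad_d E L x h)) (at (E, L))"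
    using I_rad_has_derivative[OF r_plus_derivative[OF d] rad_has_derivative[OF d, of x]] tp rad_range(3)[OF d] by simp
  have 3: "((\<lambda>z :: real \<times> real. - 2 * (fst z - U 0)) has_derivative (\<lambda>h. - 2 * fst h)) (at (E, L))"
    by (auto intro!: derivative_eq_intros)
  show ?thesis unfolding gap_def gap_d_def
    by (intro has_derivative_add has_derivative_mult_right 1 2 3)
qed

lemma speed_has_derivative:
  assumes d: "(E, L) \<in> dom"
  shows "((\<lambda>z. speed (fst z) (snd z) x) has_derivative speed_d E L x) (at (E, L))"
proof -
  note g = gap_bounds(3)[OF d, of x]
  have "(sqrt has_derivative (\<lambda>h. inverse (sqrt (gap E L x)) / 2 * h)) (at (gap E L x))"
    using DERIV_real_sqrt[OF g] by (simp only: has_field_derivative_def)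
  from has_derivative_compose[OF gap_has_derivative[OF d, of x], unfolded fst_conv snd_conv, OF this]
  have 1: "((\<lambda>z. sqrt (gap (fst z) (snd z) x)) has_derivative (\<lambda>h. inverse (sqrt (gap E L x)) / 2 * gap_d E L x h)) (at (E, L))" .
  have s: "sqrt (gap E L x) * sqrt (gap E L x) = gap E L x" "sqrt (gap E L x) \<noteq> 0" using g by auto
  have "((\<lambda>z. rad (fst z) (snd z) x / sqrt (gap (fst z) (snd z) x)) has_derivative
      (\<lambda>h. - rad E L x * (inverse (sqrt (gap E L x)) * (inverse (sqrt (gap E L x)) / 2 * gap_d E L x h) * inverse (sqrt (gap E L x)))
        + rad_d E L x h / sqrt (gap E L x))) (at (E, L))"
    using has_derivative_divide[OF rad_has_derivative[OF d, of x] 1] g by simp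
  moreover have "- a * (inverse s * (inverse s / 2 * b) * inverse s) + c / s = c / s - a * b / (2 * (s * s) * s)"
    if "s \<noteq> 0" for a b c s :: real using that by (simp add: field_simps)
  note this[OF s(2), unfolded s(1), of "rad E L x" "gap_d E L x h" "rad_d E L x h" for h, folded speed_d_def]
  ultimately show ?thesis
    unfolding speed_def by (simp only:)
qed

lemma continuous_dom_fst:
  assumes "continuous_on dom f"
  shows "continuous_on (dom \<times> X) (\<lambda>y. f (fst y))"
  by (rule continuous_on_compose2[OF assms]) (auto intro!: continuous_intros)

lemma continuous_rad_joint: "continuous_on (dom \<times> X) (\<lambda>y. rad (fst (fst y)) (snd (fst y)) (snd y))"
  unfolding rad_def by (intro continuous_intros continuous_dom_fst continuous_roots) auto

lemma dom_pos: "z \<in> dom \<Longrightarrow> 0 < r_minus (fst z) (snd z)" "z \<in> dom \<Longrightarrow> 0 < r_plus (fst z) (snd z)"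
    "z \<in> dom \<Longrightarrow> 0 < rad (fst z) (snd z) x"
  using turning_points(1,2)[of "fst z" "snd z"] rad_range(3)[of "fst z" "snd z" x] by auto

lemma continuous_pair_joint:
  fixes f :: "real \<Rightarrow> real \<Rightarrow> real"
  assumes "continuous_on ({0<..} \<times> {0<..}) (\<lambda>z. f (fst z) (snd z))"
  shows "continuous_on (dom \<times> X) (\<lambda>y. f (r_minus (fst (fst y)) (snd (fst y))) (rad (fst (fst y)) (snd (fst y)) (snd y)))"
    "continuous_on (dom \<times> X) (\<lambda>y. f (r_plus (fst (fst y)) (snd (fst y))) (rad (fst (fst y)) (snd (fst y)) (snd y)))"
proof -
  show "continuous_on (dom \<times> X) (\<lambda>y. f (r_minus (fst (fst y)) (snd (fst y))) (rad (fst (fst y)) (snd (fst y)) (snd y)))"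
    using continuous_on_compose2[OF assms continuous_on_Pair[OF continuous_dom_fst[OF continuous_roots(1)] continuous_rad_joint]]
      dom_pos by (auto simp: image_subset_iff)
  show "continuous_on (dom \<times> X) (\<lambda>y. f (r_plus (fst (fst y)) (snd (fst y))) (rad (fst (fst y)) (snd (fst y)) (snd y)))"
    using continuous_on_compose2[OF assms continuous_on_Pair[OF continuous_dom_fst[OF continuous_roots(2)] continuous_rad_joint]]
      dom_pos by (auto simp: image_subset_iff)
qed

lemma continuous_root_deriv:
  "continuous_on dom (\<lambda>z. root_deriv (snd z) (r_minus (fst z) (snd z)) h)"
  "continuous_on dom (\<lambda>z. root_deriv (snd z) (r_plus (fst z) (snd z)) h)"
proof -
  have c: "continuous_on dom (\<lambda>z. dPsi (snd z) (\<rho> z))" if "continuous_on dom \<rho>" "\<And>z. z \<in> dom \<Longrightarrow> 0 < \<rho> z" for \<rho>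
    using continuous_on_compose2[OF continuous_dPsi_joint continuous_on_Pair[OF that(1) continuous_on_snd[OF continuous_on_id]]] that(2)
    by (auto simp: image_subset_iff)
  have n: "dPsi (snd z) (r_minus (fst z) (snd z)) \<noteq> 0" "dPsi (snd z) (r_plus (fst z) (snd z)) \<noteq> 0" if "z \<in> dom" for z
    using turning_points_dPsi_sign[of "fst z" "snd z"] that by auto
  have p: "r_minus (fst z) (snd z) \<noteq> 0" "r_plus (fst z) (snd z) \<noteq> 0" if "z \<in> dom" for z
    using dom_pos[OF that] by auto
  show "continuous_on dom (\<lambda>z. root_deriv (snd z) (r_minus (fst z) (snd z)) h)"
    "continuous_on dom (\<lambda>z. root_deriv (snd z) (r_plus (fst z) (snd z)) h)"
    unfolding root_deriv_def
    by (intro continuous_on_divide continuous_on_diff continuous_on_const continuous_on_mult continuous_on_power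
        continuous_roots c dom_pos; use n p in auto)+
qed

lemma continuous_rad_d_joint: "continuous_on (dom \<times> X) (\<lambda>y. rad_d (fst (fst y)) (snd (fst y)) (snd y) h)"
  unfolding rad_d_def
  by (intro continuous_intros continuous_dom_fst continuous_root_deriv) auto

lemma continuous_gap_joint: "continuous_on (dom \<times> X) (\<lambda>y. gap (fst (fst y)) (snd (fst y)) (snd y))"
  unfolding gap_def
  by (intro continuous_intros continuous_pair_joint continuous_I_joint) auto

lemma continuous_gap_d_joint: "continuous_on (dom \<times> X) (\<lambda>y. gap_d (fst (fst y)) (snd (fst y)) (snd y) h)"
  unfolding gap_d_def
  by (intro continuous_intros continuous_pair_joint continuous_I_joint continuous_rad_d_joint
      continuous_dom_fst continuous_root_deriv) auto

lemma gap_pos: "z \<in> dom \<Longrightarrow> 0 < gap (fst z) (snd z) x"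
  using gap_bounds(3)[of "fst z" "snd z"] by simp

lemma continuous_speed_joint: "continuous_on (dom \<times> X) (\<lambda>y. speed (fst (fst y)) (snd (fst y)) (snd y))"
  unfolding speed_def
  by (intro continuous_on_divide continuous_on_real_sqrt continuous_gap_joint continuous_rad_joint)
    (use gap_pos in \<open>auto simp: less_imp_neq[symmetric]\<close>)

lemma continuous_speed_d_joint: "continuous_on (dom \<times> X) (\<lambda>y. speed_d (fst (fst y)) (snd (fst y)) (snd y) h)"
proof -
  have "gap (fst (fst y)) (snd (fst y)) (snd y) \<noteq> 0" if "y \<in> dom \<times> X" for y
    using gap_pos[of "fst y" "snd y"] that by auto
  then show ?thesis
    unfolding speed_d_def
    by (intro continuous_on_divide continuous_on_diff continuous_on_mult continuous_on_const continuous_on_real_sqrt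
        continuous_gap_joint continuous_gap_d_joint continuous_rad_joint continuous_rad_d_joint) auto
qed

lemma continuous_speed_d: "(E, L) \<in> dom \<Longrightarrow> continuous_on X (\<lambda>x. speed_d E L x h)"
  using continuous_on_compose2[OF continuous_speed_d_joint[of X h]
      continuous_on_Pair[OF continuous_on_const[of X "(E, L)"] continuous_on_id]]
  by (auto simp: image_subset_iff)

lemma clock_has_derivative:
  assumes d: "(E, L) \<in> dom"
  shows "((\<lambda>z. clock (fst z) (snd z) pi) has_derivative clock_d E L) (at (E, L))"
proof -
  have "((\<lambda>z. integral {0..pi} (\<lambda>x. speed (fst z) (snd z) x)) has_derivative
     (\<lambda>h. integral {0..pi} (\<lambda>x. speed_d (fst (E, L)) (snd (E, L)) x (1, 0)) * fst h
        + integral {0..pi} (\<lambda>x. speed_d (fst (E, L)) (snd (E, L)) x (0, 1)) * snd h)) (at (E, L))"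
  proof (rule has_derivative_integral_param_pair[OF open_dom d])
    fix z and t :: real assume z: "z \<in> dom" "t \<in> {0..pi}"
    have "speed_d (fst z) (snd z) t = (\<lambda>h. speed_d (fst z) (snd z) t (1, 0) * fst h + speed_d (fst z) (snd z) t (0, 1) * snd h)"
      using speed_d_linear by blast
    then show "((\<lambda>z. speed (fst z) (snd z) t) has_derivative
        (\<lambda>h. speed_d (fst z) (snd z) t (1, 0) * fst h + speed_d (fst z) (snd z) t (0, 1) * snd h)) (at z)"
      using speed_has_derivative[of "fst z" "snd z" t] z(1) by (simp add: prod.collapse)
  next
    fix z assume "z \<in> dom"
    then show "continuous_on {0..pi} (\<lambda>x. speed (fst z) (snd z) x)"
      using continuous_speed[of "fst z" "snd z"] by simp
  qed (use continuous_speed_d_joint[of "{0..pi}"] in \<open>simp_all add: split_beta\<close>)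
  moreover have "clock_d E L h = integral {0..pi} (\<lambda>x. speed_d E L x (1, 0)) * fst h + integral {0..pi} (\<lambda>x. speed_d E L x (0, 1)) * snd h" for h
  proof -
    have "clock_d E L h = integral {0..pi} (\<lambda>x. speed_d E L x (1, 0) * fst h + speed_d E L x (0, 1) * snd h)"
      unfolding clock_d_def using speed_d_linear[of E L _ h] by simp
    also have "\<dots> = integral {0..pi} (\<lambda>x. speed_d E L x (1, 0) * fst h) + integral {0..pi} (\<lambda>x. speed_d E L x (0, 1) * snd h)"
      by (intro Henstock_Kurzweil_Integration.integral_add integrable_continuous_real continuous_intros continuous_speed_d[OF d])
    finally show ?thesis by simp
  qed
  then have "clock_d E L = (\<lambda>h. integral {0..pi} (\<lambda>x. speed_d E L x (1, 0)) * fst h + integral {0..pi} (\<lambda>x. speed_d E L x (0, 1)) * snd h)"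
    by (rule ext)
  ultimately show ?thesis by (simp add: clock_def)
qed

lemma omega_eq: "(E, L) \<in> dom \<Longrightarrow> omega E L = 1 / (2 * clock E L pi)"
  by (simp add: omega_def period_eq)

lemma omega_has_derivative:
  assumes d: "(E, L) \<in> dom"
  shows "((\<lambda>z. omega (fst z) (snd z)) has_derivative omega_d E L) (at (E, L))"
proof -
  have p: "0 < clock E L pi" by (rule clock_pi_pos[OF d])
  have "((\<lambda>c. 1 / (2 * c)) has_real_derivative - (1 / (2 * (clock E L pi)\<^sup>2))) (at (clock E L pi))"
    using p by (auto intro!: derivative_eq_intros simp: power2_eq_square field_simps)
  then have "((\<lambda>c. 1 / (2 * c)) has_derivative (\<lambda>h. - (1 / (2 * (clock E L pi)\<^sup>2)) * h)) (at (clock (fst (E, L)) (snd (E, L)) pi))"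
    by (simp only: has_field_derivative_def fst_conv snd_conv)
  from has_derivative_compose[OF clock_has_derivative[OF d] this]
  have "((\<lambda>z. 1 / (2 * clock (fst z) (snd z) pi)) has_derivative omega_d E L) (at (E, L))"
    by (simp add: omega_d_def[abs_def])
  then show ?thesis
    by (rule has_derivative_transform_within_open[OF _ open_dom d]) (auto simp: omega_eq)
qed

text \<open>The direction (1 / (2 R^2), 1) is tangent to the lines E - Psi L R = const. So
  \<open>P R\<close> differentiates along orbits that pass R with the same radial speed.\<close>

lemma P_eq_directional:
  fixes f :: "real \<Rightarrow> real \<Rightarrow> real"
  assumes f: "((\<lambda>z. f (fst z) (snd z)) has_derivative f') (at (E, L))"
  shows "P R f E L = f' (1 / (2 * R\<^sup>2), 1)"
    and "\<And>h. f' h = deriv (\<lambda>e. f e L) E * fst h + deriv (\<lambda>l. f E l) L * snd h"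
proof -
  interpret bounded_linear f' using f by (rule has_derivative_bounded_linear)
  have "((\<lambda>e. f e L) has_derivative (\<lambda>h. f' (h, 0))) (at E)"
    using has_derivative_compose[OF has_derivative_Pair[OF has_derivative_ident has_derivative_const] f] by simp
  moreover have "f' (h, 0) = f' (1, 0) * h" for h using scaleR[of h "(1, 0)"] by simp
  then have "(\<lambda>h. f' (h, 0)) = (*) (f' (1, 0))" by (rule ext)
  ultimately have 1: "deriv (\<lambda>e. f e L) E = f' (1, 0)"
    by (intro DERIV_imp_deriv) (simp only: has_field_derivative_def)
  have "((\<lambda>l. f E l) has_derivative (\<lambda>h. f' (0, h))) (at L)"
    using has_derivative_compose[OF has_derivative_Pair[OF has_derivative_const has_derivative_ident] f] by simp
  moreover have "f' (0, h) = f' (0, 1) * h" for h using scaleR[of h "(0, 1)"] by simp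
  then have "(\<lambda>h. f' (0, h)) = (*) (f' (0, 1))" by (rule ext)
  ultimately have 2: "deriv (\<lambda>l. f E l) L = f' (0, 1)"
    by (intro DERIV_imp_deriv) (simp only: has_field_derivative_def)
  have lin: "f' h = f' (1, 0) * fst h + f' (0, 1) * snd h" for h
    using add[of "(fst h, 0)" "(0, snd h)"] scaleR[of "fst h" "(1, 0)"] scaleR[of "snd h" "(0, 1)"]
    by (simp add: mult.commute)
  then show "f' h = deriv (\<lambda>e. f e L) E * fst h + deriv (\<lambda>l. f E l) L * snd h" for h
    unfolding 1 2 .
  show "P R f E L = f' (1 / (2 * R\<^sup>2), 1)"
    unfolding P_def 1 2 lin[of "(1 / (2 * R\<^sup>2), 1)"] by (simp only: fst_conv snd_conv mult.commute[of _ "1 / (2 * R\<^sup>2)"] mult_1_right)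
qed

text \<open>In the direction of \<open>P R\<close> the two turning points move outward with bounded speed (they pivot
  about \<open>R\<close>), so no singularity arises as the orbit degenerates to a circle, and the
  contribution of the perturbation to the derivative of the period is dominated by \<open>1 / R\<^sup>2\<close>.\<close>

lemma root_deriv_direction:
  assumes R: "0 < R" and x: "(E, L) \<in> D R"
  defines "v \<equiv> (1 / (2 * R\<^sup>2), 1)"
  shows "0 < root_deriv L (r_minus E L) v" "root_deriv L (r_minus E L) v \<le> 4 * B / (R\<^sup>2 * (- \<kappa>))"
    "0 < root_deriv L (r_plus E L) v" "root_deriv L (r_plus E L) v \<le> 4 * B / (R\<^sup>2 * (- \<kappa>))"
proof -
  note d = D_dom[OF R x]
  note tp = turning_points(1,2)[OF d]
  note orb = D_orbit[OF R x]
  have r12: "0 < r_plus E L" using tp by simp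
  \<comment> \<open>The numerator of \<open>root_deriv\<close> in this direction vanishes at r = R,
    hence is proportional to the distance from R to the turning point.\<close>
  have *: "1 / (2 * R\<^sup>2) - 1 / (2 * r\<^sup>2) = (r - R) * (r + R) / (2 * R\<^sup>2 * r\<^sup>2)" if "0 < r" for r
    using that R by (simp add: field_simps power2_eq_square)
  \<comment> \<open>Here s is the distance from a turning point to R and c = r_plus - r_minus. Since
    R lies between the turning points, s / c <= 1, and this removes the degeneration.\<close>
  have bound: "(s * t) / (R\<^sup>2 * (c * g)) \<le> 4 * B / (R\<^sup>2 * (- \<kappa>))"
    if "0 \<le> s" "s \<le> c" "0 \<le> t" "t \<le> 2 * B" "- \<kappa> / 2 \<le> g" "0 < c" for s t c g
  proof -
    define k where "k = - \<kappa> / 2"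
    have k: "0 < k" "k \<le> g" "- \<kappa> = 2 * k" using params that by (auto simp: k_def)
    have "(s * t) / (R\<^sup>2 * (c * g)) \<le> (c * (2 * B)) / (R\<^sup>2 * (c * k))"
      using that R B_pos k by (intro frac_le mult_mono) auto
    also have "\<dots> = 4 * B / (R\<^sup>2 * (- \<kappa>))" unfolding k(3) using that k R by (simp add: field_simps)
    finally show ?thesis .
  qed
  define c where "c = r_plus E L - r_minus E L"
  have c: "0 < c" using tp by (simp add: c_def)
  have g: "0 < gap E L 0" "0 < gap E L pi" "- \<kappa> / 2 \<le> gap E L 0" "- \<kappa> / 2 \<le> gap E L pi"
    using gap_bounds[OF d] by auto
  have 1: "root_deriv L (r_minus E L) v = ((R - r_minus E L) * (R + r_minus E L)) / (R\<^sup>2 * (c * gap E L 0))"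
    unfolding root_deriv_def v_def fst_conv snd_conv *[OF tp(1)] turning_points_dPsi(1)[OF d] c_def[symmetric]
    using tp c g R by (simp add: field_simps)
  have 2: "root_deriv L (r_plus E L) v = ((r_plus E L - R) * (r_plus E L + R)) / (R\<^sup>2 * (c * gap E L pi))"
    unfolding root_deriv_def v_def fst_conv snd_conv *[OF r12] turning_points_dPsi(2)[OF d] c_def[symmetric]
    using r12 c g R by (simp add: field_simps)
  show "0 < root_deriv L (r_minus E L) v" "0 < root_deriv L (r_plus E L) v"
    unfolding 1 2 using orb tp r12 c g R by (auto intro!: divide_pos_pos mult_pos_pos add_pos_pos)
  show "root_deriv L (r_minus E L) v \<le> 4 * B / (R\<^sup>2 * (- \<kappa>))" "root_deriv L (r_plus E L) v \<le> 4 * B / (R\<^sup>2 * (- \<kappa>))"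
    unfolding 1 2 by (rule bound; use orb tp r12 c g R in \<open>simp add: c_def\<close>)+
qed

lemma speed_d_pos:
  assumes R: "0 < R" and x: "(E, L) \<in> D R"
  shows "0 < speed_d E L t (1 / (2 * R\<^sup>2), 1)"
proof -
  note d = D_dom[OF R x]
  note tp = turning_points(1,2)[OF d]
  define v where "v = (1 / (2 * R\<^sup>2), 1 :: real)"
  note rd = root_deriv_direction[OF R x, folded v_def]
  define k where "k = 4 * B / (R\<^sup>2 * (- \<kappa>))"
  define a b where "a = (1 - cos t) / 2" and "b = (1 + cos t) / 2"
  have ab: "0 \<le> a" "0 \<le> b" "a + b = 1" using one_minus_cos[of t] by (auto simp: a_def b_def field_simps)
  have rad_eq: "rad_d E L t v = root_deriv L (r_minus E L) v * b + root_deriv L (r_plus E L) v * a"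
    by (simp add: rad_d_def a_def b_def)
  have rd_pos: "0 < rad_d E L t v"
  proof (cases "0 < b")
    case True
    then show ?thesis unfolding rad_eq using ab rd by (intro add_pos_nonneg) auto
  next
    case False
    then have "0 < a" using ab by linarith
    then show ?thesis unfolding rad_eq using ab rd by (intro add_nonneg_pos) auto
  qed
  have "rad_d E L t v \<le> k * b + k * a"
    unfolding rad_eq k_def using ab rd by (intro add_mono mult_right_mono) auto
  also have "\<dots> = k * (a + b)" by (simp add: algebra_simps)
  finally have rd_le: "rad_d E L t v \<le> k" using ab by simp
  have k: "0 \<le> k" using rd_pos rd_le by linarith
  let ?r = "rad E L t"
  have r: "0 < ?r" "0 < r_plus E L" using rad_range(3)[OF d] tp by auto
  have le: "i * s \<le> \<delta> * k" if "\<bar>i\<bar> \<le> \<delta>" "0 < s" "s \<le> k" for i s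
  proof -
    have "i * s \<le> \<bar>i\<bar> * s" using that by (intro mult_right_mono) auto
    also have "\<dots> \<le> \<delta> * k" using that delta_nonneg by (intro mult_mono) auto
    finally show ?thesis .
  qed
  have "a * (Ia (r_minus E L) ?r * root_deriv L (r_minus E L) v + Ir (r_minus E L) ?r * rad_d E L t v)
      + b * (Ia (r_plus E L) ?r * root_deriv L (r_plus E L) v + Ir (r_plus E L) ?r * rad_d E L t v)
    \<le> a * (\<delta> * k + \<delta> * k) + b * (\<delta> * k + \<delta> * k)"
    using ab rd rd_pos rd_le r tp Ia_bound Ir_bound unfolding k_def[symmetric]
    by (intro add_mono mult_left_mono le) auto
  also have "\<dots> = (a + b) * (\<delta> * k + \<delta> * k)" by (simp add: algebra_simps)
  also have "\<dots> = 2 * (\<delta> * k)" using ab by simp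
  finally have "gap_d E L t v \<le> - (1 / R\<^sup>2) + 4 * (\<delta> * k)"
    unfolding gap_d_def a_def[symmetric] b_def[symmetric] by (simp add: v_def)
  \<comment> \<open>With k = 4 B / (R^2 (- kappa)) and B = M / (- kappa), this is the condition 16
    delta M <= kappa^2. The term - 1 / R^2 that it has to beat comes from - 2 dE in
    \<open>gap_d\<close>.\<close>
  moreover have "4 * (\<delta> * k) \<le> 1 / R\<^sup>2"
  proof -
    have "4 * (\<delta> * k) = (16 * \<delta> * M) / (R\<^sup>2 * \<kappa>\<^sup>2)"
      using params R by (simp add: k_def B_def power2_eq_square mult_ac)
    also have "\<dots> \<le> \<kappa>\<^sup>2 / (R\<^sup>2 * \<kappa>\<^sup>2)" using small(2) by (intro divide_right_mono) auto
    also have "\<dots> = 1 / R\<^sup>2" using params by simp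
    finally show ?thesis .
  qed
  ultimately have "gap_d E L t v \<le> 0" by linarith
  then have "?r * gap_d E L t v / (2 * gap E L t * sqrt (gap E L t)) \<le> 0"
    using r gap_bounds(3)[OF d, of t] by (intro divide_nonpos_pos mult_nonneg_nonpos) auto
  moreover have "0 < rad_d E L t v / sqrt (gap E L t)"
    using rd_pos gap_bounds(3)[OF d, of t] by simp
  ultimately show ?thesis unfolding speed_d_def v_def[symmetric] by linarith
qed

lemma P_omega:
  assumes R: "0 < R" and x: "(E, L) \<in> D R"
  shows "P R omega E L = omega_d E L (1 / (2 * R\<^sup>2), 1)" "P R omega E L < 0"
proof -
  note d = D_dom[OF R x]
  show 1: "P R omega E L = omega_d E L (1 / (2 * R\<^sup>2), 1)"
    by (rule P_eq_directional(1)[OF omega_has_derivative[OF d]])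
  have "0 < clock_d E L (1 / (2 * R\<^sup>2), 1)"
    unfolding clock_d_def using speed_d_pos[OF R x]
      integral_less_real[where f = "\<lambda>_. 0" and g = "\<lambda>t. speed_d E L t (1 / (2 * R\<^sup>2), 1)" and a = 0 and b = pi]
      continuous_speed_d[OF d, of "{0..pi}"] pi_gt_zero by (simp add: not_le)
  then show "P R omega E L < 0"
    unfolding 1 omega_d_def using clock_pi_pos[OF d] by simp
qed

text \<open>Two orbits with the same z lie on a common line in the direction of \<open>P R\<close>.
  The segment between them stays in \<open>D R\<close>, and omega is strictly decreasing along
  it.\<close>

lemma yz_inj: assumes R: "0 < R" shows "inj_on (yz R) (D R)"
proof -
  have less: "omega E' L' < omega E L"
    if x: "(E, L) \<in> D R" and x': "(E', L') \<in> D R" and z: "E - Psi L R = E' - Psi L' R" and LL: "L < L'" for E L E' L'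
  proof -
    \<comment> \<open>The energy on that line as a function of the angular momentum l. It increases
      in l, so E <= E0 holds on the segment because it holds at the end with larger L.\<close>
    define c where "c l = E - Psi L R + Psi l R" for l
    have c_mono: "c l \<le> c L'" if "l \<le> L'" for l
      using that R by (simp add: c_def Psi_def divide_right_mono)
    have c_ends: "c L = E" "c L' = E'" using z by (simp_all add: c_def)
    have mem: "(c l, l) \<in> D R" if "L \<le> l" "l \<le> L'" for l
      using that x x' c_mono[of l] c_ends by (auto simp: D_def c_def)
    have dc: "((\<lambda>l. (c l, l)) has_derivative (\<lambda>h. (h * (1 / (2 * R\<^sup>2)), h))) (at l)" for l
      unfolding c_def Psi_def using R
      by (auto intro!: derivative_eq_intros simp: field_simps)
    have "omega (c L') L' < omega (c L) L"
    proof (rule DERIV_neg_imp_decreasing[OF LL, of "\<lambda>l. omega (c l) l"])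
      fix l assume l: "L \<le> l" "l \<le> L'"
      note m = mem[OF l]
      have "((\<lambda>l. omega (fst (c l, l)) (snd (c l, l))) has_derivative (\<lambda>h. omega_d (c l) l (h * (1 / (2 * R\<^sup>2)), h))) (at l)"
        by (rule has_derivative_compose[OF dc omega_has_derivative[OF D_dom[OF R m]]])
      moreover have "omega_d (c l) l (h * (1 / (2 * R\<^sup>2)), h) = P R omega (c l) l * h" for h
      proof -
        interpret bounded_linear "omega_d (c l) l"
          using omega_has_derivative[OF D_dom[OF R m]] by (rule has_derivative_bounded_linear)
        show ?thesis
          using scaleR[of h "(1 / (2 * R\<^sup>2), 1)"] by (simp add: P_omega(1)[OF R m] mult.commute)
      qed
      then have "(\<lambda>h. omega_d (c l) l (h * (1 / (2 * R\<^sup>2)), h)) = (*) (P R omega (c l) l)" by (rule ext)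
      ultimately have "DERIV (\<lambda>l. omega (c l) l) l :> P R omega (c l) l"
        by (simp only: has_field_derivative_def fst_conv snd_conv)
      then show "\<exists>y. DERIV (\<lambda>l. omega (c l) l) l :> y \<and> y < 0"
        using P_omega(2)[OF R m] by blast
    qed
    then show ?thesis by (simp add: c_ends)
  qed
  show ?thesis
  proof (rule inj_onI)
    fix p p' assume p: "p \<in> D R" "p' \<in> D R" "yz R p = yz R p'"
    obtain E L E' L' where pp: "p = (E, L)" "p' = (E', L')" by (cases p, cases p')
    have o: "omega E L = omega E' L'" "E - Psi L R = E' - Psi L' R" using p pp by (auto simp: yz_def)
    have "L = L'"
      using less[of E L E' L'] less[of E' L' E L] p pp o by (metis less_irrefl linorder_less_linear)
    then show "p = p'" using o pp by simp
  qed
qed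

lemma yz_has_derivative:
  assumes R: "0 < R" and x: "(E, L) \<in> D R"
  shows "(yz R has_derivative (\<lambda>h. (deriv (\<lambda>e. omega e L) E * fst h + deriv (\<lambda>l. omega E l) L * snd h,
      1 * fst h + (- (1 / (2 * R\<^sup>2))) * snd h))) (at (E, L) within X)"
proof -
  note o = omega_has_derivative[OF D_dom[OF R x]]
  have 1: "((\<lambda>z. omega (fst z) (snd z)) has_derivative
      (\<lambda>h. deriv (\<lambda>e. omega e L) E * fst h + deriv (\<lambda>l. omega E l) L * snd h)) (at (E, L))"
    using o P_eq_directional(2)[OF o] by (metis (no_types, lifting) has_derivative_eq_rhs ext)
  have 2: "((\<lambda>z. fst z - Psi (snd z) R) has_derivative (\<lambda>h. 1 * fst h + (- (1 / (2 * R\<^sup>2))) * snd h)) (at (E, L))"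
    unfolding Psi_def using R by (auto intro!: derivative_eq_intros simp: field_simps)
  have "yz R = (\<lambda>z. (omega (fst z) (snd z), fst z - Psi (snd z) R))" by (auto simp: yz_def)
  with has_derivative_Pair[OF 1 2] show ?thesis by (auto intro: has_derivative_at_withinI)
qed

end

subsection \<open>The Plemelj operator\<close>

context near_kepler
begin

text \<open>The union of the sets \<open>D R\<close> over R > 0 (see \<open>D_subset_DA\<close> and
  \<open>DA_D\<close>). It serves as the common domain on which integrands get a majorant
  independent of R.\<close>

definition DA :: "(real \<times> real) set" where
  "DA = dom \<inter> {z. L0 \<le> snd z} \<inter> {z. fst z \<le> E0}"

definition Box :: "(real \<times> real) set" where
  "Box = cbox (U 0 - M / A, L0) (E0, 2 * M * B)"

lemma D_subset_DA: "0 < R \<Longrightarrow> D R \<subseteq> DA"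
  using D_dom by (auto simp: DA_def D_def)

lemma DA_D:
  assumes "z \<in> DA"
  obtains R where "0 < R" "z \<in> D R"
  using assms by (cases z) (auto simp: DA_def dom_def D_def)

lemma DA_Box: "DA \<subseteq> Box"
proof
  fix z assume z: "z \<in> DA"
  then obtain R where R: "0 < R" "z \<in> D R" by (rule DA_D)
  obtain E L where EL: "z = (E, L)" by (cases z)
  have x: "L0 \<le> L" "Psi L R < E" "E \<le> E0" using R EL by (auto simp: D_def)
  note AB = allowed_region[OF R(1) x(1) x(3) less_imp_le[OF x(2)]]
  have "0 \<le> L / (2 * R\<^sup>2)" using x params by simp
  moreover have "M / R \<le> M / A" using AB params A_pos by (intro divide_left_mono) auto
  ultimately have 1: "U 0 - M / A \<le> E"
    using x U_bounds(1)[OF R(1)] by (simp add: Psi_def)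
  have "0 < W E L R" using x R by (simp add: W_pos_iff)
  moreover have "(E - U 0) * R\<^sup>2 \<le> 0" using x params by (intro mult_nonpos_nonneg) (auto simp: E0_eq)
  moreover have "2 * M * R \<le> 2 * M * B" using AB params by (intro mult_left_mono) auto
  ultimately have "L \<le> 2 * M * B" using W_le[OF R(1), of E L] by linarith
  then show "z \<in> Box" using 1 x by (simp add: EL Box_def cbox_Pair_eq)
qed

lemma DA_borel: "DA \<in> sets borel"
  unfolding DA_def using open_dom
  by (intro sets.Int borel_open borel_closed closed_Collect_le continuous_intros) auto

lemma D_borel: "D R \<in> sets borel"
proof -
  have "D R = {z. L0 \<le> snd z} \<inter> {z. Psi (snd z) R < fst z} \<inter> {z. fst z \<le> E0}" by (auto simp: D_def)
  moreover have "open {z :: real \<times> real. Psi (snd z) R < fst z}"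
    unfolding Psi_def by (cases "R = 0") (auto intro!: open_Collect_less continuous_intros)
  moreover have "closed {z :: real \<times> real. L0 \<le> snd z}" "closed {z :: real \<times> real. fst z \<le> E0}"
    by (intro closed_Collect_le continuous_intros)+
  ultimately show ?thesis
    by (simp only: sets.Int borel_open borel_closed)
qed

section \<open>Bounds and joint continuity of the integrand\<close>

lemma phi'_eq: "phi' E L = - (\<mu> * max 0 (E0 - E) powr (\<mu> - 1)) * max 0 (L - L0) powr \<nu>"
proof -
  have "((\<lambda>e. max 0 (E0 - e) powr \<mu>) has_real_derivative \<mu> * max 0 (E0 - E) powr (\<mu> - 1) * (0 - 1)) (at E)"
    using params by (intro DERIV_chain2[OF DERIV_max_powr]) (auto intro!: derivative_eq_intros)
  from DERIV_cmult_right[OF this, of "max 0 (L - L0) powr \<nu>"]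
  show ?thesis unfolding phi'_def phi_def by (intro DERIV_imp_deriv) simp
qed

lemma continuous_phi': "continuous_on X (\<lambda>z. phi' (fst z) (snd z))"
  unfolding phi'_eq using params by (intro continuous_intros continuous_on_max_powr) auto

definition phi'_max :: real where
  "phi'_max = \<mu> * (M / A) powr (\<mu> - 1) * (2 * M * B) powr \<nu>"

lemma phi'_bound:
  assumes "(E, L) \<in> DA"
  shows "\<bar>phi' E L\<bar> \<le> phi'_max"
proof -
  have b: "U 0 - M / A \<le> E" "L \<le> 2 * M * B"
    using DA_Box assms by (auto simp: Box_def cbox_Pair_eq)
  have 1: "max 0 (E0 - E) \<le> M / A"
    using b params A_pos by (auto simp: E0_eq)
  have 2: "max 0 (L - L0) \<le> 2 * M * B" using b params B_pos by auto
  have "\<bar>phi' E L\<bar> = \<mu> * max 0 (E0 - E) powr (\<mu> - 1) * max 0 (L - L0) powr \<nu>"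
    using params by (simp add: phi'_eq abs_mult)
  also have "\<dots> \<le> phi'_max"
    unfolding phi'_max_def using params 1 2 by (intro mult_mono powr_mono2) auto
  finally show ?thesis .
qed

lemma phi'_max_nonneg: "0 \<le> phi'_max"
  using params by (simp add: phi'_max_def)

text \<open>Rescaling to a fixed interval moves the upper limit x into the integrand, so that
  continuity of parameter integrals yields joint continuity in (E, L) and x.\<close>

lemma clock_scale:
  assumes d: "(E, L) \<in> dom" and x: "0 \<le> x"
  shows "clock E L x = integral {0..1} (\<lambda>s. x * speed E L (x * s))"
proof -
  have "((\<lambda>s. x *\<^sub>R speed E L (x * s)) has_integral
      (integral {x * 0..x * 1} (speed E L) - integral {x * 1..x * 0} (speed E L))) {0..1}"
    by (rule has_integral_substitution_general[of "{}" _ _ _ 0 x])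
      (use x in \<open>auto intro!: continuous_speed[OF d] continuous_intros derivative_eq_intros mult_left_le\<close>)
  then show ?thesis
    using x by (cases "x = 0") (auto simp: clock_def dest!: integral_unique)
qed

lemma continuous_clock_joint: "continuous_on (dom \<times> {0..}) (\<lambda>y. clock (fst (fst y)) (snd (fst y)) (snd y))"
proof -
  have "continuous_on ((dom \<times> {0..}) \<times> {0..1}) (\<lambda>w. snd (fst w) * speed (fst (fst (fst w))) (snd (fst (fst w))) (snd (fst w) * snd w))"
  proof -
    have h: "continuous_on ((dom \<times> {0..}) \<times> {0..1}) (\<lambda>w. (fst (fst w), snd (fst w) * snd w :: real))"
      by (intro continuous_intros)
    have im: "(\<lambda>w. (fst (fst w), snd (fst w) * snd w)) ` ((dom \<times> {0..}) \<times> {0..1}) \<subseteq> dom \<times> UNIV"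
      by auto
    from continuous_on_compose2[OF continuous_speed_joint h im] show ?thesis
      by (intro continuous_on_mult continuous_on_snd continuous_on_fst continuous_on_id) simp
  qed
  then have "continuous_on (dom \<times> {0..}) (\<lambda>y. integral {0..1} (\<lambda>s. snd y * speed (fst (fst y)) (snd (fst y)) (snd y * s)))"
    using integral_continuous_on_param[of "dom \<times> {0..}" 0 1 "\<lambda>y s. snd y * speed (fst (fst y)) (snd (fst y)) (snd y * s)"]
    by (simp add: split_beta)
  then show ?thesis
    by (rule continuous_on_eq) (auto simp: clock_scale)
qed

lemma continuous_clock_pi: "continuous_on dom (\<lambda>z. clock (fst z) (snd z) pi)"
proof -
  have h: "continuous_on dom (\<lambda>z. (z, pi))" by (intro continuous_intros)
  have im: "(\<lambda>z. (z, pi)) ` dom \<subseteq> dom \<times> {0..}" by auto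
  from continuous_on_compose2[OF continuous_clock_joint h im] show ?thesis by simp
qed

lemma continuous_tau_joint: "continuous_on (dom \<times> {0..}) (\<lambda>y. tau (fst (fst y)) (snd (fst y)) (snd y))"
  unfolding tau_def
  by (intro continuous_on_divide continuous_clock_joint continuous_on_mult continuous_on_const
      continuous_dom_fst[OF continuous_clock_pi]) (use clock_pi_pos in \<open>auto simp: less_imp_neq[symmetric]\<close>)

lemma continuous_phase_rate_joint: "continuous_on (dom \<times> X) (\<lambda>y. phase_rate (fst (fst y)) (snd (fst y)) (snd y))"
  unfolding phase_rate_def
  by (intro continuous_on_divide continuous_speed_joint continuous_on_mult continuous_on_const
      continuous_dom_fst[OF continuous_clock_pi]) (use clock_pi_pos in \<open>auto simp: less_imp_neq[symmetric]\<close>)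

lemma DA_orbit:
  assumes "(E, L) \<in> DA"
  shows "(E, L) \<in> dom" "rad E L x \<in> {R_min..R_max}" "{r_minus E L..r_plus E L} \<subseteq> {R_min..R_max}"
proof -
  obtain R where R: "0 < R" "(E, L) \<in> D R" using DA_D[OF assms] .
  show d: "(E, L) \<in> dom" using D_dom[OF R] .
  show "{r_minus E L..r_plus E L} \<subseteq> {R_min..R_max}" using D_orbit[OF R] by auto
  then show "rad E L x \<in> {R_min..R_max}" using rad_range[OF d, of x] by auto
qed

lemma fourier_coeff_DA:
  assumes "V \<in> C1 R_min R_max" "(E, L) \<in> DA"
  shows "fourier_coeff V m E L =
    2 * integral {0..pi} (\<lambda>x. (cos (2 * pi * of_int m * tau E L x) * phase_rate E L x) *\<^sub>R V (rad E L x))"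
  using DA_orbit[OF assms(2)] C1D(4)[OF assms(1) R_min_max(3)]
  by (intro fourier_coeff_eq) (auto intro: continuous_on_subset)

lemma continuous_fourier_integrand:
  assumes V: "V \<in> C1 R_min R_max"
  shows "continuous_on (DA \<times> {0..pi}) (\<lambda>y. (cos (2 * pi * of_int m * tau (fst (fst y)) (snd (fst y)) (snd y))
      * phase_rate (fst (fst y)) (snd (fst y)) (snd y)) *\<^sub>R V (rad (fst (fst y)) (snd (fst y)) (snd y)))"
proof -
  have sub: "DA \<times> {0..pi} \<subseteq> dom \<times> {0..}" by (auto simp: DA_def)
  have "continuous_on (DA \<times> {0..pi}) (\<lambda>y. V (rad (fst (fst y)) (snd (fst y)) (snd y)))"
    using C1D(4)[OF V R_min_max(3)] continuous_on_subset[OF continuous_rad_joint sub] DA_orbit(2)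
    by (intro continuous_on_compose2[where g = V and s = "DA \<times> {0..pi}"]) auto
  then show ?thesis
    by (intro continuous_intros continuous_on_subset[OF continuous_tau_joint sub]
        continuous_on_subset[OF continuous_phase_rate_joint sub])
qed

lemma continuous_fourier_coeff:
  assumes V: "V \<in> C1 R_min R_max"
  shows "continuous_on DA (\<lambda>z. fourier_coeff V m (fst z) (snd z))"
proof -
  have "continuous_on DA (\<lambda>z. integral {0..pi} (\<lambda>x. (cos (2 * pi * of_int m * tau (fst z) (snd z) x)
      * phase_rate (fst z) (snd z) x) *\<^sub>R V (rad (fst z) (snd z) x)))"
    using integral_continuous_on_param[of DA 0 pi "\<lambda>z x. (cos (2 * pi * of_int m * tau (fst z) (snd z) x)
      * phase_rate (fst z) (snd z) x) *\<^sub>R V (rad (fst z) (snd z) x)"] continuous_fourier_integrand[OF V, of m]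
    by (simp add: split_beta)
  then have "continuous_on DA (\<lambda>z. 2 * integral {0..pi} (\<lambda>x. (cos (2 * pi * of_int m * tau (fst z) (snd z) x)
      * phase_rate (fst z) (snd z) x) *\<^sub>R V (rad (fst z) (snd z) x)))"
    by (intro continuous_intros)
  then show ?thesis
    by (rule continuous_on_eq) (simp add: fourier_coeff_DA[OF V])
qed

lemma fourier_coeff_lincomb:
  assumes V: "V \<in> C1 R_min R_max" and Z: "Z \<in> C1 R_min R_max" and z: "(E, L) \<in> DA"
  shows "fourier_coeff (\<lambda>r. c * V r + d * Z r) m E L = c * fourier_coeff V m E L + d * fourier_coeff Z m E L"
proof -
  let ?k = "\<lambda>x. cos (2 * pi * of_int m * tau E L x) * phase_rate E L x"
  have c: "continuous_on {0..pi} (\<lambda>x. ?k x *\<^sub>R V (rad E L x))" if "V \<in> C1 R_min R_max" for V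
  proof -
    have h: "continuous_on {0..pi} (\<lambda>x. ((E, L), x))" by (intro continuous_intros)
    have im: "(\<lambda>x. ((E, L), x)) ` {0..pi} \<subseteq> DA \<times> {0..pi}" using z by auto
    from continuous_on_compose2[OF continuous_fourier_integrand[OF that] h im] show ?thesis by simp
  qed
  have "integral {0..pi} (\<lambda>x. ?k x *\<^sub>R (c * V (rad E L x) + d * Z (rad E L x))) =
      integral {0..pi} (\<lambda>x. c * (?k x *\<^sub>R V (rad E L x)) + d * (?k x *\<^sub>R Z (rad E L x)))"
    by (simp add: scaleR_right_distrib)
  also have "\<dots> = integral {0..pi} (\<lambda>x. c * (?k x *\<^sub>R V (rad E L x))) + integral {0..pi} (\<lambda>x. d * (?k x *\<^sub>R Z (rad E L x)))"
    by (intro Henstock_Kurzweil_Integration.integral_add integrable_continuous_real continuous_intros c V Z)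
  also have "\<dots> = c * integral {0..pi} (\<lambda>x. ?k x *\<^sub>R V (rad E L x)) + d * integral {0..pi} (\<lambda>x. ?k x *\<^sub>R Z (rad E L x))"
    by (simp only: Henstock_Kurzweil_Integration.integral_mult_right)
  finally show ?thesis
    unfolding fourier_coeff_DA[OF C1_lincomb(1)[OF V Z R_min_max(3)] z] fourier_coeff_DA[OF V z] fourier_coeff_DA[OF Z z]
    by (simp add: algebra_simps)
qed

text \<open>The solution x of rad E L x = R in closed form. It makes the angle at R visibly
  continuous in R and the orbit together.\<close>

definition anomaly :: "real \<Rightarrow> real \<Rightarrow> real \<Rightarrow> real" where
  "anomaly R E L = arccos ((r_minus E L + r_plus E L - 2 * R) / (r_plus E L - r_minus E L))"

lemma anomaly_arg:
  assumes R: "0 < R" and x: "(E, L) \<in> D R"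
  shows "(r_minus E L + r_plus E L - 2 * R) / (r_plus E L - r_minus E L) \<in> {-1..1}"
  using D_orbit(3,4)[OF R x] by (simp add: field_simps)

lemma angle_at_anomaly:
  assumes R: "0 < R" and x: "(E, L) \<in> D R"
  shows "angle_at R E L = tau E L (anomaly R E L)" "anomaly R E L \<in> {0..pi}"
proof -
  have a: "cos (anomaly R E L) = (r_minus E L + r_plus E L - 2 * R) / (r_plus E L - r_minus E L)" "anomaly R E L \<in> {0..pi}"
    unfolding anomaly_def using anomaly_arg[OF R x] by (auto simp: cos_arccos arccos_lbound arccos_ubound)
  have "rad E L (anomaly R E L) = R"
  proof -
    have *: "cos (anomaly R E L) * (r_plus E L - r_minus E L) = r_minus E L + r_plus E L - 2 * R"
      unfolding a(1) using D_orbit(3,4)[OF R x] by simp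
    have "rad E L (anomaly R E L) = (r_minus E L + r_plus E L - cos (anomaly R E L) * (r_plus E L - r_minus E L)) / 2"
      by (simp add: rad_def field_simps)
    then show ?thesis unfolding * by simp
  qed
  then show "angle_at R E L = tau E L (anomaly R E L)" "anomaly R E L \<in> {0..pi}"
    using angle_at_rad[OF D_dom[OF R x] a(2)] a(2) by auto
qed

lemma continuous_angle_at:
  "continuous_on {(R, z). 0 < R \<and> z \<in> D R} (\<lambda>w. angle_at (fst w) (fst (snd w)) (snd (snd w)))"
proof -
  let ?T = "{(R, z). 0 < R \<and> z \<in> D R}"
  have sub: "snd w \<in> dom" if "w \<in> ?T" for w using that D_dom by auto
  have roots: "continuous_on ?T (\<lambda>w. r_minus (fst (snd w)) (snd (snd w)))" "continuous_on ?T (\<lambda>w. r_plus (fst (snd w)) (snd (snd w)))"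
    using sub by (auto intro!: continuous_on_compose2[OF continuous_roots(1)] continuous_on_compose2[OF continuous_roots(2)] continuous_intros)
  have ne: "r_plus (fst (snd w)) (snd (snd w)) - r_minus (fst (snd w)) (snd (snd w)) \<noteq> 0" if "w \<in> ?T" for w
    using turning_points(2)[of "fst (snd w)" "snd (snd w)"] sub[OF that] by simp
  have "continuous_on ?T (\<lambda>w. anomaly (fst w) (fst (snd w)) (snd (snd w)))"
    unfolding anomaly_def
    using anomaly_arg ne by (intro continuous_on_arccos continuous_on_divide continuous_intros roots) auto
  then have "continuous_on ?T (\<lambda>w. tau (fst (snd w)) (snd (snd w)) (anomaly (fst w) (fst (snd w)) (snd (snd w))))"
  proof -
    assume an: "continuous_on ?T (\<lambda>w. anomaly (fst w) (fst (snd w)) (snd (snd w)))"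
    have h: "continuous_on ?T (\<lambda>w. (snd w, anomaly (fst w) (fst (snd w)) (snd (snd w))))"
      by (intro continuous_on_Pair an continuous_on_snd continuous_on_id)
    have im: "(\<lambda>w. (snd w, anomaly (fst w) (fst (snd w)) (snd (snd w)))) ` ?T \<subseteq> dom \<times> {0..}"
    proof
      fix y assume "y \<in> (\<lambda>w. (snd w, anomaly (fst w) (fst (snd w)) (snd (snd w)))) ` ?T"
      then obtain w where w: "w \<in> ?T" "y = (snd w, anomaly (fst w) (fst (snd w)) (snd (snd w)))" by blast
      then show "y \<in> dom \<times> {0..}"
        using sub[OF w(1)] angle_at_anomaly(2)[of "fst w" "fst (snd w)" "snd (snd w)"] by auto
    qed
    from continuous_on_compose2[OF continuous_tau_joint h im] show ?thesis by simp
  qed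
  then show ?thesis
    by (rule continuous_on_eq) (auto simp: angle_at_anomaly)
qed

definition den :: "real \<Rightarrow> real \<Rightarrow> real \<Rightarrow> int \<Rightarrow> real \<times> real \<Rightarrow> complex" where
  "den s lam \<epsilon> m z = of_real (omega (fst z) (snd z)) + (of_real lam + of_real s * \<i> * of_real \<epsilon>) / (2 * of_real pi * of_int m)"

lemma den_bound:
  assumes "s \<in> {1, -1}" "0 < \<epsilon>" "m \<noteq> 0"
  shows "\<epsilon> / (2 * pi * \<bar>of_int m\<bar>) \<le> norm (den s lam \<epsilon> m z)" "den s lam \<epsilon> m z \<noteq> 0"
proof -
  have "Im (den s lam \<epsilon> m z) = s * \<epsilon> / (2 * pi * of_int m)"
  proof -
    have "(2 * of_real pi * of_int m :: complex) = of_real (2 * pi * of_int m)" by simp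
    then show ?thesis unfolding den_def by (simp only: Im_divide_of_real) (simp)
  qed
  then have "\<bar>Im (den s lam \<epsilon> m z)\<bar> = \<epsilon> / (2 * pi * \<bar>of_int m\<bar>)"
    using assms by (auto simp: abs_mult abs_divide)
  then show 1: "\<epsilon> / (2 * pi * \<bar>of_int m\<bar>) \<le> norm (den s lam \<epsilon> m z)"
    using abs_Im_le_cmod[of "den s lam \<epsilon> m z"] by simp
  have "0 < \<epsilon> / (2 * pi * \<bar>of_int m\<bar>)" using assms by simp
  then have "0 < norm (den s lam \<epsilon> m z)" using 1 by linarith
  then show "den s lam \<epsilon> m z \<noteq> 0" by simp
qed

lemma continuous_den: "continuous_on DA (den s lam \<epsilon> m)"
proof -
  have "continuous_on dom (\<lambda>z. omega (fst z) (snd z))"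
    using has_derivative_continuous[OF omega_has_derivative] by (auto intro!: continuous_at_imp_continuous_on)
  then have "continuous_on DA (\<lambda>z. omega (fst z) (snd z))"
    by (rule continuous_on_subset) (auto simp: DA_def)
  then show ?thesis unfolding den_def by (intro continuous_intros)
qed

text \<open>The Plemelj integrand pulled back to (E, L), with the product of \<open>q\<close> and
  the Jacobian already replaced by |phi'|.\<close>

definition Pl_density :: "real \<Rightarrow> real \<Rightarrow> real \<Rightarrow> int \<Rightarrow> (real \<Rightarrow> complex) \<Rightarrow> real \<Rightarrow> real \<times> real \<Rightarrow> complex" where
  "Pl_density s lam \<epsilon> m V R z = of_real \<bar>phi' (fst z) (snd z)\<bar> *
     (fourier_coeff V m (fst z) (snd z) * of_real (S m (angle_at R (fst z) (snd z)))) / den s lam \<epsilon> m z"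

text \<open>\<open>action_of\<close> chooses a preimage in \<open>yz_domain R\<close>, which also
  contains the points with z = 0, while injectivity is known on \<open>D R\<close>. As z is itself a
  coordinate, any preimage of a point with z > 0 has z > 0 and thus lies in
  \<open>D R\<close>.\<close>

lemma action_of_yz:
  assumes R: "0 < R" and x: "x \<in> D R"
  shows "action_of R (yz R x) = x"
proof -
  have D: "D R = {(E, L) \<in> action_set. Psi L R < E}" by (rule D_action_set[OF R])
  have "x \<in> yz_domain R" using x unfolding D yz_domain_def by auto
  then have im: "yz R x \<in> yz R ` yz_domain R" by blast
  let ?y = "action_of R (yz R x)"
  have y: "?y \<in> yz_domain R" "yz R ?y = yz R x"
    unfolding action_of_def using inv_into_into[OF im] f_inv_into_f[OF im] by auto
  have "snd (yz R ?y) = snd (yz R x)" using y(2) by simp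
  then have "?y \<in> D R"
    using y(1) x unfolding D by (auto simp: yz_def yz_domain_def split: prod.splits)
  then show ?thesis using yz_inj[OF R] x y(2) by (auto simp: inj_on_def)
qed

lemma J_eq: assumes R: "0 < R" shows "J R = yz R ` D R"
proof -
  have D: "D R = {(E, L) \<in> action_set. Psi L R < E}" by (rule D_action_set[OF R])
  show ?thesis
  proof (intro subset_antisym subsetI)
    fix p assume p: "p \<in> J R"
    then have im: "p \<in> yz R ` yz_domain R" by (simp add: J_def)
    have "action_of R p \<in> yz_domain R" "yz R (action_of R p) = p"
      unfolding action_of_def using inv_into_into[OF im] f_inv_into_f[OF im] by auto
    moreover have "case action_of R p of (E, L) \<Rightarrow> Psi L R < E" using p by (simp add: J_def)
    ultimately have "action_of R p \<in> D R" unfolding D yz_domain_def by auto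
    then show "p \<in> yz R ` D R" using \<open>yz R (action_of R p) = p\<close> by force
  next
    fix p assume "p \<in> yz R ` D R"
    then obtain x where x: "x \<in> D R" "p = yz R x" by blast
    then have "p \<in> yz R ` yz_domain R" unfolding D yz_domain_def by auto
    then show "p \<in> J R"
      unfolding J_def using action_of_yz[OF R x(1)] x by (auto simp: D_def)
  qed
qed

lemma S_bound: "\<bar>S m t\<bar> \<le> 1"
  by (simp add: S_def)

text \<open>The size of m enters through the imaginary part of the denominator, which is epsilon /
  (2 pi |m|). The resulting factor |m| cancels against 1/m in \<open>F_term\<close>.\<close>

lemma Pl_density_bound:
  assumes se: "s \<in> {1, -1}" "0 < \<epsilon>" "m \<noteq> 0" and z: "z \<in> DA"
  shows "norm (Pl_density s lam \<epsilon> m V R z) \<le>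
    2 * pi * \<bar>of_int m\<bar> / \<epsilon> * phi'_max * norm (fourier_coeff V m (fst z) (snd z))"
proof -
  have "norm (Pl_density s lam \<epsilon> m V R z) = \<bar>phi' (fst z) (snd z)\<bar> *
     (norm (fourier_coeff V m (fst z) (snd z)) * \<bar>S m (angle_at R (fst z) (snd z))\<bar>) / norm (den s lam \<epsilon> m z)"
    by (simp add: Pl_density_def norm_mult norm_divide)
  also have "\<dots> \<le> phi'_max * (norm (fourier_coeff V m (fst z) (snd z)) * 1) / (\<epsilon> / (2 * pi * \<bar>of_int m\<bar>))"
    using phi'_bound[of "fst z" "snd z"] z S_bound den_bound(1)[OF se] se phi'_max_nonneg
    by (intro frac_le mult_mono) (auto intro!: mult_nonneg_nonneg)
  also have "\<dots> = 2 * pi * \<bar>of_int m\<bar> / \<epsilon> * phi'_max * norm (fourier_coeff V m (fst z) (snd z))"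
    by (simp add: field_simps)
  finally show ?thesis .
qed

lemma Box_lmeasurable: "Box \<in> lmeasurable"
  unfolding Box_def by (rule lmeasurable_cbox)

lemma DA_lmeasurable: "DA \<in> lmeasurable" and D_lmeasurable: "0 < R \<Longrightarrow> D R \<in> lmeasurable"
  using DA_borel D_borel[of R] DA_Box D_subset_DA[of R] Box_lmeasurable
  by (auto intro!: fmeasurableI2[of Box lebesgue])

lemma fourier_coeff_integrable:
  assumes V: "V \<in> C1 R_min R_max" and m: "m \<noteq> 0"
  shows "set_integrable lebesgue DA (\<lambda>z. norm (fourier_coeff V m (fst z) (snd z)))"
proof (rule measurable_bounded_by_integrable_imp_absolutely_integrable)
  show "(\<lambda>z. norm (fourier_coeff V m (fst z) (snd z))) \<in> borel_measurable (lebesgue_on DA)"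
    using DA_borel by (intro continuous_imp_measurable_on_sets_lebesgue continuous_intros continuous_fourier_coeff V) auto
  show "(\<lambda>z. fourier_const * C1_norm R_min R_max V) integrable_on DA"
    by (rule integrable_on_const[OF DA_lmeasurable])
  show "norm (norm (fourier_coeff V m (fst z) (snd z))) \<le> fourier_const * C1_norm R_min R_max V" if z: "z \<in> DA" for z
  proof -
    obtain R where R: "0 < R" "z \<in> D R" using DA_D[OF z] .
    then show ?thesis
      using fourier_coeff_sum_bound[of R "fst z" "snd z" V "{m}"] V m by simp
  qed
qed (use DA_borel in auto)

lemma continuous_Pl_density:
  assumes R: "0 < R" and V: "V \<in> C1 R_min R_max" and se: "s \<in> {1, -1}" "0 < \<epsilon>" "m \<noteq> 0"
  shows "continuous_on (D R) (Pl_density s lam \<epsilon> m V R)"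
proof -
  note sub = D_subset_DA[OF R]
  have "continuous_on (D R) (\<lambda>z. angle_at R (fst z) (snd z))"
  proof -
    have h: "continuous_on (D R) (\<lambda>z. (R, z))" by (intro continuous_intros)
    have im: "(\<lambda>z. (R, z)) ` D R \<subseteq> {(R, z). 0 < R \<and> z \<in> D R}" using R by auto
    from continuous_on_compose2[OF continuous_angle_at h im] show ?thesis by simp
  qed
  then show ?thesis
    unfolding Pl_density_def S_def using den_bound(2)[OF se]
    by (intro continuous_on_divide continuous_intros continuous_phi'
        continuous_on_subset[OF continuous_fourier_coeff[OF V] sub] continuous_on_subset[OF continuous_den sub]) auto
qed

lemma Pl_density_integrable:
  assumes R: "0 < R" and V: "V \<in> C1 R_min R_max" and se: "s \<in> {1, -1}" "0 < \<epsilon>" "m \<noteq> 0"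
  shows "set_integrable lebesgue (D R) (Pl_density s lam \<epsilon> m V R)"
proof (rule measurable_bounded_by_integrable_imp_absolutely_integrable)
  show "Pl_density s lam \<epsilon> m V R \<in> borel_measurable (lebesgue_on (D R))"
    using D_borel by (intro continuous_imp_measurable_on_sets_lebesgue continuous_Pl_density assms) auto
  have "(\<lambda>z. norm (fourier_coeff V m (fst z) (snd z))) absolutely_integrable_on D R"
    by (rule set_integrable_subset[OF fourier_coeff_integrable[OF V se(3)]]) (use D_borel D_subset_DA[OF R] in auto)
  then show "(\<lambda>z. 2 * pi * \<bar>of_int m\<bar> / \<epsilon> * phi'_max * norm (fourier_coeff V m (fst z) (snd z))) integrable_on D R"
    by (intro integrable_on_mult_right set_lebesgue_integral_eq_integral(1))
  show "norm (Pl_density s lam \<epsilon> m V R z) \<le> 2 * pi * \<bar>of_int m\<bar> / \<epsilon> * phi'_max * norm (fourier_coeff V m (fst z) (snd z))"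
    if "z \<in> D R" for z
    using that D_subset_DA[OF R] by (intro Pl_density_bound[OF se]) auto
qed (use D_borel in auto)

text \<open>The weight \<open>q\<close> cancels the Jacobian of the change of variables \<open>yz\<close>.\<close>

lemma Pl_eq:
  assumes R: "0 < R" and V: "V \<in> C1 R_min R_max" and se: "s \<in> {1, -1}" "0 < \<epsilon>" "m \<noteq> 0"
  shows "set_integrable lebesgue (J R) (Pl_integrand s lam \<epsilon> m q_yz (VS_yz V m) R)"
    and "Pl s lam \<epsilon> m q_yz (VS_yz V m) R = (LINT z:D R|lebesgue. Pl_density s lam \<epsilon> m V R z)"
proof -
  let ?f = "Pl_integrand s lam \<epsilon> m q_yz (VS_yz V m) R"
  define a b where "a z = deriv (\<lambda>e. omega e (snd z)) (fst z)" and "b z = deriv (\<lambda>l. omega (fst z) l) (snd z)" for z :: "real \<times> real"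
  let ?det = "\<lambda>z. \<bar>a z * (- (1 / (2 * R\<^sup>2))) - b z * 1\<bar>"
  have cancel: "?det z *\<^sub>R ?f (yz R z) = Pl_density s lam \<epsilon> m V R z" if z: "z \<in> D R" for z
  proof -
    obtain E L where EL: "z = (E, L)" by (cases z)
    have det: "?det z = \<bar>P R omega E L\<bar>"
      unfolding P_def a_def b_def EL by (simp add: abs_minus_commute algebra_simps flip: abs_minus_cancel[of "- x - y" for x y])
    have "P R omega E L \<noteq> 0" using P_omega(2)[OF R] z EL by (metis less_irrefl)
    then have "?det z * q R E L = \<bar>phi' E L\<bar>" unfolding det q_def by simp
    then have "?det z *\<^sub>R (of_real (q R E L) * X / Y) = of_real \<bar>phi' E L\<bar> * X / Y" for X Y :: complex
      by (simp add: scaleR_conv_of_real mult.assoc[symmetric] flip: of_real_mult)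
    moreover have "yz R z = (omega E L, E - Psi L R)" by (simp add: EL yz_def)
    moreover have "q_yz R (yz R z) = q R E L" "VS_yz V m R (yz R z) = fourier_coeff V m E L * of_real (S m (angle_at R E L))"
      using action_of_yz[OF R z] by (simp_all add: q_yz_def VS_yz_def EL)
    ultimately show ?thesis
      unfolding Pl_integrand_def Pl_density_def den_def by (simp add: EL)
  qed
  have der: "(yz R has_derivative (\<lambda>h. (a z * fst h + b z * snd h, 1 * fst h + (- (1 / (2 * R\<^sup>2))) * snd h))) (at z within D R)"
    if "z \<in> D R" for z
    using yz_has_derivative[OF R, of "fst z" "snd z" "D R"] that by (simp add: a_def b_def)
  have int: "set_integrable lebesgue (D R) (\<lambda>z. ?det z *\<^sub>R ?f (yz R z))"
    using Pl_density_integrable[OF assms]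
    by (subst set_integrable_cong[OF refl refl cancel]) auto
  note cov = change_of_variables_plane[OF D_borel der yz_inj[OF R] int]
  show "set_integrable lebesgue (J R) ?f" unfolding J_eq[OF R] by (rule cov(1))
  have "Pl s lam \<epsilon> m q_yz (VS_yz V m) R = (LINT z:D R|lebesgue. ?det z *\<^sub>R ?f (yz R z))"
    unfolding Pl_def J_eq[OF R] by (rule cov(2))
  also have "\<dots> = (LINT z:D R|lebesgue. Pl_density s lam \<epsilon> m V R z)"
    by (intro set_lebesgue_integral_cong allI impI cancel) (use D_borel in auto)
  finally show "Pl s lam \<epsilon> m q_yz (VS_yz V m) R = (LINT z:D R|lebesgue. Pl_density s lam \<epsilon> m V R z)" .
qed

text \<open>These numbers are the weights for the M-test: they do not depend on R, and
  \<open>fourier_mass_sum\<close> makes them summable in m.\<close>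

definition fourier_mass :: "(real \<Rightarrow> complex) \<Rightarrow> int \<Rightarrow> real" where
  "fourier_mass V m = (LINT z:DA|lebesgue. norm (fourier_coeff V m (fst z) (snd z)))"

lemma Pl_bound:
  assumes R: "0 < R" and V: "V \<in> C1 R_min R_max" and se: "s \<in> {1, -1}" "0 < \<epsilon>" "m \<noteq> 0"
  shows "norm (Pl s lam \<epsilon> m q_yz (VS_yz V m) R) \<le> 2 * pi * \<bar>of_int m\<bar> / \<epsilon> * phi'_max * fourier_mass V m"
proof -
  let ?c = "2 * pi * \<bar>of_int m\<bar> / \<epsilon> * phi'_max"
  have c: "0 \<le> ?c" using phi'_max_nonneg se by simp
  have "norm (Pl s lam \<epsilon> m q_yz (VS_yz V m) R) \<le> (LINT z|lebesgue. norm (indicator (D R) z *\<^sub>R Pl_density s lam \<epsilon> m V R z))"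
    unfolding Pl_eq(2)[OF assms] set_lebesgue_integral_def by (rule integral_norm_bound)
  also have "\<dots> \<le> (LINT z|lebesgue. ?c * (indicator DA z *\<^sub>R norm (fourier_coeff V m (fst z) (snd z))))"
  proof (rule integral_mono)
    show "integrable lebesgue (\<lambda>z. norm (indicator (D R) z *\<^sub>R Pl_density s lam \<epsilon> m V R z))"
      using Pl_density_integrable[OF assms] by (intro integrable_norm) (simp add: set_integrable_def)
    show "integrable lebesgue (\<lambda>z. ?c * (indicator DA z *\<^sub>R norm (fourier_coeff V m (fst z) (snd z))))"
      using fourier_coeff_integrable[OF V se(3)] by (intro integrable_mult_right) (simp add: set_integrable_def)
    show "norm (indicator (D R) z *\<^sub>R Pl_density s lam \<epsilon> m V R z) \<le> ?c * (indicator DA z *\<^sub>R norm (fourier_coeff V m (fst z) (snd z)))" for z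
    proof (cases "z \<in> D R")
      case True
      then show ?thesis using Pl_density_bound[OF se, of z lam V R] D_subset_DA[OF R] by auto
    next
      case False
      have "0 \<le> ?c * (indicator DA z *\<^sub>R norm (fourier_coeff V m (fst z) (snd z)))"
        by (rule mult_nonneg_nonneg[OF c]) simp
      then show ?thesis using False by simp
    qed
  qed
  also have "\<dots> = ?c * fourier_mass V m"
    by (simp add: fourier_mass_def set_lebesgue_integral_def)
  finally show ?thesis .
qed

text \<open>\<open>fourier_const\<close> times an upper bound for the area of the box of admissible
  (E, L).\<close>

definition mass_const :: real where
  "mass_const = fourier_const * ((M / A) * (2 * M * B))"

lemma measure_DA: "measure lebesgue DA \<le> (M / A) * (2 * M * B)"
proof (cases "Box = {}")
  case False
  have "measure lebesgue DA \<le> measure lebesgue Box"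
    using DA_Box DA_borel Box_lmeasurable by (intro measure_mono_fmeasurable) auto
  also have "\<dots> = (E0 - (U 0 - M / A)) * (2 * M * B - L0)"
  proof -
    have "measure lebesgue Box = measure lborel Box"
      by (rule measure_completion) (simp add: Box_def)
    also have "\<dots> = measure lborel (cbox (U 0 - M / A) E0) * measure lborel (cbox L0 (2 * M * B))"
      unfolding Box_def by (rule content_Pair)
    finally show ?thesis using False by (auto simp: Box_def cbox_Pair_eq)
  qed
  also have "\<dots> \<le> (M / A) * (2 * M * B)"
  proof -
    have "U 0 - M / A \<le> E0" "L0 \<le> 2 * M * B" using False by (auto simp: Box_def cbox_Pair_eq)
    then show ?thesis using params A_pos B_pos E0_eq by (intro mult_mono) auto
  qed
  finally show ?thesis .
next
  case True
  then have "DA = {}" using DA_Box by auto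
  then show ?thesis using params A_pos B_pos by simp
qed

lemma fourier_mass_nonneg: "0 \<le> fourier_mass V m"
  unfolding fourier_mass_def set_lebesgue_integral_def by (intro Bochner_Integration.integral_nonneg) auto

lemma fourier_mass_sum:
  assumes V: "V \<in> C1 R_min R_max" and X: "finite X" "(0::int) \<notin> X"
  shows "(\<Sum>m\<in>X. fourier_mass V m) \<le> mass_const * C1_norm R_min R_max V"
proof -
  let ?b = "fourier_const * C1_norm R_min R_max V"
  have b: "0 \<le> ?b" using fourier_const_nonneg C1_norm_nonneg[OF V R_min_max(3)] by simp
  have int: "integrable lebesgue (\<lambda>z. indicator DA z *\<^sub>R norm (fourier_coeff V m (fst z) (snd z)))" if "m \<in> X" for m
    using fourier_coeff_integrable[OF V, of m] that X by (auto simp: set_integrable_def)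
  have "(\<Sum>m\<in>X. fourier_mass V m) = (LINT z|lebesgue. (\<Sum>m\<in>X. indicator DA z *\<^sub>R norm (fourier_coeff V m (fst z) (snd z))))"
    unfolding fourier_mass_def set_lebesgue_integral_def using int by (intro Bochner_Integration.integral_sum[symmetric])
  also have "\<dots> \<le> (LINT z|lebesgue. ?b * indicator DA z)"
  proof (rule integral_mono)
    show "integrable lebesgue (\<lambda>z. \<Sum>m\<in>X. indicator DA z *\<^sub>R norm (fourier_coeff V m (fst z) (snd z)))"
      using int by (rule Bochner_Integration.integrable_sum)
    show "integrable lebesgue (\<lambda>z. ?b * indicator DA z)"
      using DA_lmeasurable by (intro integrable_mult_right integrable_real_indicator) (auto simp: fmeasurable_def)
    show "(\<Sum>m\<in>X. indicator DA z *\<^sub>R norm (fourier_coeff V m (fst z) (snd z))) \<le> ?b * indicator DA z" for z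
    proof (cases "z \<in> DA")
      case True
      obtain R where R: "0 < R" "z \<in> D R" using DA_D[OF True] .
      then show ?thesis
        using fourier_coeff_sum_bound[of R "fst z" "snd z" V X] V X True by simp
    qed simp
  qed
  also have "\<dots> = ?b * measure lebesgue DA"
    using DA_lmeasurable by simp
  also have "\<dots> \<le> ?b * ((M / A) * (2 * M * B))"
    by (rule mult_left_mono[OF measure_DA b])
  finally show ?thesis by (simp add: mass_const_def mult_ac)
qed

text \<open>Dominated convergence on the common domain \<open>DA\<close>, after extension by 0. The
  integrand is continuous in R, and the moving domain \<open>D R\<close> is harmless because its
  indicator converges off the line E = Psi L R.\<close>

lemma Pl_continuous:
  assumes V: "V \<in> C1 R_min R_max" and se: "s \<in> {1, -1}" "0 < \<epsilon>" "m \<noteq> 0"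
  shows "continuous_on {R_min..R_max} (\<lambda>R. Pl s lam \<epsilon> m q_yz (VS_yz V m) R)"
proof (rule continuous_on_sequentiallyI)
  fix u :: "nat \<Rightarrow> real" and R
  assume u: "\<forall>n. u n \<in> {R_min..R_max}" and R: "R \<in> {R_min..R_max}" and lim: "u \<longlonglongrightarrow> R"
  have pos: "0 < R" "\<And>n. 0 < u n" using R u R_min_max(4) by (auto intro: less_le_trans)
  let ?c = "2 * pi * \<bar>of_int m\<bar> / \<epsilon> * phi'_max"
  have c: "0 \<le> ?c" using phi'_max_nonneg se by simp
  let ?h = "\<lambda>R z. indicator (D R) z *\<^sub>R Pl_density s lam \<epsilon> m V R z"
  have int: "integrable lebesgue (?h R)" if "0 < R" for R
    using Pl_density_integrable[OF that assms] by (simp add: set_integrable_def)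
  have "(\<lambda>n. LINT z|lebesgue. ?h (u n) z) \<longlonglongrightarrow> (LINT z|lebesgue. ?h R z)"
  proof (rule integral_dominated_convergence)
    show "?h R \<in> borel_measurable lebesgue" by (rule borel_measurable_integrable[OF int[OF pos(1)]])
    show "?h (u n) \<in> borel_measurable lebesgue" for n by (rule borel_measurable_integrable[OF int[OF pos(2)]])
    show "integrable lebesgue (\<lambda>z. ?c * (indicator DA z *\<^sub>R norm (fourier_coeff V m (fst z) (snd z))))"
      using fourier_coeff_integrable[OF V se(3)] by (intro integrable_mult_right) (simp add: set_integrable_def)
    show "AE z in lebesgue. norm (?h (u n) z) \<le> ?c * (indicator DA z *\<^sub>R norm (fourier_coeff V m (fst z) (snd z)))" for n
    proof (intro AE_I2)
      fix z
      show "norm (?h (u n) z) \<le> ?c * (indicator DA z *\<^sub>R norm (fourier_coeff V m (fst z) (snd z)))"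
      proof (cases "z \<in> D (u n)")
        case True
        then have "z \<in> DA" using D_subset_DA[OF pos(2)[of n]] by blast
        then show ?thesis using Pl_density_bound[OF se, of z lam V "u n"] True by simp
      next
        case False
        have "0 \<le> ?c * (indicator DA z *\<^sub>R norm (fourier_coeff V m (fst z) (snd z)))"
          by (rule mult_nonneg_nonneg[OF c]) simp
        then show ?thesis using False by simp
      qed
    qed
    \<comment> \<open>Psi is affine in L, so the exceptional set is a line in the (E, L) plane and
      has measure zero.\<close>
    have "negligible {z. (1 :: real, - (1 / (2 * R\<^sup>2))) \<bullet> z = U R - M / R}"
      by (rule negligible_hyperplane) (simp add: zero_prod_def)
    then have "AE z in lebesgue. z \<notin> {z. (1 :: real, - (1 / (2 * R\<^sup>2))) \<bullet> z = U R - M / R}"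
      by (intro AE_not_in) (simp add: negligible_iff_null_sets)
    then show "AE z in lebesgue. (\<lambda>n. ?h (u n) z) \<longlonglongrightarrow> ?h R z"
    proof eventually_elim
      case (elim z)
      obtain E L where z: "z = (E, L)" by (cases z)
      have ne: "E \<noteq> Psi L R" using elim by (auto simp: z Psi_def)
      have Pc: "(\<lambda>n. Psi L (u n)) \<longlonglongrightarrow> Psi L R"
        using continuous_on_tendsto_compose[OF continuous_Psi lim] pos by auto
      show ?case
      proof (cases "z \<in> D R")
        case True
        then have "Psi L R < E" by (simp add: z D_def)
        then have ev: "\<forall>\<^sub>F n in sequentially. Psi L (u n) < E" using order_tendstoD(2)[OF Pc] by simp
        then have evD: "\<forall>\<^sub>F n in sequentially. z \<in> D (u n)"
          by eventually_elim (use True in \<open>auto simp: z D_def\<close>)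
        have "(\<lambda>n. angle_at (fst (u n, z)) (fst (snd (u n, z))) (snd (snd (u n, z))))
            \<longlonglongrightarrow> angle_at (fst (R, z)) (fst (snd (R, z))) (snd (snd (R, z)))"
          by (rule continuous_on_tendsto_compose[OF continuous_angle_at])
            (use lim True pos evD in \<open>auto intro!: tendsto_intros elim!: eventually_mono\<close>)
        then have "(\<lambda>n. Pl_density s lam \<epsilon> m V (u n) z) \<longlonglongrightarrow> Pl_density s lam \<epsilon> m V R z"
          unfolding Pl_density_def S_def by (intro tendsto_intros den_bound(2)[OF se]) simp
        moreover have "\<forall>\<^sub>F n in sequentially. Pl_density s lam \<epsilon> m V (u n) z = ?h (u n) z"
          using evD by eventually_elim simp
        ultimately show ?thesis using True by (auto intro: Lim_transform_eventually)
      next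
        case False
        have "\<forall>\<^sub>F n in sequentially. z \<notin> D (u n)"
        proof (cases "L0 \<le> L \<and> E \<le> E0")
          case True
          then have "E < Psi L R" using False ne by (auto simp: z D_def)
          then have "\<forall>\<^sub>F n in sequentially. E < Psi L (u n)" using order_tendstoD(1)[OF Pc] by simp
          then show ?thesis by eventually_elim (auto simp: z D_def)
        qed (auto simp: z D_def)
        then have "\<forall>\<^sub>F n in sequentially. ?h (u n) z = 0" by eventually_elim simp
        then show ?thesis using False by (simp add: tendsto_eventually)
      qed
    qed
  qed
  then show "(\<lambda>n. Pl s lam \<epsilon> m q_yz (VS_yz V m) (u n)) \<longlonglongrightarrow> Pl s lam \<epsilon> m q_yz (VS_yz V m) R"
    using pos by (simp add: Pl_eq(2)[OF _ assms] set_lebesgue_integral_def)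
qed

lemma Pl_lincomb:
  assumes R: "0 < R" and V: "V \<in> C1 R_min R_max" and Z: "Z \<in> C1 R_min R_max" and se: "s \<in> {1, -1}" "0 < \<epsilon>" "m \<noteq> 0"
  shows "Pl s lam \<epsilon> m q_yz (VS_yz (\<lambda>r. c * V r + d * Z r) m) R =
    c * Pl s lam \<epsilon> m q_yz (VS_yz V m) R + d * Pl s lam \<epsilon> m q_yz (VS_yz Z m) R"
proof -
  let ?h = "\<lambda>V z. indicator (D R) z *\<^sub>R Pl_density s lam \<epsilon> m V R z"
  have int: "integrable lebesgue (?h V)" if "V \<in> C1 R_min R_max" for V
    using Pl_density_integrable[OF R that se] by (simp add: set_integrable_def)
  have e: "?h (\<lambda>r. c * V r + d * Z r) z = c * ?h V z + d * ?h Z z" for z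
  proof (cases "z \<in> D R")
    case True
    then have "(fst z, snd z) \<in> DA" using D_subset_DA[OF R] by auto
    from fourier_coeff_lincomb[OF V Z this] True show ?thesis
      by (simp add: Pl_density_def algebra_simps add_divide_distrib)
  qed simp
  have "(LINT z|lebesgue. ?h (\<lambda>r. c * V r + d * Z r) z) = (LINT z|lebesgue. c * ?h V z) + (LINT z|lebesgue. d * ?h Z z)"
    unfolding e by (intro Bochner_Integration.integral_add integrable_mult_right int V Z)
  then show ?thesis
    unfolding Pl_eq(2)[OF R V se] Pl_eq(2)[OF R Z se] Pl_eq(2)[OF R C1_lincomb(1)[OF V Z R_min_max(3)] se] set_lebesgue_integral_def
    by (simp only: integral_mult_right_zero)
qed

end

subsection \<open>Invertibility\<close>

context near_kepler
begin

text \<open>The product of 4 pi / R^2 <= 4 pi / A^2 and the factor 2 pi * \<open>phi'_max\<close>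
  from the bound on the Plemelj operator.\<close>

definition radial_const :: real where
  "radial_const = 8 * pi\<^sup>2 * phi'_max / A\<^sup>2"

text \<open>In the last factor, 1 accounts for the derivative of \<open>K V\<close>, and B, which
  bounds the length of the interval, for its values.\<close>

definition op_const :: real where
  "op_const = radial_const * mass_const * (B + 1)"

definition radial_term :: "real \<Rightarrow> real \<Rightarrow> real \<Rightarrow> (real \<Rightarrow> complex) \<Rightarrow> int \<Rightarrow> real \<Rightarrow> complex" where
  "radial_term s lam \<epsilon> V m R = 1 / of_int m * F_radial s lam \<epsilon> m V R"

text \<open>Minus the derivative of \<open>K V\<close>: the sum is taken before the integration over
  r.\<close>

definition radial_sum :: "real \<Rightarrow> real \<Rightarrow> real \<Rightarrow> (real \<Rightarrow> complex) \<Rightarrow> real \<Rightarrow> complex" where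
  "radial_sum s lam \<epsilon> V R = (\<Sum>\<^sub>\<infinity>m\<in>{m. m \<noteq> 0}. radial_term s lam \<epsilon> V m R)"

definition K :: "real \<Rightarrow> real \<Rightarrow> real \<Rightarrow> (real \<Rightarrow> complex) \<Rightarrow> real \<Rightarrow> complex" where
  "K s lam \<epsilon> V R = (if R \<in> {R_min..R_max} then \<Sum>\<^sub>\<infinity>m\<in>{m. m \<noteq> 0}. F_term s lam \<epsilon> m V R else 0)"

lemma R_pos: "R \<in> {R_min..R_max} \<Longrightarrow> 0 < R"
  using R_min_max(4) by auto

lemma radial_const_nonneg: "0 \<le> radial_const"
  using phi'_max_nonneg by (simp add: radial_const_def)

lemma mass_const_nonneg: "0 \<le> mass_const"
  unfolding mass_const_def using fourier_const_nonneg A_pos B_pos params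
  by (intro mult_nonneg_nonneg divide_nonneg_nonneg) auto

lemma fourier_mass_summable:
  assumes V: "V \<in> C1 R_min R_max"
  shows "fourier_mass V summable_on {m. m \<noteq> 0}"
proof (rule nonneg_bdd_above_summable_on)
  show "bdd_above (sum (fourier_mass V) ` {X. X \<subseteq> {m. m \<noteq> 0} \<and> finite X})"
    using fourier_mass_sum[OF V] by (intro bdd_aboveI[of _ "mass_const * C1_norm R_min R_max V"]) auto
qed (rule fourier_mass_nonneg)

context
  fixes s lam \<epsilon> :: real
  assumes se: "s \<in> {1, -1}" "0 < \<epsilon>"
begin

lemma continuous_F_radial:
  assumes V: "V \<in> C1 R_min R_max" and m: "m \<noteq> 0"
  shows "continuous_on {R_min..R_max} (F_radial s lam \<epsilon> m V)"
  unfolding F_radial_def using R_pos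
  by (intro continuous_on_mult Pl_continuous[OF V se m] continuous_on_of_real continuous_on_divide continuous_intros) force

lemma radial_term_bound:
  assumes V: "V \<in> C1 R_min R_max" and m: "m \<noteq> 0" and R: "R \<in> {R_min..R_max}"
  shows "norm (radial_term s lam \<epsilon> V m R) \<le> radial_const / \<epsilon> * fourier_mass V m"
proof -
  note Rp = R_pos[OF R]
  have "norm (radial_term s lam \<epsilon> V m R) = 1 / \<bar>of_int m\<bar> * (4 * pi / R\<^sup>2 * norm (Pl s lam \<epsilon> m q_yz (VS_yz V m) R))"
    unfolding radial_term_def F_radial_def norm_mult norm_of_real using m by (simp add: norm_divide norm_mult)
  also have "\<dots> \<le> 1 / \<bar>of_int m\<bar> * (4 * pi / A\<^sup>2 * (2 * pi * \<bar>of_int m\<bar> / \<epsilon> * phi'_max * fourier_mass V m))"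
    using Pl_bound[OF Rp V se m] R R_min_max(1) A_pos m
    by (intro mult_left_mono mult_mono divide_left_mono power_mono) auto
  also have "\<dots> = radial_const / \<epsilon> * fourier_mass V m"
    using m by (simp add: radial_const_def power2_eq_square)
  finally show ?thesis .
qed

lemma radial_sum_uniform_limit:
  assumes V: "V \<in> C1 R_min R_max"
  shows "uniform_limit {R_min..R_max} (\<lambda>X R. \<Sum>m\<in>X. radial_term s lam \<epsilon> V m R) (radial_sum s lam \<epsilon> V)
    (finite_subsets_at_top {m. m \<noteq> 0})"
  unfolding radial_sum_def
  by (rule Weierstrass_m_test_general[OF radial_term_bound[OF V]
        summable_on_cmult_right[OF fourier_mass_summable[OF V]]]) auto

lemma continuous_radial_term:
  assumes V: "V \<in> C1 R_min R_max"
  shows "continuous_on {R_min..R_max} (radial_term s lam \<epsilon> V m)"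
proof (cases "m = 0")
  case False
  then show ?thesis unfolding radial_term_def by (intro continuous_intros continuous_F_radial[OF V]) auto
qed (simp add: radial_term_def)

lemma continuous_radial_sum:
  assumes V: "V \<in> C1 R_min R_max"
  shows "continuous_on {R_min..R_max} (radial_sum s lam \<epsilon> V)"
  by (rule uniform_limit_theorem[OF always_eventually radial_sum_uniform_limit[OF V]])
    (auto intro!: continuous_on_sum continuous_radial_term[OF V])

lemma radial_sum_bound:
  assumes V: "V \<in> C1 R_min R_max" and R: "R \<in> {R_min..R_max}"
  shows "norm (radial_sum s lam \<epsilon> V R) \<le> radial_const / \<epsilon> * (mass_const * C1_norm R_min R_max V)"
proof (rule Lim_norm_ubound[OF _ tendsto_uniform_limitI[OF radial_sum_uniform_limit[OF V] R]])
  show "\<forall>\<^sub>F X in finite_subsets_at_top {m. m \<noteq> 0}. norm (\<Sum>m\<in>X. radial_term s lam \<epsilon> V m R)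
      \<le> radial_const / \<epsilon> * (mass_const * C1_norm R_min R_max V)"
  proof (rule eventually_finite_subsets_at_top_weakI)
    fix X :: "int set" assume X: "finite X" "X \<subseteq> {m. m \<noteq> 0}"
    have "norm (\<Sum>m\<in>X. radial_term s lam \<epsilon> V m R) \<le> (\<Sum>m\<in>X. radial_const / \<epsilon> * fourier_mass V m)"
      using X by (intro sum_norm_le radial_term_bound[OF V _ R]) auto
    also have "\<dots> = radial_const / \<epsilon> * (\<Sum>m\<in>X. fourier_mass V m)" by (rule sum_distrib_left[symmetric])
    also have "\<dots> \<le> radial_const / \<epsilon> * (mass_const * C1_norm R_min R_max V)"
      using X se radial_const_nonneg by (intro mult_left_mono fourier_mass_sum[OF V]) auto
    finally show "norm (\<Sum>m\<in>X. radial_term s lam \<epsilon> V m R) \<le> radial_const / \<epsilon> * (mass_const * C1_norm R_min R_max V)" .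
  qed
qed simp

lemma F_radial_integrable:
  assumes V: "V \<in> C1 R_min R_max" and m: "m \<noteq> 0" and R: "R \<in> {R_min..R_max}"
  shows "set_integrable lebesgue {R..R_max} (F_radial s lam \<epsilon> m V)"
  by (rule absolutely_integrable_continuous_real[OF continuous_on_subset[OF continuous_F_radial[OF V m]]]) (use R in auto)

lemma F_term_eq:
  assumes V: "V \<in> C1 R_min R_max" and m: "m \<noteq> 0" and R: "R \<in> {R_min..R_max}"
  shows "F_term s lam \<epsilon> m V R = integral {R..R_max} (radial_term s lam \<epsilon> V m)"
  unfolding F_term_def set_lebesgue_integral_eq_integral(2)[OF F_radial_integrable[OF assms]] radial_term_def
  by (simp only: Henstock_Kurzweil_Integration.integral_mult_right)

text \<open>The finite partial sums converge uniformly in R, so summation over m and integration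
  over r may be exchanged.\<close>

lemma F_term_has_sum:
  assumes V: "V \<in> C1 R_min R_max" and R: "R \<in> {R_min..R_max}"
  shows "((\<lambda>m. F_term s lam \<epsilon> m V R) has_sum integral {R..R_max} (radial_sum s lam \<epsilon> V)) {m. m \<noteq> 0}"
proof -
  have sub: "{R..R_max} \<subseteq> {R_min..R_max}" using R by auto
  obtain I' J' where IJ: "\<And>X. ((\<lambda>R. \<Sum>m\<in>X. radial_term s lam \<epsilon> V m R) has_integral I' X) {R..R_max}"
    "(radial_sum s lam \<epsilon> V has_integral J') {R..R_max}"
    "(I' \<longlongrightarrow> J') (finite_subsets_at_top {m. m \<noteq> 0})"
  proof (rule uniform_limit_integral[OF uniform_limit_on_subset[OF radial_sum_uniform_limit[OF V] sub]])
    show "continuous_on {R..R_max} (\<lambda>R. \<Sum>m\<in>X. radial_term s lam \<epsilon> V m R)" for X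
      by (intro continuous_on_sum continuous_on_subset[OF continuous_radial_term[OF V] sub])
  qed (simp, rule that)
  have "I' X = (\<Sum>m\<in>X. F_term s lam \<epsilon> m V R)" if "finite X" "X \<subseteq> {m. m \<noteq> 0}" for X
  proof -
    have "((\<lambda>R. \<Sum>m\<in>X. radial_term s lam \<epsilon> V m R) has_integral (\<Sum>m\<in>X. F_term s lam \<epsilon> m V R)) {R..R_max}"
    proof (rule has_integral_sum[OF that(1)])
      fix m assume "m \<in> X"
      then have m: "m \<noteq> 0" using that by auto
      show "(radial_term s lam \<epsilon> V m has_integral F_term s lam \<epsilon> m V R) {R..R_max}"
        unfolding F_term_eq[OF V m R]
        by (intro integrable_integral integrable_continuous_real continuous_on_subset[OF continuous_radial_term[OF V] sub])
    qed
    with IJ(1) show ?thesis by (rule has_integral_unique)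
  qed
  then have "\<forall>\<^sub>F X in finite_subsets_at_top {m. m \<noteq> 0}. I' X = (\<Sum>m\<in>X. F_term s lam \<epsilon> m V R)"
    by (intro eventually_finite_subsets_at_top_weakI)
  then have "((\<lambda>X. \<Sum>m\<in>X. F_term s lam \<epsilon> m V R) \<longlongrightarrow> J') (finite_subsets_at_top {m. m \<noteq> 0})"
    by (rule Lim_transform_eventually[OF IJ(3)])
  then show ?thesis
    unfolding has_sum_def using IJ(2) by (simp add: integral_unique)
qed

lemma K_eq:
  assumes "V \<in> C1 R_min R_max" "R \<in> {R_min..R_max}"
  shows "K s lam \<epsilon> V R = integral {R..R_max} (radial_sum s lam \<epsilon> V)"
  using infsumI[OF F_term_has_sum[OF assms]] assms(2) by (simp add: K_def)

text \<open>The outer integration from R to R_max supplies the derivative, so continuity of the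
  Plemelj operator in R suffices for \<open>K V\<close> to be continuously differentiable.\<close>

lemma K_C1:
  assumes V: "V \<in> C1 R_min R_max"
  shows "K s lam \<epsilon> V \<in> C1 R_min R_max"
    and "C1_norm R_min R_max (K s lam \<epsilon> V) \<le> op_const / \<epsilon> * C1_norm R_min R_max V"
proof -
  let ?h = "radial_sum s lam \<epsilon> V" and ?q = "radial_const / \<epsilon> * (mass_const * C1_norm R_min R_max V)"
  note hc = continuous_radial_sum[OF V]
  have int: "?h integrable_on {R_min..R_max}" by (rule integrable_continuous_real[OF hc])
  have Kd: "(K s lam \<epsilon> V has_vector_derivative - ?h R) (at R within {R_min..R_max})" if R: "R \<in> {R_min..R_max}" for R
  proof (rule has_vector_derivative_transform[OF R])
    show "K s lam \<epsilon> V x = integral {R_min..R_max} ?h - integral {R_min..x} ?h" if x: "x \<in> {R_min..R_max}" for x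
      unfolding K_eq[OF V x] using Henstock_Kurzweil_Integration.integral_combine[of R_min x R_max ?h] x int
      by (simp add: algebra_simps)
    show "((\<lambda>x. integral {R_min..R_max} ?h - integral {R_min..x} ?h) has_vector_derivative - ?h R) (at R within {R_min..R_max})"
      using has_vector_derivative_diff[OF has_vector_derivative_const integral_has_vector_derivative[OF hc R]] by simp
  qed
  have zero: "K s lam \<epsilon> V x = 0" if "x \<notin> {R_min..R_max}" for x using that by (auto simp: K_def)
  have mc: "continuous_on {R_min..R_max} (\<lambda>R. - ?h R)" by (intro continuous_intros hc)
  show "K s lam \<epsilon> V \<in> C1 R_min R_max"
    by (rule C1I(1)[OF R_min_max(3) mc zero Kd])
  have vd: "vector_derivative (K s lam \<epsilon> V) (at R within {R_min..R_max}) = - ?h R" if "R \<in> {R_min..R_max}" for R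
    by (rule C1I(2)[OF R_min_max(3) mc zero Kd that])
  have q: "0 \<le> ?q"
    using radial_const_nonneg mass_const_nonneg C1_norm_nonneg[OF V R_min_max(3)] se
    by (intro mult_nonneg_nonneg divide_nonneg_nonneg) auto
  have "C1_norm R_min R_max (K s lam \<epsilon> V) \<le> ?q * B + ?q"
  proof (rule C1_norm_le[OF R_min_max(3)])
    fix R assume R: "R \<in> {R_min..R_max}"
    have sub: "{R..R_max} \<subseteq> {R_min..R_max}" using R by auto
    have "norm (integral {R..R_max} ?h) \<le> ?q * (R_max - R)"
      using R radial_sum_bound[OF V]
      by (intro integral_bound continuous_on_subset[OF hc sub]) auto
    also have "\<dots> \<le> ?q * B"
      using R_min_max(2) R_pos[OF R] by (intro mult_left_mono q) auto
    finally show "norm (K s lam \<epsilon> V R) \<le> ?q * B" unfolding K_eq[OF V R] .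
    show "norm (vector_derivative (K s lam \<epsilon> V) (at R within {R_min..R_max})) \<le> ?q"
      unfolding vd[OF R] norm_minus_cancel by (rule radial_sum_bound[OF V R])
  qed
  also have "?q * B + ?q = op_const / \<epsilon> * C1_norm R_min R_max V"
    by (simp add: op_const_def algebra_simps add_divide_distrib)
  finally show "C1_norm R_min R_max (K s lam \<epsilon> V) \<le> op_const / \<epsilon> * C1_norm R_min R_max V" .
qed

text \<open>Infinite sums are linear where they converge, hence the argument through
  \<open>has_sum\<close> with the sums already identified.\<close>

lemma K_lincomb:
  assumes V: "V \<in> C1 R_min R_max" and Z: "Z \<in> C1 R_min R_max"
  shows "K s lam \<epsilon> (\<lambda>r. c * V r + d * Z r) = (\<lambda>R. c * K s lam \<epsilon> V R + d * K s lam \<epsilon> Z R)"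
proof
  fix R
  note VZ = C1_lincomb(1)[OF V Z R_min_max(3), of c d]
  show "K s lam \<epsilon> (\<lambda>r. c * V r + d * Z r) R = c * K s lam \<epsilon> V R + d * K s lam \<epsilon> Z R"
  proof (cases "R \<in> {R_min..R_max}")
    case R: True
    have sub: "{R..R_max} \<subseteq> {R_min..R_max}" using R by auto
    have "F_term s lam \<epsilon> m (\<lambda>r. c * V r + d * Z r) R = c * F_term s lam \<epsilon> m V R + d * F_term s lam \<epsilon> m Z R" if m: "m \<noteq> 0" for m
    proof -
      have "integral {R..R_max} (radial_term s lam \<epsilon> (\<lambda>r. c * V r + d * Z r) m) =
          integral {R..R_max} (\<lambda>x. c * radial_term s lam \<epsilon> V m x + d * radial_term s lam \<epsilon> Z m x)"
      proof (rule Henstock_Kurzweil_Integration.integral_cong)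
        fix x assume "x \<in> {R..R_max}"
        then have x: "0 < x" using sub R_pos by blast
        show "radial_term s lam \<epsilon> (\<lambda>r. c * V r + d * Z r) m x = c * radial_term s lam \<epsilon> V m x + d * radial_term s lam \<epsilon> Z m x"
          unfolding radial_term_def F_radial_def Pl_lincomb[OF x V Z se m] by (simp only: distrib_left mult_ac)
      qed
      also have "\<dots> = integral {R..R_max} (\<lambda>x. c * radial_term s lam \<epsilon> V m x) + integral {R..R_max} (\<lambda>x. d * radial_term s lam \<epsilon> Z m x)"
        by (intro Henstock_Kurzweil_Integration.integral_add integrable_continuous_real continuous_on_mult continuous_on_const
            continuous_on_subset[OF continuous_radial_term sub] V Z)
      finally show ?thesis
        unfolding F_term_eq[OF V m R] F_term_eq[OF Z m R] F_term_eq[OF VZ m R]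
        by (simp only: Henstock_Kurzweil_Integration.integral_mult_right)
    qed
    then have "((\<lambda>m. F_term s lam \<epsilon> m (\<lambda>r. c * V r + d * Z r) R) has_sum
        c * integral {R..R_max} (radial_sum s lam \<epsilon> V) + d * integral {R..R_max} (radial_sum s lam \<epsilon> Z)) {m. m \<noteq> 0} \<longleftrightarrow>
      ((\<lambda>m. c * F_term s lam \<epsilon> m V R + d * F_term s lam \<epsilon> m Z R) has_sum
        c * integral {R..R_max} (radial_sum s lam \<epsilon> V) + d * integral {R..R_max} (radial_sum s lam \<epsilon> Z)) {m. m \<noteq> 0}"
      by (intro has_sum_cong) auto
    moreover have "((\<lambda>m. c * F_term s lam \<epsilon> m V R + d * F_term s lam \<epsilon> m Z R) has_sum
        c * integral {R..R_max} (radial_sum s lam \<epsilon> V) + d * integral {R..R_max} (radial_sum s lam \<epsilon> Z)) {m. m \<noteq> 0}"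
      by (intro has_sum_add has_sum_cmult_right F_term_has_sum V Z R)
    ultimately have "((\<lambda>m. F_term s lam \<epsilon> m (\<lambda>r. c * V r + d * Z r) R) has_sum
        c * integral {R..R_max} (radial_sum s lam \<epsilon> V) + d * integral {R..R_max} (radial_sum s lam \<epsilon> Z)) {m. m \<noteq> 0}" by blast
    from infsumI[OF this] show ?thesis
      unfolding K_eq[OF V R] K_eq[OF Z R] using R by (simp add: K_def)
  qed (auto simp: K_def)
qed

lemma F_wd: "F_well_defined s lam \<epsilon>"
  unfolding F_well_defined_def
proof (intro ballI conjI allI impI)
  fix V :: "real \<Rightarrow> complex" and R assume V: "V \<in> C1 R_min R_max" and R: "R \<in> {R_min..R_max}"
  show "(\<lambda>m. F_term s lam \<epsilon> m V R) summable_on {m. m \<noteq> 0}"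
    using F_term_has_sum[OF V R] by (rule has_sum_imp_summable)
  fix m :: int assume m: "m \<noteq> 0"
  show "set_integrable lebesgue (J R) (Pl_integrand s lam \<epsilon> m q_yz (VS_yz V m) R)"
    by (rule Pl_eq(1)[OF R_pos[OF R] V se m])
  show "set_integrable lebesgue {R..R_max} (F_radial s lam \<epsilon> m V)"
    by (rule F_radial_integrable[OF V m R])
qed

theorem F_invertible:
  assumes eta: "0 < \<eta>" "2 * (\<eta> * op_const) \<le> \<epsilon>"
  shows "C1_bounded_operator R_min R_max 2 (F s lam \<epsilon>)"
    "bij_betw (F s lam \<epsilon>) (C1 R_min R_max) (C1 R_min R_max)"
    "C1_bounded_operator R_min R_max 2 (inv_into (C1 R_min R_max) (F s lam \<epsilon>))"
proof -
  have K: "C1_bounded_operator R_min R_max (1/2) (\<lambda>V R. of_real \<eta> * K s lam \<epsilon> V R)"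
    unfolding C1_bounded_operator_def
  proof (intro conjI ballI allI)
    have etaK: "(\<lambda>R. of_real \<eta> * K s lam \<epsilon> V R) \<in> C1 R_min R_max"
      "C1_norm R_min R_max (\<lambda>R. of_real \<eta> * K s lam \<epsilon> V R) \<le> \<eta> * C1_norm R_min R_max (K s lam \<epsilon> V)"
      if "V \<in> C1 R_min R_max" for V
      using C1_lincomb[OF K_C1(1)[OF that] K_C1(1)[OF that] R_min_max(3), of "of_real \<eta>" 0] eta by auto
    then show "(\<lambda>V R. of_real \<eta> * K s lam \<epsilon> V R) \<in> C1 R_min R_max \<rightarrow> C1 R_min R_max" by auto
    show "(\<lambda>R. of_real \<eta> * K s lam \<epsilon> (\<lambda>x. V x + Z x) R) = (\<lambda>x. of_real \<eta> * K s lam \<epsilon> V x + of_real \<eta> * K s lam \<epsilon> Z x)"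
      if "V \<in> C1 R_min R_max" "Z \<in> C1 R_min R_max" for V Z
      using K_lincomb[OF that, of 1 1] by (simp add: algebra_simps)
    show "(\<lambda>R. of_real \<eta> * K s lam \<epsilon> (\<lambda>x. c * V x) R) = (\<lambda>x. c * (of_real \<eta> * K s lam \<epsilon> V x))"
      if "V \<in> C1 R_min R_max" for V c
      using K_lincomb[OF that that, of c 0] by (simp add: mult_ac)
    show "C1_norm R_min R_max (\<lambda>R. of_real \<eta> * K s lam \<epsilon> V R) \<le> 1/2 * C1_norm R_min R_max V"
      if V: "V \<in> C1 R_min R_max" for V
    proof -
      have "\<eta> * C1_norm R_min R_max (K s lam \<epsilon> V) \<le> \<eta> * (op_const / \<epsilon> * C1_norm R_min R_max V)"
        using eta by (intro mult_left_mono K_C1(2)[OF V]) auto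
      also have "\<dots> = (\<eta> * op_const / \<epsilon>) * C1_norm R_min R_max V" by simp
      also have "\<dots> \<le> 1/2 * C1_norm R_min R_max V"
        using eta se by (intro mult_right_mono C1_norm_nonneg[OF V R_min_max(3)]) (simp add: field_simps)
      finally show ?thesis using etaK(2)[OF V] by linarith
    qed
  qed
  \<comment> \<open>Outside the interval both sides vanish, because elements of \<open>C1\<close>
    are extended by 0.\<close>
  have F: "F s lam \<epsilon> V = (\<lambda>x. V x - of_real \<eta> * K s lam \<epsilon> V x)" if "V \<in> C1 R_min R_max" for V
    using C1D(1)[OF that R_min_max(3)] by (auto simp: F_def K_def)
  from C1_bounded_operator_inverse[OF R_min_max(3) K F]
  show "C1_bounded_operator R_min R_max 2 (F s lam \<epsilon>)"
    "bij_betw (F s lam \<epsilon>) (C1 R_min R_max) (C1 R_min R_max)"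
    "C1_bounded_operator R_min R_max 2 (inv_into (C1 R_min R_max) (F s lam \<epsilon>))" by auto
qed

end

end

theorem proposition6p12:
  fixes M L0 \<kappa> \<mu> \<nu> :: real
  assumes "0 < M" and "0 < L0"
    and "- (2 powr (- 2 / 3)) * (M\<^sup>2 / (2 * L0)) < \<kappa>" and "\<kappa> < 0"
    and "2 < \<mu>" and "1 < \<nu>"
  shows "\<exists>C. \<forall>\<epsilon>>0. \<exists>\<eta>0>0. \<forall>\<eta>. 0 < \<eta> \<and> \<eta> < \<eta>0 \<longrightarrow>
    (\<forall>(U :: real \<Rightarrow> real) E0.
      point_mass_vlasov_poisson.steady_state M L0 \<kappa> \<mu> \<nu> \<eta> U E0 \<longrightarrow>
      (let Rmin = point_mass_vlasov_poisson.R_min M L0 \<mu> \<nu> U E0;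
           Rmax = point_mass_vlasov_poisson.R_max M L0 \<mu> \<nu> U E0
       in \<forall>lam \<in> point_mass_vlasov_poisson.sigma M L0 \<mu> \<nu> U E0. \<forall>s\<in>{1, - 1}.
        (let F = point_mass_vlasov_poisson.F M L0 \<mu> \<nu> \<eta> U E0 s lam \<epsilon>
         in point_mass_vlasov_poisson.F_well_defined M L0 \<mu> \<nu> U E0 s lam \<epsilon> \<and>
            C1_bounded_operator Rmin Rmax C F \<and>
            bij_betw F (C1 Rmin Rmax) (C1 Rmin Rmax) \<and>
            C1_bounded_operator Rmin Rmax C (inv_into (C1 Rmin Rmax) F))))"
proof -
  have par: "0 < M" "0 < L0" "\<kappa> < 0" "2 < \<mu>" "1 < \<nu>" by fact+
  obtain C where C: "0 \<le> C"
    "\<And>\<eta> U E0. 0 < \<eta> \<Longrightarrow> \<eta> \<le> 1 \<Longrightarrow> point_mass_vlasov_poisson.steady_state M L0 \<kappa> \<mu> \<nu> \<eta> U E0 \<Longrightarrow>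
      8 * (C * \<eta>) \<le> - \<kappa> \<Longrightarrow> 16 * (C * \<eta>) * M \<le> \<kappa>\<^sup>2 \<Longrightarrow> C * \<eta> < \<kappa> + M\<^sup>2 / (2 * L0) \<Longrightarrow>
      \<exists>Y1 Y2 Y3. near_kepler M L0 \<kappa> \<mu> \<nu> U E0 Y1 Y2 Y3 (C * \<eta>)"
    using steady_state_near_kepler[OF par] by metis
  \<comment> \<open>From the hypothesis, kappa lies strictly above - M^2 / (2 L0), the energy of the
    circular Kepler orbit with L = L0. The distance \<open>gap\<close> is part of the budget for
    eta.\<close>
  have "(2 :: real) powr (- 2 / 3) \<le> 1"
    using powr_mono[of "- 2 / 3" 0 "2 :: real"] by simp
  then have "2 powr (- 2 / 3) * (M\<^sup>2 / (2 * L0)) \<le> 1 * (M\<^sup>2 / (2 * L0))"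
    using par by (intro mult_right_mono) auto
  then have gap: "0 < \<kappa> + M\<^sup>2 / (2 * L0)" using assms(3) by simp
  \<comment> \<open>A common bound for C * eta under which the three smallness conditions of
    \<open>near_kepler\<close> hold.\<close>
  define a where "a = min (- \<kappa> / 8) (min (\<kappa>\<^sup>2 / (16 * M)) ((\<kappa> + M\<^sup>2 / (2 * L0)) / 2))"
  have a: "0 < a" using par gap by (auto simp: a_def)
  have a_le: "8 * a \<le> - \<kappa>" "16 * a * M \<le> \<kappa>\<^sup>2" "a < \<kappa> + M\<^sup>2 / (2 * L0)"
  proof -
    have "a \<le> - \<kappa> / 8" "a \<le> \<kappa>\<^sup>2 / (16 * M)" "a \<le> (\<kappa> + M\<^sup>2 / (2 * L0)) / 2"
      unfolding a_def by (blast intro: min.cobounded1 min.coboundedI2 min.cobounded2)+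
    then show "8 * a \<le> - \<kappa>" "16 * a * M \<le> \<kappa>\<^sup>2" "a < \<kappa> + M\<^sup>2 / (2 * L0)"
      using par gap by (auto simp: pos_le_divide_eq mult_ac)
  qed
  \<comment> \<open>\<open>op_const\<close> is built from M, L0, kappa, mu and nu alone, so it can
    be fixed before epsilon, eta and the steady state are chosen.\<close>
  define Q where "Q = near_kepler.op_const M L0 \<kappa> \<mu> \<nu>"
  show ?thesis
  proof (rule exI[of _ 2], intro allI impI)
    fix \<epsilon> :: real assume eps: "0 < \<epsilon>"
    \<comment> \<open>The three entries secure eta <= 1, C * eta <= a, and 2 * eta * Q <= epsilon.
      Adding 1 in the denominators keeps them positive.\<close>
    define \<eta>0 where "\<eta>0 = min 1 (min (a / (C + 1)) (\<epsilon> / (2 * (\<bar>Q\<bar> + 1))))"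
    have "0 < \<eta>0" unfolding \<eta>0_def using a C(1) eps by (auto intro!: divide_pos_pos)
    moreover have "let Rmin = point_mass_vlasov_poisson.R_min M L0 \<mu> \<nu> U E0;
           Rmax = point_mass_vlasov_poisson.R_max M L0 \<mu> \<nu> U E0
       in \<forall>lam \<in> point_mass_vlasov_poisson.sigma M L0 \<mu> \<nu> U E0. \<forall>s\<in>{1, - 1}.
        (let F = point_mass_vlasov_poisson.F M L0 \<mu> \<nu> \<eta> U E0 s lam \<epsilon>
         in point_mass_vlasov_poisson.F_well_defined M L0 \<mu> \<nu> U E0 s lam \<epsilon> \<and>
            C1_bounded_operator Rmin Rmax 2 F \<and>
            bij_betw F (C1 Rmin Rmax) (C1 Rmin Rmax) \<and>
            C1_bounded_operator Rmin Rmax 2 (inv_into (C1 Rmin Rmax) F))"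
      if eta: "0 < \<eta> \<and> \<eta> < \<eta>0" and ss: "point_mass_vlasov_poisson.steady_state M L0 \<kappa> \<mu> \<nu> \<eta> U E0"
      for \<eta> :: real and U :: "real \<Rightarrow> real" and E0 :: real
    proof -
      have e: "0 < \<eta>" "\<eta> < 1" "\<eta> < a / (C + 1)" "\<eta> < \<epsilon> / (2 * (\<bar>Q\<bar> + 1))"
        using eta by (auto simp: \<eta>0_def)
      have "\<eta> * (C + 1) < a" using e(3) C(1) by (simp add: pos_less_divide_eq)
      then have Ca: "C * \<eta> \<le> a" using e(1) by (simp add: algebra_simps)
      have "16 * (C * \<eta>) * M \<le> 16 * a * M" using Ca par by simp
      then obtain Y1 Y2 Y3 where nk: "near_kepler M L0 \<kappa> \<mu> \<nu> U E0 Y1 Y2 Y3 (C * \<eta>)"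
        using C(2)[OF e(1) less_imp_le[OF e(2)] ss] Ca a_le by auto
      interpret near_kepler M L0 \<kappa> \<mu> \<nu> \<eta> U E0 Y1 Y2 Y3 "C * \<eta>" by (rule nk)
      have "\<eta> * (2 * (\<bar>Q\<bar> + 1)) < \<epsilon>" using e(4) by (simp add: pos_less_divide_eq)
      moreover have "\<eta> * Q \<le> \<eta> * (\<bar>Q\<bar> + 1)" using e(1) by (intro mult_left_mono) auto
      ultimately have "2 * (\<eta> * Q) \<le> \<epsilon>"
        using distrib_left[of \<eta> "\<bar>Q\<bar>" 1] by (simp add: algebra_simps)
      then have Q: "2 * (\<eta> * op_const) \<le> \<epsilon>" unfolding Q_def .
      show ?thesis
        unfolding Let_def using F_wd[OF _ eps] F_invertible[OF _ eps e(1) Q] by blast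
    qed
    ultimately show "\<exists>\<eta>0>0. \<forall>\<eta>. 0 < \<eta> \<and> \<eta> < \<eta>0 \<longrightarrow>
    (\<forall>(U :: real \<Rightarrow> real) E0.
      point_mass_vlasov_poisson.steady_state M L0 \<kappa> \<mu> \<nu> \<eta> U E0 \<longrightarrow>
      (let Rmin = point_mass_vlasov_poisson.R_min M L0 \<mu> \<nu> U E0;
           Rmax = point_mass_vlasov_poisson.R_max M L0 \<mu> \<nu> U E0
       in \<forall>lam \<in> point_mass_vlasov_poisson.sigma M L0 \<mu> \<nu> U E0. \<forall>s\<in>{1, - 1}.
        (let F = point_mass_vlasov_poisson.F M L0 \<mu> \<nu> \<eta> U E0 s lam \<epsilon>
         in point_mass_vlasov_poisson.F_well_defined M L0 \<mu> \<nu> U E0 s lam \<epsilon> \<and>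
            C1_bounded_operator Rmin Rmax 2 F \<and>
            bij_betw F (C1 Rmin Rmax) (C1 Rmin Rmax) \<and>
            C1_bounded_operator Rmin Rmax 2 (inv_into (C1 Rmin Rmax) F))))" by blast
  qed
qed

end
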